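(* Let $s\in(0,1]$ and $p\in[1,+\infty)$ be such that $sp<N$ and $s\neq p$. Let $\Omega\subset\mathbb{R}^N$ be an open and bounded domain with Lipschitz boundary. Let $\widetilde s,\widetilde p$ satisfy $$0\le\widetilde s<s\qquad\text{and}\qquad 1\le\widetilde p<\frac{Np}{N-(s-\widetilde s)p}.$$ Then the space $W^{s,p}(\Omega)$ is compactly embedded in $W^{\widetilde s,\widetilde p}(\Omega)$. Moreover, the curve $\gamma:[0,1]\to\mathbb{R}^2$ defined as $$\gamma(\theta):=(s_\theta,p_\theta)=\left(\theta\widetilde s+(1-\theta)s,\ \frac{p\,\widetilde p}{\widetilde p+\theta(p-\widetilde p)}\right)$$ is such that, if $0<\theta_1<\theta_2\le1$, then the space $W^{s_{\theta_1},p_{\theta_1}}(\Omega)$ is compactly embedded in $W^{s_{\theta_2},p_{\theta_2}}(\Omega)$.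
   Context: $N\ge1$ is an integer and functions are real-valued and measurable. For $s\in[0,1]$ and $p\in[1,+\infty)$ define $[u]_{W^{0,p}(\Omega)}:=\|u\|_{L^p(\Omega)}$, $[u]_{W^{1,p}(\Omega)}:=\|\nabla u\|_{L^p(\Omega)}$ (weak gradient) and, for $s\in(0,1)$, $$[u]_{W^{s,p}(\Omega)}:=\left(c_{N,s,p}\iint_{\Omega\times\Omega}\frac{|u(x)-u(y)|^p}{|x-y|^{N+sp}}\,dx\,dy\right)^{1/p},\qquad c_{N,s,p}:=\frac{s\,2^{2s-1}\,\Gamma\left(\frac{ps+p+N-2}{2}\right)}{\pi^{N/2}\,\Gamma(1-s)}.$$ Set $W^{s,p}(\Omega):=\{u\in L^p(\Omega):[u]_{W^{s,p}(\Omega)}<+\infty\}$, with norm $\|u\|_{W^{0,p}(\Omega)}:=\|u\|_{L^p(\Omega)}$ if $s=0$ and $\|u\|_{W^{s,p}(\Omega)}:=\big([u]^p_{W^{s,p}(\Omega)}+\|u\|^p_{L^p(\Omega)}\big)^{1/p}$ if $s\in(0,1]$. *)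

theory Defs
  imports "HOL-Analysis.Analysis"
begin

section \<open>Lipschitz domains\<close>

text \<open>Near every boundary point, \<open>\<Omega>\<close> is the strict epigraph, in the direction of a unit vector
  \<open>e\<close>, of a Lipschitz function on the hyperplane orthogonal to \<open>e\<close>; the point
  \<open>x - (x \<bullet> e) *\<^sub>R e\<close> is the orthogonal projection of \<open>x\<close> onto that hyperplane.\<close>

definition lipschitz_boundary :: "'a::euclidean_space set \<Rightarrow> bool" where
  "lipschitz_boundary \<Omega> \<longleftrightarrow>
     (\<forall>x0\<in>frontier \<Omega>. \<exists>r>0. \<exists>e g L. norm e = 1 \<and>
        L-lipschitz_on {y. y \<bullet> e = 0} (g :: 'a \<Rightarrow> real) \<and>
        \<Omega> \<inter> ball x0 r = {x \<in> ball x0 r. g (x - (x \<bullet> e) *\<^sub>R e) < x \<bullet> e})"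

section \<open>Weak gradients\<close>

definition partial_deriv :: "'a::euclidean_space \<Rightarrow> ('a \<Rightarrow> real) \<Rightarrow> 'a \<Rightarrow> real" where
  "partial_deriv b f x = frechet_derivative f (at x) b"

primrec Ck :: "nat \<Rightarrow> ('a::euclidean_space \<Rightarrow> real) \<Rightarrow> bool" where
  "Ck 0 f \<longleftrightarrow> continuous_on UNIV f"
| "Ck (Suc k) f \<longleftrightarrow> f differentiable_on UNIV \<and> (\<forall>b\<in>Basis. Ck k (partial_deriv b f))"

definition test_function :: "'a::euclidean_space set \<Rightarrow> ('a \<Rightarrow> real) \<Rightarrow> bool" where
  "test_function \<Omega> \<phi> \<longleftrightarrow>
     (\<forall>k. Ck k \<phi>) \<and> compact (closure {x. \<phi> x \<noteq> 0}) \<and> closure {x. \<phi> x \<noteq> 0} \<subseteq> \<Omega>"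

definition locally_integrable ::
    "'a::euclidean_space set \<Rightarrow> ('a \<Rightarrow> 'b::euclidean_space) \<Rightarrow> bool" where
  "locally_integrable \<Omega> f \<longleftrightarrow> (\<forall>K. compact K \<and> K \<subseteq> \<Omega> \<longrightarrow> f absolutely_integrable_on K)"

definition has_weak_gradient ::
    "'a::euclidean_space set \<Rightarrow> ('a \<Rightarrow> real) \<Rightarrow> ('a \<Rightarrow> 'a) \<Rightarrow> bool" where
  "has_weak_gradient \<Omega> u g \<longleftrightarrow>
     locally_integrable \<Omega> u \<and> locally_integrable \<Omega> g \<and>
     (\<forall>\<phi> b. test_function \<Omega> \<phi> \<longrightarrow> b \<in> Basis \<longrightarrow>
        (\<integral>x. u x * partial_deriv b \<phi> x \<partial>lebesgue_on \<Omega>) =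
        - (\<integral>x. (g x \<bullet> b) * \<phi> x \<partial>lebesgue_on \<Omega>))"

text \<open>For open \<open>\<Omega>\<close>, weak gradients are unique up to null sets, so the choice is immaterial.\<close>

definition weak_gradient ::
    "'a::euclidean_space set \<Rightarrow> ('a \<Rightarrow> real) \<Rightarrow> 'a \<Rightarrow> 'a" where
  "weak_gradient \<Omega> u = (SOME g. has_weak_gradient \<Omega> u g)"

section \<open>Sobolev spaces of order in \<open>[0,1]\<close>\<close>

text \<open>Norms and seminorms take values in \<open>[0,\<infinity>]\<close>, so that ``finite seminorm'' is meaningful.
  Elements of the spaces are functions rather than classes modulo null sets; only their
  restriction to \<open>\<Omega>\<close> matters.\<close>

definition ennpowr :: "ennreal \<Rightarrow> real \<Rightarrow> ennreal" where
  "ennpowr x a = (if x = \<infinity> then \<infinity> else ennreal (enn2real x powr a))"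

definition Lp_norm ::
    "real \<Rightarrow> 'a::euclidean_space set \<Rightarrow> ('a \<Rightarrow> 'b::euclidean_space) \<Rightarrow> ennreal" where
  "Lp_norm p \<Omega> f = ennpowr (\<integral>\<^sup>+x. ennreal (norm (f x) powr p) \<partial>lebesgue_on \<Omega>) (1 / p)"

definition Lp_space :: "real \<Rightarrow> 'a::euclidean_space set \<Rightarrow> ('a \<Rightarrow> real) set" where
  "Lp_space p \<Omega> = {u. u \<in> borel_measurable (lebesgue_on \<Omega>) \<and> Lp_norm p \<Omega> u < \<infinity>}"

definition gagliardo_const :: "nat \<Rightarrow> real \<Rightarrow> real \<Rightarrow> real" where
  "gagliardo_const N s p =
     s * 2 powr (2 * s - 1) * Gamma ((p * s + p + real N - 2) / 2) /
     (pi powr (real N / 2) * Gamma (1 - s))"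

text \<open>The integrand is \<open>0\<close> on the (null) diagonal, since division by zero yields \<open>0\<close>.\<close>

definition gagliardo_seminorm ::
    "real \<Rightarrow> real \<Rightarrow> 'a::euclidean_space set \<Rightarrow> ('a \<Rightarrow> real) \<Rightarrow> ennreal" where
  "gagliardo_seminorm s p \<Omega> u =
     ennpowr (ennreal (gagliardo_const DIM('a) s p) *
       (\<integral>\<^sup>+(x, y). ennreal (\<bar>u x - u y\<bar> powr p / norm (x - y) powr (real DIM('a) + s * p))
          \<partial>(lebesgue_on \<Omega> \<Otimes>\<^sub>M lebesgue_on \<Omega>))) (1 / p)"

text \<open>A function without a weak gradient has infinite seminorm of order one.\<close>

definition sobolev_seminorm ::
    "real \<Rightarrow> real \<Rightarrow> 'a::euclidean_space set \<Rightarrow> ('a \<Rightarrow> real) \<Rightarrow> ennreal" where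
  "sobolev_seminorm s p \<Omega> u =
     (if s = 0 then Lp_norm p \<Omega> u
      else if s = 1 then
        (if \<exists>g. has_weak_gradient \<Omega> u g then Lp_norm p \<Omega> (weak_gradient \<Omega> u) else \<infinity>)
      else gagliardo_seminorm s p \<Omega> u)"

definition sobolev_space ::
    "real \<Rightarrow> real \<Rightarrow> 'a::euclidean_space set \<Rightarrow> ('a \<Rightarrow> real) set" where
  "sobolev_space s p \<Omega> = {u \<in> Lp_space p \<Omega>. sobolev_seminorm s p \<Omega> u < \<infinity>}"

definition sobolev_norm ::
    "real \<Rightarrow> real \<Rightarrow> 'a::euclidean_space set \<Rightarrow> ('a \<Rightarrow> real) \<Rightarrow> ennreal" where
  "sobolev_norm s p \<Omega> u =
     (if s = 0 then Lp_norm p \<Omega> u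
      else ennpowr (ennpowr (sobolev_seminorm s p \<Omega> u) p + ennpowr (Lp_norm p \<Omega> u) p) (1 / p))"

section \<open>Compact embeddings\<close>

text \<open>\<open>X\<close> and \<open>Y\<close> are function spaces with (semi)norms \<open>nX\<close> and \<open>nY\<close>: the inclusion is continuous,
  and every \<open>nX\<close>-bounded sequence has a subsequence that \<open>nY\<close>-converges to an element of \<open>Y\<close>.\<close>

definition compactly_embedded ::
    "('a \<Rightarrow> real) set \<Rightarrow> (('a \<Rightarrow> real) \<Rightarrow> ennreal) \<Rightarrow>
     ('a \<Rightarrow> real) set \<Rightarrow> (('a \<Rightarrow> real) \<Rightarrow> ennreal) \<Rightarrow> bool" where
  "compactly_embedded X nX Y nY \<longleftrightarrow>
     X \<subseteq> Y \<and>
     (\<exists>C::real. \<forall>u\<in>X. nY u \<le> ennreal C * nX u) \<and>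
     (\<forall>(u :: nat \<Rightarrow> 'a \<Rightarrow> real) (M::real).
        (\<forall>n. u n \<in> X \<and> nX (u n) \<le> ennreal M) \<longrightarrow>
        (\<exists>v\<in>Y. \<exists>r. strict_mono (r :: nat \<Rightarrow> nat) \<and>
           (\<lambda>k. nY (\<lambda>x. u (r k) x - v x)) \<longlonglongrightarrow> 0))"

definition sobolev_compactly_embedded ::
    "'a::euclidean_space set \<Rightarrow> real \<times> real \<Rightarrow> real \<times> real \<Rightarrow> bool" where
  "sobolev_compactly_embedded \<Omega> = (\<lambda>(s, p) (s', p').
     compactly_embedded (sobolev_space s p \<Omega>) (sobolev_norm s p \<Omega>)
       (sobolev_space s' p' \<Omega>) (sobolev_norm s' p' \<Omega>))"

end

theory Submission
  imports Defs "HOL-Complex_Analysis.Great_Picard"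
begin

text \<open>
  Let \<open>n\<close> be the dimension and \<open>D x = \<integral> \<bar>u x - u y\<bar>\<^sup>p / \<bar>x - y\<bar>\<^bsup>n + s p\<^esup> dy\<close>, so that \<open>\<integral> D \<le> 1\<close> on the unit
  ball of the fractional space. A Lipschitz domain satisfies \<open>\<bar>\<Omega> \<inter> B(x, t)\<bar> \<ge> c t\<^sup>n\<close>, and this alone
  yields, by a chain of Markov inequalities over dyadic scales, \<open>\<bar>u x\<bar> \<le> K t\<^bsup>s - n / p\<^esup>\<close> whenever
  \<open>D x \<le> m t\<^bsup>- n\<^esup>\<close>, and the same bound for \<open>\<bar>u x - u y\<bar>\<close> if \<open>\<bar>x - y\<bar> \<le> t\<close> and \<open>D y \<le> m t\<^bsup>- n\<^esup>\<close>.
  Optimising in \<open>t\<close>, as in Hedberg's inequality, bounds the integrand of the target seminorm by that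
  of the source plus \<open>D\<close> times an integrable kernel, for all subcritical exponents.
  Comparing \<open>u\<close> with its averages over small balls makes bounded sequences precompact in \<open>L\<^sup>1\<close>; an
  almost everywhere convergent subsequence then converges in the target norm, because it is bounded
  in a slightly stronger subcritical norm on a space of finite measure.
  The case \<open>s = 1\<close> is reduced to an order \<open>\<sigma> < 1\<close> close to \<open>1\<close>: testing the weak gradient \<open>g\<close> with
  products of smooth bumps gives \<open>u (x + f) - u x = \<integral>\<^sub>0\<^sup>1 g (x + \<tau> f) \<bullet> f d\<tau>\<close> for almost every \<open>x\<close> whose segment
  lies in \<open>\<Omega>\<close>, and the uniform cone condition connects nearby points by two such segments.
  Finally, \<open>s\<^sub>\<theta>\<close> and \<open>1 / p\<^sub>\<theta>\<close> are affine in \<open>\<theta>\<close>, so the second claim is the first one with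
  \<open>(s\<^sub>\<theta>, p\<^sub>\<theta>)\<close> at the smaller parameter as source.
\<close>

section \<open>Singular kernels\<close>

text \<open>The guiding quantity is the differential dimension \<open>n / p - s\<close>: the bound
  on \<open>p'\<close> says exactly that \<open>n / p - s < n / p' - s'\<close>. Strictness pays for
  every loss: replacing \<open>s = 1\<close> by \<open>\<sigma> < 1\<close>, replacing
  \<open>s' = 0\<close> by a small positive order, and asking for slightly more than
  \<open>(s', p')\<close> when almost everywhere convergence is turned into norm convergence. It is
  also what makes \<open>e\<close> positive in the kernels |x - y|^(e - n). All fractional estimates
  live on an abstract measure with n-dimensional ball growth. The boundary of the domain enters only
  through a cone condition, once for the measure density and once for order one. Estimates are
  proved on unit balls with unspecified constants, and homogeneity restores the norms at the end.
  For order one the obstacle is measure theoretic: the definitions use completed Lebesgue measure on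
  \<open>\<Omega>\<close>, while translations and Fubini are applied to Borel functions on the whole
  space. Hence the Borel representatives, and the truncation to a compact set containing the
  segments, which makes the integrals finite.\<close>

lemma single_le_suminf: "f k \<le> (\<Sum>k. f k)" for f :: "nat \<Rightarrow> ennreal"
  using sum_le_suminf[of f "{k}"] by simp

text \<open>Summation over dyadic shells. On the k-th shell the kernel is at most
  \<open>a k\<close>, the shell lies in the ball of radius \<open>\<rho> k\<close>, and the growth
  bound turns the sum into a geometric series with ratio 2^(-e). The upper bound on \<open>e\<close>
  makes the kernel nonincreasing in the distance; larger exponents are reduced to this case in
  \<open>kernel_integral_bound\<close>.\<close>

lemma singular_integral_bound:
  fixes M :: "'a::euclidean_space measure"
  assumes sets: "\<And>x t. ball x t \<inter> space M \<in> sets M"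
    and up: "\<And>x t. 0 < t \<Longrightarrow> emeasure M (ball x t \<inter> space M) \<le> ennreal (C * t powr DIM('a))"
    and e: "0 < e" "e \<le> real DIM('a)"
  shows "\<exists>K\<ge>0. \<forall>x. (\<integral>\<^sup>+y. ennreal (norm (x - y) powr (e - DIM('a))) * indicator (ball x 1) y \<partial>M)
           \<le> ennreal K"
proof -
  define n where "n = real DIM('a)"
  define a where "a k = 2 powr ((real k + 1) * (n - e))" for k :: nat
  \<comment> \<open>Twice the outer radius 2^(-k) of the shell, so that the open ball also catches
    points at distance exactly 2^(-k).\<close>
  define \<rho> where "\<rho> k = 2 powr (1 - real k)" for k :: nat
  define D where "D = \<bar>C\<bar> * 2 powr (2 * n - e)"
  have pw: "ennreal (norm (x - y) powr (e - n)) * indicator (ball x 1) y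
      \<le> (\<Sum>k. ennreal (a k) * indicator (ball x (\<rho> k) \<inter> space M) y)" if "y \<in> space M" for x y :: 'a
  proof (cases "0 < norm (x - y) \<and> norm (x - y) < 1")
    case True
    define r where "r = norm (x - y)"
    define k where "k = nat \<lfloor>- log 2 r\<rfloor>"
    have r: "0 < r" "r < 1" using True by (auto simp: r_def)
    have "log 2 r < 0" using r by simp
    hence k: "real k \<le> - log 2 r" "- log 2 r < real k + 1" by (auto simp: k_def)
    have r2: "r = 2 powr (log 2 r)" using r by simp
    have "r < \<rho> k" unfolding \<rho>_def by (subst r2, subst powr_less_cancel_iff) (use k in auto)
    hence ind: "indicator (ball x (\<rho> k) \<inter> space M) y = (1::ennreal)"
      using that by (auto simp: r_def dist_norm)
    have "r powr (e - n) \<le> a k"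
      unfolding a_def
      by (subst r2, subst powr_powr, subst powr_le_cancel_iff)
        (use k e mult_right_mono[of "- log 2 r" "real k + 1" "n - e"] in \<open>auto simp: n_def algebra_simps\<close>)
    hence "ennreal (norm (x - y) powr (e - n)) * indicator (ball x 1) y
       \<le> ennreal (a k) * indicator (ball x (\<rho> k) \<inter> space M) y"
      unfolding ind using True by (auto simp: r_def dist_norm ennreal_leI)
    also have "\<dots> \<le> (\<Sum>k. ennreal (a k) * indicator (ball x (\<rho> k) \<inter> space M) y)"
      by (rule single_le_suminf)
    finally show ?thesis .
  next
    case False
    then show ?thesis by (auto simp: dist_norm indicator_def)
  qed
  have "(\<integral>\<^sup>+y. ennreal (norm (x - y) powr (e - n)) * indicator (ball x 1) y \<partial>M)
     \<le> ennreal (D * (\<Sum>k. (2 powr - e) ^ k))" for x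
  proof -
    have sm: "summable (\<lambda>k. (2 powr - e) ^ k)" using e by (intro summable_geometric) (auto simp: powr_less_one)
    have "(\<integral>\<^sup>+y. ennreal (norm (x - y) powr (e - n)) * indicator (ball x 1) y \<partial>M)
       \<le> (\<integral>\<^sup>+y. (\<Sum>k. ennreal (a k) * indicator (ball x (\<rho> k) \<inter> space M) y) \<partial>M)"
      by (intro nn_integral_mono pw)
    also have "\<dots> = (\<Sum>k. ennreal (a k) * emeasure M (ball x (\<rho> k) \<inter> space M))"
      using sets by (subst nn_integral_suminf) (auto simp: nn_integral_cmult_indicator)
    also have "\<dots> \<le> (\<Sum>k. ennreal (D * (2 powr - e) ^ k))"
    proof (intro suminf_le)
      fix k
      have "ennreal (a k) * emeasure M (ball x (\<rho> k) \<inter> space M) \<le> ennreal (a k) * ennreal (\<bar>C\<bar> * \<rho> k powr n)"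
        by (intro mult_left_mono order_trans[OF up]) (auto simp: \<rho>_def n_def intro!: ennreal_leI mult_right_mono)
      also have "\<dots> = ennreal (a k * (\<bar>C\<bar> * \<rho> k powr n))" by (simp add: a_def ennreal_mult)
      also have "a k * (\<bar>C\<bar> * \<rho> k powr n) = \<bar>C\<bar> * 2 powr ((real k + 1) * (n - e) + (1 - real k) * n)"
        by (simp add: a_def \<rho>_def powr_powr powr_add)
      also have "(real k + 1) * (n - e) + (1 - real k) * n = (2 * n - e) + (- e) * real k"
        by (simp add: algebra_simps)
      also have "\<bar>C\<bar> * 2 powr \<dots> = D * (2 powr - e) ^ k"
        unfolding powr_add by (simp add: D_def powr_powr flip: powr_realpow)
      finally show "ennreal (a k) * emeasure M (ball x (\<rho> k) \<inter> space M) \<le> ennreal (D * (2 powr - e) ^ k)" .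
    qed auto
    also have "\<dots> = ennreal (\<Sum>k. D * (2 powr - e) ^ k)"
      by (intro suminf_ennreal2 summable_mult sm) (auto simp: D_def)
    also have "\<dots> = ennreal (D * (\<Sum>k. (2 powr - e) ^ k))"
      by (subst suminf_mult[OF sm]) simp
    finally show ?thesis .
  qed
  thus ?thesis unfolding n_def
    by (intro exI[of _ "max 0 (D * (\<Sum>k. (2 powr - e) ^ k))"]) (meson ennreal_leI max.cobounded1 max.cobounded2 order_trans)
qed

text \<open>Two Markov inequalities at once: each bad set has at most a quarter of \<open>v\<close>.
  If no point were good, 4 would be bounded on \<open>V\<close> by the sum of the two normalised
  functions, whose integral is at most \<open>2 * v\<close>.\<close>

lemma exists_both_small:
  assumes V: "V \<in> sets M" and [measurable]: "h1 \<in> borel_measurable M" "h2 \<in> borel_measurable M"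
    and v: "0 < v" "ennreal v \<le> emeasure M V"
    and A: "0 < A1" "0 < A2"
    and h: "(\<integral>\<^sup>+z. h1 z * indicator V z \<partial>M) \<le> ennreal A1" "(\<integral>\<^sup>+z. h2 z * indicator V z \<partial>M) \<le> ennreal A2"
  shows "\<exists>z\<in>V. h1 z \<le> ennreal (4 * A1 / v) \<and> h2 z \<le> ennreal (4 * A2 / v)"
proof (rule ccontr)
  assume "\<not> ?thesis"
  hence *: "ennreal (4 * A1 / v) < h1 z \<or> ennreal (4 * A2 / v) < h2 z" if "z \<in> V" for z
    using that by (auto simp: not_le)
  note [measurable] = V
  have e4: "ennreal (v / A) * ennreal (4 * A / v) = 4" if "0 < A" for A
    using that v by (simp add: ennreal_mult[symmetric])
  have "4 * indicator V z \<le> ennreal (v / A1) * (h1 z * indicator V z) + ennreal (v / A2) * (h2 z * indicator V z)" for z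
  proof (cases "z \<in> V")
    case True
    from *[OF True] show ?thesis
    proof
      assume "ennreal (4 * A1 / v) < h1 z"
      hence "4 \<le> ennreal (v / A1) * h1 z" using mult_left_mono[of "ennreal (4 * A1 / v)" "h1 z" "ennreal (v / A1)"] e4[OF A(1)] by auto
      thus ?thesis using True by (simp add: add_increasing2)
    next
      assume "ennreal (4 * A2 / v) < h2 z"
      hence "4 \<le> ennreal (v / A2) * h2 z" using mult_left_mono[of "ennreal (4 * A2 / v)" "h2 z" "ennreal (v / A2)"] e4[OF A(2)] by auto
      thus ?thesis using True by (simp add: add_increasing)
    qed
  qed auto
  hence "(\<integral>\<^sup>+z. 4 * indicator V z \<partial>M) \<le> (\<integral>\<^sup>+z. ennreal (v / A1) * (h1 z * indicator V z) + ennreal (v / A2) * (h2 z * indicator V z) \<partial>M)"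
    by (intro nn_integral_mono) auto
  also have "\<dots> = ennreal (v / A1) * (\<integral>\<^sup>+z. h1 z * indicator V z \<partial>M) + ennreal (v / A2) * (\<integral>\<^sup>+z. h2 z * indicator V z \<partial>M)"
    by (subst nn_integral_add) (auto simp: nn_integral_cmult)
  also have "\<dots> \<le> ennreal (v / A1) * ennreal A1 + ennreal (v / A2) * ennreal A2"
    by (intro add_mono mult_left_mono h) auto
  also have "\<dots> = ennreal (2 * v)" using A v by (simp add: ennreal_mult[symmetric] ennreal_plus[symmetric] del: ennreal_plus)
  finally have 1: "4 * emeasure M V \<le> ennreal (2 * v)" by (simp add: nn_integral_cmult_indicator)
  have "4 * ennreal v \<le> 4 * emeasure M V" using v by (intro mult_left_mono) auto
  with 1 have "4 * ennreal v \<le> ennreal (2 * v)" by (rule order_trans[rotated])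
  also have "4 * ennreal v = ennreal (4 * v)" using v by (simp add: ennreal_mult)
  finally show False using v by (simp add: ennreal_le_iff)
qed

section \<open>Fractional embeddings under a measure density condition\<close>

definition diff_quot :: "real \<Rightarrow> real \<Rightarrow> ('a::euclidean_space \<Rightarrow> real) \<Rightarrow> 'a \<Rightarrow> 'a \<Rightarrow> ennreal" where
  "diff_quot s p u x y = ennreal (\<bar>u x - u y\<bar> powr p / norm (x - y) powr (real DIM('a) + s * p))"

text \<open>The p-th power of the Gagliardo seminorm without its constant. The iterated form exposes
  the inner integral, a function of one point that plays the part of the maximal function in
  Hedberg's argument; \<open>energy_eq_pair_integral\<close> gives the double integral.\<close>

definition energy :: "'a::euclidean_space measure \<Rightarrow> real \<Rightarrow> real \<Rightarrow> ('a \<Rightarrow> real) \<Rightarrow> ennreal" where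
  "energy M s p u = (\<integral>\<^sup>+x. \<integral>\<^sup>+y. diff_quot s p u x y \<partial>M \<partial>M)"

definition pintegral :: "'a measure \<Rightarrow> real \<Rightarrow> ('a \<Rightarrow> real) \<Rightarrow> ennreal" where
  "pintegral M p u = (\<integral>\<^sup>+x. ennreal (\<bar>u x\<bar> powr p) \<partial>M)"

text \<open>An abstraction of \<open>lebesgue_on \<Omega>\<close>. \<open>lower\<close> feeds the
  Markov arguments, \<open>upper\<close> the integrability of the kernels, and
  \<open>diameter\<close> gives finite nets and controls kernels whose exponent is not
  singular.\<close>

locale regular_measure = finite_measure M for M :: "'a::euclidean_space measure" +
  fixes c C \<rho> :: real
  assumes id_measurable [measurable]: "(\<lambda>x. x) \<in> borel_measurable M"
    and c_pos: "0 < c"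
    and lower: "x \<in> space M \<Longrightarrow> 0 < t \<Longrightarrow> t \<le> 1 \<Longrightarrow>
      ennreal (c * t powr DIM('a)) \<le> emeasure M (ball x t \<inter> space M)"
    and diameter: "1 \<le> \<rho>" "x \<in> space M \<Longrightarrow> y \<in> space M \<Longrightarrow> norm (x - y) \<le> \<rho>"
    and upper: "0 < t \<Longrightarrow> emeasure M (ball x t \<inter> space M) \<le> ennreal (C * t powr DIM('a))"
begin

lemma ball_sets [measurable]: "ball x t \<inter> space M \<in> sets M"
  using measurable_sets[OF id_measurable, of "ball x t"] by simp

lemma diff_quot_measurable [measurable]:
  assumes [measurable]: "u \<in> borel_measurable M"
  shows "case_prod (diff_quot s p u) \<in> borel_measurable (M \<Otimes>\<^sub>M M)"
  unfolding diff_quot_def split_beta' by measurable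

lemma diff_quot_measurable' [measurable]:
  assumes [measurable]: "u \<in> borel_measurable M" and x: "x \<in> space M"
  shows "diff_quot s p u x \<in> borel_measurable M"
  unfolding diff_quot_def by measurable

lemma diff_int_measurable [measurable]:
  assumes [measurable]: "u \<in> borel_measurable M"
  shows "(\<lambda>x. \<integral>\<^sup>+y. diff_quot s p u x y \<partial>M) \<in> borel_measurable M"
  by (rule borel_measurable_nn_integral) measurable

text \<open>On a ball of radius \<open>R\<close> around \<open>x\<close> the singular weight is at
  least R^(-(n + s p)), so it can be traded for a constant. The point z = x contributes nothing
  because 0 powr p is 0.\<close>

lemma diff_power_integral_le:
  fixes s p R m :: real
  assumes u: "u \<in> borel_measurable M" and x: "x \<in> space M" and R: "0 < R" and V: "V \<subseteq> ball x R"
    and sp: "0 \<le> real DIM('a) + s * p"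
    and d: "(\<integral>\<^sup>+y. diff_quot s p u x y \<partial>M) \<le> ennreal m" and m: "0 \<le> m"
  shows "(\<integral>\<^sup>+z. ennreal (\<bar>u x - u z\<bar> powr p) * indicator V z \<partial>M) \<le> ennreal (R powr (DIM('a) + s * p) * m)"
proof -
  have "ennreal (\<bar>u x - u z\<bar> powr p) * indicator V z \<le> ennreal (R powr (DIM('a) + s * p)) * diff_quot s p u x z" for z
  proof (cases "z \<in> V \<and> z \<noteq> x")
    case True
    define r where "r = norm (x - z)"
    have r: "0 < r" "r < R" using True V by (auto simp: r_def dist_norm)
    have "r powr (DIM('a) + s * p) \<le> R powr (DIM('a) + s * p)" using r sp by (intro powr_mono2) auto
    hence "\<bar>u x - u z\<bar> powr p * r powr (DIM('a) + s * p) \<le> R powr (DIM('a) + s * p) * \<bar>u x - u z\<bar> powr p"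
      by (subst mult.commute) (intro mult_right_mono, auto)
    hence "\<bar>u x - u z\<bar> powr p \<le> R powr (DIM('a) + s * p) * (\<bar>u x - u z\<bar> powr p / r powr (DIM('a) + s * p))"
      using r by (simp add: field_simps)
    thus ?thesis using True by (simp add: diff_quot_def r_def ennreal_mult[symmetric] ennreal_leI)
  qed (auto simp: indicator_def)
  hence "(\<integral>\<^sup>+z. ennreal (\<bar>u x - u z\<bar> powr p) * indicator V z \<partial>M)
     \<le> (\<integral>\<^sup>+z. ennreal (R powr (DIM('a) + s * p)) * diff_quot s p u x z \<partial>M)" by (intro nn_integral_mono)
  also have "\<dots> = ennreal (R powr (DIM('a) + s * p)) * (\<integral>\<^sup>+z. diff_quot s p u x z \<partial>M)"
    using u x by (intro nn_integral_cmult) simp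
  also have "\<dots> \<le> ennreal (R powr (DIM('a) + s * p)) * ennreal m" by (intro mult_left_mono d) auto
  finally show ?thesis using m by (simp add: ennreal_mult)
qed

text \<open>Points where \<open>\<integral> diff_quot s p u x y dy\<close> is at most \<open>m t\<^sup>-\<^sup>n\<close> are good at scale \<open>t\<close>. Inside a
  ball of radius \<open>t\<close> around such a point most points are good at scale \<open>2 t\<close>, so that the values of
  \<open>u\<close> can be compared along a chain of dyadic scales; this replaces averages of \<open>u\<close>.\<close>

lemma pointwise_growth:
  fixes p s :: real
  assumes p: "1 \<le> p" and s: "0 < s" "s * p < DIM('a)"
  obtains m K where "1 \<le> m" "0 \<le> K"
    and "\<And>u t x. \<lbrakk>u \<in> borel_measurable M; pintegral M p u \<le> 1; energy M s p u \<le> 1; 0 < t; t \<le> 1; x \<in> space M;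
      (\<integral>\<^sup>+z. diff_quot s p u x z \<partial>M) \<le> ennreal (m * t powr - real DIM('a))\<rbrakk>
      \<Longrightarrow> \<bar>u x\<bar> \<le> K * t powr (s - DIM('a) / p)"
    and "\<And>u t x y. \<lbrakk>u \<in> borel_measurable M; pintegral M p u \<le> 1; energy M s p u \<le> 1; 0 < t; t \<le> 1;
      x \<in> space M; (\<integral>\<^sup>+z. diff_quot s p u x z \<partial>M) \<le> ennreal (m * t powr - real DIM('a));
      y \<in> space M; (\<integral>\<^sup>+z. diff_quot s p u y z \<partial>M) \<le> ennreal (m * t powr - real DIM('a)); dist x y \<le> t\<rbrakk>
      \<Longrightarrow> \<bar>u x - u y\<bar> \<le> K * t powr (s - DIM('a) / p)"
proof -
  define n where "n = real DIM('a)"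
  define \<beta> where "\<beta> = n / p - s"
  \<comment> \<open>Markov at scale t yields a point whose inner integral is at most 4 / (c t^n) =
    (4 2^n / c) (2 t)^(-n); this \<open>m\<close> makes that point good at scale 2 t.\<close>
  define m where "m = 4 * 2 powr n / c + 1"
  \<comment> \<open>\<open>\<Lambda>\<close> bounds one link of the chain: it is the p-th root of
    Markov's 4 / c times \<open>m\<close> times the weight factor. \<open>K\<close> is a fixed point
    of the recursion, \<open>\<Lambda> + K * 2 powr - \<beta> \<le> K\<close>; its factor 2 covers
    the end of the chain and the comparison of two points, where \<open>\<Lambda>\<close> is paid
    twice.\<close>
  define \<Lambda> where "\<Lambda> = (4 * m * 2 powr (n + s * p) / c) powr (1 / p)"
  define K where "K = 2 * \<Lambda> / (1 - 2 powr - \<beta>)"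
  have n0: "0 < n" by (simp add: n_def)
  have beta: "0 < \<beta>" using s p by (simp add: \<beta>_def n_def field_simps)
  have m: "1 \<le> m" "4 * 2 powr n / c \<le> m" using c_pos by (auto simp: m_def)
  have L0: "0 < \<Lambda>" using m c_pos unfolding \<Lambda>_def by (simp add: powr_gt_zero)
  have b1: "0 < 1 - 2 powr - \<beta>" "1 - 2 powr - \<beta> < 1" using beta by (auto simp: powr_less_one)
  have K0: "0 < K" unfolding K_def using L0 b1 by (intro divide_pos_pos) auto
  have K1: "2 * \<Lambda> \<le> K * (1 - 2 powr - \<beta>)" using b1 beta by (simp add: K_def)
  have K2: "2 * \<Lambda> \<le> K" using K1 b1 K0 mult_left_mono[of "1 - 2 powr - \<beta>" 1 K] by linarith
  have bp: "- (\<beta> * p) = s * p - n" using p by (simp add: \<beta>_def field_simps)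
  have main: "\<bar>u x\<bar> \<le> K * t powr (s - n / p) \<and>
      (\<forall>y\<in>space M. dist x y \<le> t \<longrightarrow> (\<integral>\<^sup>+z. diff_quot s p u y z \<partial>M) \<le> ennreal (m * t powr - n) \<longrightarrow>
         \<bar>u x - u y\<bar> \<le> K * t powr (s - n / p))"
    if u[measurable]: "u \<in> borel_measurable M" and J: "pintegral M p u \<le> 1" and I: "energy M s p u \<le> 1"
      and t: "0 < t" "t \<le> 1" and x: "x \<in> space M" and d: "(\<integral>\<^sup>+z. diff_quot s p u x z \<partial>M) \<le> ennreal (m * t powr - n)"
    for u t x
  proof -
    let ?d = "\<lambda>x. \<integral>\<^sup>+z. diff_quot s p u x z \<partial>M"
    have near: "\<bar>u w - u z\<bar> \<le> \<Lambda> * t powr - \<beta>" 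
      if t: "0 < t" and z: "ennreal (\<bar>u w - u z\<bar> powr p) \<le> ennreal (4 * ((2 * t) powr (n + s * p) * (m * t powr - n)) / (c * t powr n))"
      for w z t
    proof -
      have "\<bar>u w - u z\<bar> powr p \<le> 4 * ((2 * t) powr (n + s * p) * (m * t powr - n)) / (c * t powr n)"
        using z by (subst (asm) ennreal_le_iff) (use m c_pos in auto)
      also have "\<dots> = (4 * m * 2 powr (n + s * p) / c) * (t powr (n + s * p) * t powr - n * t powr - n)"
        using t by (simp add: powr_mult powr_minus field_simps)
      also have "t powr (n + s * p) * t powr - n * t powr - n = t powr (- (\<beta> * p))"
        unfolding bp by (simp add: powr_add[symmetric])
      finally have "(\<bar>u w - u z\<bar> powr p) powr (1 / p) \<le> ((4 * m * 2 powr (n + s * p) / c) * t powr (- (\<beta> * p))) powr (1 / p)"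
        using p by (intro powr_mono2) auto
      also have "\<dots> = \<Lambda> * t powr - \<beta>"
        using p m c_pos by (subst powr_mult) (auto simp: \<Lambda>_def powr_powr)
      finally show ?thesis using p by (simp add: powr_powr)
    qed
    \<comment> \<open>The ball is centred at \<open>x\<close> but the differences are taken from
      \<open>w\<close>, hence the radius 2 t. With \<open>w = x\<close> this serves the chain; with
      another \<open>w\<close> it lets two nearby points share one intermediate point.\<close>
    have dint: "(\<integral>\<^sup>+z. ennreal (\<bar>u w - u z\<bar> powr p) * indicator (ball x t \<inter> space M) z \<partial>M)
        \<le> ennreal ((2 * t) powr (n + s * p) * (m * t powr - n))"
      if "0 < t" "w \<in> space M" "?d w \<le> ennreal (m * t powr - n)" "dist x w \<le> t" for x w t
    proof (rule diff_power_integral_le[OF u, folded n_def])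
      show "ball x t \<inter> space M \<subseteq> ball w (2 * t)"
        using that by (auto simp: dist_commute intro!: order.strict_trans1[OF dist_triangle[of _ _ x]])
    qed (use that s p m n0 in \<open>auto intro!: add_nonneg_nonneg\<close>)
    have pos: "0 < (2 * t) powr (n + s * p) * (m * t powr - n)" if "0 < t" for t
      using that m by (intro mult_pos_pos) auto
    \<comment> \<open>Induction over the number of doublings needed to reach scale one. The case
      \<open>k = 0\<close> is vacuous, as it would require 1 < t and t \<le> 1.\<close>
    have grow: "\<forall>t x. (1/2) ^ k < t \<longrightarrow> t \<le> 1 \<longrightarrow> x \<in> space M \<longrightarrow> ?d x \<le> ennreal (m * t powr - n) \<longrightarrow> \<bar>u x\<bar> \<le> K * t powr - \<beta>" for k
    proof (induction k)
      case (Suc k)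
      show ?case
      proof (intro allI impI)
        fix t :: real and x assume t1: "(1/2) ^ Suc k < t" "t \<le> 1" and x: "x \<in> space M" and d: "?d x \<le> ennreal (m * t powr - n)"
        have t: "0 < t" by (rule order.strict_trans[OF _ t1(1)]) simp
        have cv: "0 < c * t powr n" using c_pos t by simp
        show "\<bar>u x\<bar> \<le> K * t powr - \<beta>"
        proof (cases "2 * t \<le> 1")
          case True
          have "(\<integral>\<^sup>+z. ?d z * indicator (ball x t \<inter> space M) z \<partial>M) \<le> energy M s p u"
            unfolding energy_def by (intro nn_integral_mono) (auto simp: indicator_def)
          hence "(\<integral>\<^sup>+z. ?d z * indicator (ball x t \<inter> space M) z \<partial>M) \<le> ennreal 1" using I by simp
          from exists_both_small[OF ball_sets _ _ cv _ pos[OF t] _ dint[OF t x d] this] lower[OF x t t1(2)]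
          obtain z where z: "z \<in> space M" "ennreal (\<bar>u x - u z\<bar> powr p) \<le> ennreal (4 * ((2 * t) powr (n + s * p) * (m * t powr - n)) / (c * t powr n))"
            and dz: "?d z \<le> ennreal (4 * 1 / (c * t powr n))"
            using t by (auto simp: n_def)
          have "4 * 1 / (c * t powr n) = (4 * 2 powr n / c) * (2 * t) powr - n" using t by (simp add: powr_mult powr_minus field_simps)
          also have "\<dots> \<le> m * (2 * t) powr - n" by (intro mult_right_mono m) auto
          finally have "?d z \<le> ennreal (m * (2 * t) powr - n)" using dz by (meson ennreal_leI order_trans)
          moreover have "(1/2) ^ k < 2 * t" using t1 by simp
          ultimately have "\<bar>u z\<bar> \<le> K * (2 * t) powr - \<beta>" using Suc True z by blast
          also have "\<dots> = (K * 2 powr - \<beta>) * t powr - \<beta>" by (simp add: powr_mult)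
          finally have "\<bar>u x\<bar> \<le> (\<Lambda> + K * 2 powr - \<beta>) * t powr - \<beta>"
            using near[OF t z(2)] by (simp add: algebra_simps)
          also have "\<dots> \<le> K * t powr - \<beta>"
            using K1 L0 by (intro mult_right_mono) (auto simp: algebra_simps)
          finally show ?thesis .
        next
          \<comment> \<open>End of the chain: the scale exceeds 1/2, so the volume of the ball is
            bounded below and the L^p bound itself provides a point with a small value.\<close>
          case False
          have "(\<integral>\<^sup>+z. ennreal (\<bar>u z\<bar> powr p) * indicator (ball x t \<inter> space M) z \<partial>M) \<le> pintegral M p u"
            unfolding pintegral_def by (intro nn_integral_mono) (auto simp: indicator_def)
          hence "(\<integral>\<^sup>+z. ennreal (\<bar>u z\<bar> powr p) * indicator (ball x t \<inter> space M) z \<partial>M) \<le> ennreal 1" using J by simp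
          from exists_both_small[OF ball_sets _ _ cv _ pos[OF t] _ dint[OF t x d] this] lower[OF x t t1(2)]
          obtain z where z: "z \<in> space M" "ennreal (\<bar>u x - u z\<bar> powr p) \<le> ennreal (4 * ((2 * t) powr (n + s * p) * (m * t powr - n)) / (c * t powr n))"
            and uz: "ennreal (\<bar>u z\<bar> powr p) \<le> ennreal (4 * 1 / (c * t powr n))"
            using t by (auto simp: n_def)
          have "\<bar>u z\<bar> powr p \<le> 4 * 1 / (c * t powr n)" using uz cv by (subst (asm) ennreal_le_iff) auto
          also have "\<dots> = (4 * 2 powr n / c) * (2 * t) powr - n" using t by (simp add: powr_mult powr_minus field_simps)
          also have "\<dots> \<le> (4 * 2 powr n / c) * 1"
            using False c_pos n0 by (intro mult_left_mono) (auto simp: powr_minus intro!: inverse_le_1_iff[THEN iffD2] ge_one_powr_ge_zero)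
          also have "\<dots> \<le> 4 * m * 2 powr (n + s * p) / c"
          proof -
            have "2 powr n \<le> 2 powr (n + s * p)" using s p by simp
            also have "\<dots> \<le> m * 2 powr (n + s * p)" using m by simp
            finally show ?thesis using c_pos by (simp add: field_simps)
          qed
          finally have "(\<bar>u z\<bar> powr p) powr (1 / p) \<le> \<Lambda>" unfolding \<Lambda>_def using p by (intro powr_mono2) auto
          hence "\<bar>u z\<bar> \<le> \<Lambda>" using p by (simp add: powr_powr)
          also have "\<dots> \<le> \<Lambda> * t powr - \<beta>" using L0 t t1 beta by (simp add: powr_minus one_le_inverse_iff powr_le1)
          finally have "\<bar>u x\<bar> \<le> (2 * \<Lambda>) * t powr - \<beta>" using near[OF t z(2)] by (simp add: algebra_simps)
          also have "\<dots> \<le> K * t powr - \<beta>" by (intro mult_right_mono K2) auto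
          finally show ?thesis .
        qed
      qed
    qed auto
    have sb: "s - n / p = - \<beta>" by (simp add: \<beta>_def)
    obtain k where "(1/2) ^ k < t" using real_arch_pow_inv[of t "1/2"] t by auto
    hence 1: "\<bar>u x\<bar> \<le> K * t powr - \<beta>" using grow t x d by blast
    have 2: "\<bar>u x - u y\<bar> \<le> K * t powr - \<beta>" if y: "y \<in> space M" "dist x y \<le> t" "?d y \<le> ennreal (m * t powr - n)" for y
    proof -
      have cv: "0 < c * t powr n" using c_pos t by simp
      from exists_both_small[OF ball_sets _ _ cv _ pos[OF t(1)] pos[OF t(1)] dint[OF t(1) x d] dint[OF t(1) y(1,3,2)]] lower[OF x t] x y
      obtain z where z: "ennreal (\<bar>u x - u z\<bar> powr p) \<le> ennreal (4 * ((2 * t) powr (n + s * p) * (m * t powr - n)) / (c * t powr n))"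
          "ennreal (\<bar>u y - u z\<bar> powr p) \<le> ennreal (4 * ((2 * t) powr (n + s * p) * (m * t powr - n)) / (c * t powr n))"
        using t by (auto simp: n_def)
      have "\<bar>u x - u y\<bar> \<le> (2 * \<Lambda>) * t powr - \<beta>" using near[OF t(1) z(1)] near[OF t(1) z(2)] by (simp add: algebra_simps)
      also have "\<dots> \<le> K * t powr - \<beta>" by (intro mult_right_mono K2) auto
      finally show ?thesis .
    qed
    show ?thesis unfolding sb using 1 2 by blast
  qed
  show ?thesis
  proof (rule that[OF m(1) less_imp_le[OF K0], folded n_def])
    show "\<bar>u x\<bar> \<le> K * t powr (s - n / p)"
      if "u \<in> borel_measurable M" "pintegral M p u \<le> 1" "energy M s p u \<le> 1" "0 < t" "t \<le> 1" "x \<in> space M"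
        "(\<integral>\<^sup>+z. diff_quot s p u x z \<partial>M) \<le> ennreal (m * t powr - n)" for u t x
      using main[OF that] by (rule conjunct1)
    show "\<bar>u x - u y\<bar> \<le> K * t powr (s - n / p)"
      if *: "u \<in> borel_measurable M" "pintegral M p u \<le> 1" "energy M s p u \<le> 1" "0 < t" "t \<le> 1" "x \<in> space M"
        "(\<integral>\<^sup>+z. diff_quot s p u x z \<partial>M) \<le> ennreal (m * t powr - n)"
        and y: "y \<in> space M" "(\<integral>\<^sup>+z. diff_quot s p u y z \<partial>M) \<le> ennreal (m * t powr - n)" "dist x y \<le> t" for u t x y
      using conjunct2[OF main[OF *], THEN bspec[OF _ y(1)]] y by blast
  qed
qed

text \<open>The singular bound is used at the exponent \<open>e0 = min e n\<close>. The remaining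
  factor |x - y|^(e - e0) is bounded because the diameter is at most \<open>\<rho>\<close>, and
  outside the unit ball |x - y|^(e0 - n) is at most one.\<close>

lemma kernel_integral_bound:
  fixes e :: real
  assumes e: "0 < e"
  shows "\<exists>K\<ge>0. \<forall>x\<in>space M. (\<integral>\<^sup>+y. ennreal (norm (x - y) powr (e - DIM('a))) \<partial>M) \<le> ennreal K"
proof -
  define n where "n = real DIM('a)"
  define e0 where "e0 = min e n"
  have e0: "0 < e0" "e0 \<le> n" "e0 \<le> e" using e by (auto simp: e0_def n_def)
  from singular_integral_bound[OF ball_sets upper e0(1) e0(2)[unfolded n_def]] obtain K where K: "K \<ge> 0"
    "\<And>x. (\<integral>\<^sup>+y. ennreal (norm (x - y) powr (e0 - n)) * indicator (ball x 1) y \<partial>M) \<le> ennreal K"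
    unfolding n_def by auto
  define B where "B = \<rho> powr (e - e0)"
  have B: "1 \<le> B" using diameter(1) e0 by (simp add: B_def ge_one_powr_ge_zero)
  have "(\<integral>\<^sup>+y. ennreal (norm (x - y) powr (e - n)) \<partial>M) \<le> ennreal (B * (K + measure M (space M)))" if x: "x \<in> space M" for x
  proof -
    have [measurable]: "Measurable.pred M (\<lambda>y. y \<in> ball x 1)" by simp
    have "ennreal (norm (x - y) powr (e - n)) \<le> ennreal B * (ennreal (norm (x - y) powr (e0 - n)) * indicator (ball x 1) y + 1)"
      if y: "y \<in> space M" for y
    proof -
      have 1: "ennreal (norm (x - y) powr (e0 - n)) \<le> ennreal (norm (x - y) powr (e0 - n)) * indicator (ball x 1) y + 1"
      proof (cases "dist x y < 1")
        case False
        hence "norm (x - y) powr (e0 - n) \<le> norm (x - y) powr 0"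
          using e0 by (intro powr_mono) (auto simp: dist_norm)
        thus ?thesis using False by (auto simp: dist_norm ennreal_le_1 split: if_splits)
      qed auto
      have "norm (x - y) powr (e - n) = norm (x - y) powr (e - e0) * norm (x - y) powr (e0 - n)"
        by (simp add: powr_add[symmetric])
      also have "\<dots> \<le> B * norm (x - y) powr (e0 - n)"
        unfolding B_def using e0 by (intro mult_right_mono powr_mono2 diameter x y) auto
      finally have "ennreal (norm (x - y) powr (e - n)) \<le> ennreal B * ennreal (norm (x - y) powr (e0 - n))"
        using B by (simp add: ennreal_mult[symmetric] ennreal_leI)
      also have "\<dots> \<le> ennreal B * (ennreal (norm (x - y) powr (e0 - n)) * indicator (ball x 1) y + 1)"
        by (intro mult_left_mono 1) auto
      finally show ?thesis .
    qed
    hence "(\<integral>\<^sup>+y. ennreal (norm (x - y) powr (e - n)) \<partial>M) \<le>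
      (\<integral>\<^sup>+y. ennreal B * (ennreal (norm (x - y) powr (e0 - n)) * indicator (ball x 1) y + 1) \<partial>M)" by (intro nn_integral_mono)
    also have "\<dots> = ennreal B * ((\<integral>\<^sup>+y. ennreal (norm (x - y) powr (e0 - n)) * indicator (ball x 1) y \<partial>M) + emeasure M (space M))"
      by (subst nn_integral_cmult, simp, subst nn_integral_add) auto
    also have "\<dots> \<le> ennreal B * (ennreal K + ennreal (measure M (space M)))"
      by (intro add_mono mult_left_mono K) (simp_all add: emeasure_eq_measure)
    finally show ?thesis using K B by (simp add: ennreal_plus[symmetric] ennreal_mult[symmetric] del: ennreal_plus)
  qed
  thus ?thesis using K(1) B unfolding n_def by (intro exI[of _ "B * (K + measure M (space M))"]) auto
qed

text \<open>Hedberg's argument for an increasing exponent. If a and b are the inner integrals at x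
  and y, both points are good up to the scale \<tau> with \<tau>^(-n) = 2 + a + b. A pair closer
  than \<tau> keeps p powers of its difference and bounds the other q - p by growth at its own
  distance. For a distant pair growth at scale \<tau> bounds everything by (2 + a + b) |x - y|^(e -
  n) up to a constant; there a depends on x alone and b on y alone, so the kernel is integrated in
  the other variable.\<close>

lemma energy_embedding_large_exponent:
  fixes p q s s' :: real
  assumes p: "1 \<le> p" "p \<le> q" and s: "s * p < DIM('a)" "0 < s'" "s' < s" and sub: "DIM('a) / p - s < DIM('a) / q - s'"
  shows "\<exists>K\<ge>0. \<forall>u\<in>borel_measurable M. pintegral M p u \<le> 1 \<longrightarrow> energy M s p u \<le> 1 \<longrightarrow>
    energy M s' q u \<le> ennreal K \<and> pintegral M q u \<le> ennreal K"
proof -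
  define n where "n = real DIM('a)"
  define \<beta> where "\<beta> = n / p - s"
  \<comment> \<open>This is \<open>q\<close> times the slack in \<open>sub\<close>, so its
    positivity is the subcriticality assumption.\<close>
  define e where "e = n - q * (\<beta> + s')"
  have n0: "0 < n" by (simp add: n_def)
  have beta: "0 < \<beta>" using s p by (simp add: \<beta>_def n_def field_simps)
  have q: "1 \<le> q" using p by simp
  have e: "0 < e"
  proof -
    have "\<beta> + s' < n / q" using sub by (simp add: \<beta>_def n_def)
    hence "q * (\<beta> + s') < q * (n / q)" using q by (intro mult_strict_left_mono) auto
    thus ?thesis using q by (simp add: e_def)
  qed
  obtain m K0 where m: "m \<ge> 1" and K0: "K0 \<ge> 0"
    and growth1: "\<And>u t x. \<lbrakk>u \<in> borel_measurable M; pintegral M p u \<le> 1; energy M s p u \<le> 1; 0 < t; t \<le> 1; x \<in> space M;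
      (\<integral>\<^sup>+z. diff_quot s p u x z \<partial>M) \<le> ennreal (m * t powr - n)\<rbrakk>
      \<Longrightarrow> \<bar>u x\<bar> \<le> K0 * t powr (s - n / p)"
    and growth2: "\<And>u t x y. \<lbrakk>u \<in> borel_measurable M; pintegral M p u \<le> 1; energy M s p u \<le> 1; 0 < t; t \<le> 1;
      x \<in> space M; (\<integral>\<^sup>+z. diff_quot s p u x z \<partial>M) \<le> ennreal (m * t powr - n);
      y \<in> space M; (\<integral>\<^sup>+z. diff_quot s p u y z \<partial>M) \<le> ennreal (m * t powr - n); dist x y \<le> t\<rbrakk>
      \<Longrightarrow> \<bar>u x - u y\<bar> \<le> K0 * t powr (s - n / p)"
  proof (rule pointwise_growth[OF p(1) order.strict_trans[OF s(2,3)] s(1), folded n_def], goal_cases)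
    case (1 m K)
    show ?case by (rule that[of m K]) (fact 1)+
  qed
  from kernel_integral_bound[of e] e obtain W where W: "W \<ge> 0" 
    "\<And>x. x \<in> space M \<Longrightarrow> (\<integral>\<^sup>+y. ennreal (norm (x - y) powr (e - n)) \<partial>M) \<le> ennreal W" unfolding n_def by auto
  define A where "A = 1 + K0 powr (q - p) + (2 * K0) powr q"
  have A: "1 \<le> A" "K0 powr (q - p) \<le> A" "(2 * K0) powr q \<le> A" by (auto simp: A_def)
  define V where "V = measure M (space M)"
  have sb: "s - n / p = - \<beta>" by (simp add: \<beta>_def)
  have bound: "energy M s' q u \<le> ennreal (A * (1 + 2 * (V + 1) * W)) \<and> pintegral M q u \<le> ennreal (A * (V + 1))"
    if u[measurable]: "u \<in> borel_measurable M" and J: "pintegral M p u \<le> 1" and I: "energy M s p u \<le> 1" for u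
  proof
    let ?d = "\<lambda>x. \<integral>\<^sup>+z. diff_quot s p u x z \<partial>M"
    let ?w = "\<lambda>x y. ennreal (norm (x - y) powr (e - n))"
    note gr1 = growth1[OF u J I, unfolded sb] and gr2 = growth2[OF u J I, unfolded sb]
    have Id: "(\<integral>\<^sup>+x. ?d x \<partial>M) \<le> 1" using I by (simp add: energy_def)
    have Vn: "(\<integral>\<^sup>+x. 1 \<partial>M) = ennreal V" by (simp add: V_def emeasure_eq_measure)
    have V0: "0 \<le> V" by (simp add: V_def)
    have pw: "diff_quot s' q u x y \<le> ennreal A * (diff_quot s p u x y + ((1 + ?d x) * ?w x y + (1 + ?d y) * ?w x y))"
      if x: "x \<in> space M" and y: "y \<in> space M" for x y
    \<comment> \<open>On the diagonal the left side is 0; off it, an infinite inner integral makes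
      the right side infinite.\<close>
    proof (cases "x = y \<or> ?d x = \<infinity> \<or> ?d y = \<infinity>")
      case True
      then show ?thesis
        using A p q by (auto simp: diff_quot_def ennreal_mult_top ennreal_top_mult)
    next
      case False
      then obtain a b where ab: "?d x = ennreal a" "0 \<le> a" "?d y = ennreal b" "0 \<le> b"
        by (metis ennreal_cases infinity_ennreal_def)
      define r where "r = norm (x - y)"
      define \<tau> where "\<tau> = (2 + a + b) powr (- (1 / n))"
      have r: "0 < r" using False by (simp add: r_def)
      have tau: "0 < \<tau>" "\<tau> \<le> 1" "\<tau> powr - n = 2 + a + b"
      proof -
        show "\<tau> powr - n = 2 + a + b" using n0 ab by (simp add: \<tau>_def powr_powr)
        have "\<tau> \<le> (2 + a + b) powr 0" unfolding \<tau>_def using n0 ab by (intro powr_mono) auto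
        thus "\<tau> \<le> 1" using ab by simp
      qed (use ab in \<open>simp add: \<tau>_def\<close>)
      have good: "?d x \<le> ennreal (m * t powr - n)" "?d y \<le> ennreal (m * t powr - n)" if "0 < t" "t \<le> \<tau>" for t
      proof -
        have "2 + a + b \<le> t powr - n" unfolding tau(3)[symmetric] using that n0 by (intro powr_mono2') auto
        also have "\<dots> \<le> m * t powr - n" using mult_right_mono[OF m, of "t powr - n"] by simp
        finally show "?d x \<le> ennreal (m * t powr - n)" "?d y \<le> ennreal (m * t powr - n)" using ab by (auto intro!: ennreal_leI)
      qed
      have "\<bar>u x - u y\<bar> powr q / r powr (n + s' * q) \<le> A * (\<bar>u x - u y\<bar> powr p / r powr (n + s * p) + (2 + a + b) * r powr (e - n))"
      proof (cases "r \<le> \<tau>")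
        case True
        have "\<bar>u x - u y\<bar> \<le> K0 * r powr - \<beta>"
          by (rule gr2[OF r order.trans[OF True tau(2)] x good(1)[OF r True] y good(2)[OF r True]]) (simp add: r_def dist_norm)
        hence "\<bar>u x - u y\<bar> powr (q - p) \<le> (K0 * r powr - \<beta>) powr (q - p)" using p by (intro powr_mono2) auto
        also have "\<dots> = K0 powr (q - p) * r powr (- \<beta> * (q - p))" using K0 by (simp add: powr_mult powr_powr)
        also have "\<dots> \<le> A * r powr (- \<beta> * (q - p))" by (intro mult_right_mono A) auto
        finally have "\<bar>u x - u y\<bar> powr p * \<bar>u x - u y\<bar> powr (q - p) \<le> \<bar>u x - u y\<bar> powr p * (A * r powr (- \<beta> * (q - p)))"
          by (intro mult_left_mono) auto
        hence "\<bar>u x - u y\<bar> powr q \<le> A * \<bar>u x - u y\<bar> powr p * r powr (- \<beta> * (q - p))"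
          by (simp add: powr_add[symmetric] mult_ac)
        hence "\<bar>u x - u y\<bar> powr q / r powr (n + s' * q) \<le> A * \<bar>u x - u y\<bar> powr p * r powr (- \<beta> * (q - p)) / r powr (n + s' * q)"
          by (intro divide_right_mono) auto
        also have "\<dots> = A * (\<bar>u x - u y\<bar> powr p * r powr (- \<beta> * (q - p) - (n + s' * q)))"
          by (simp add: powr_diff)
        \<comment> \<open>The exponents differ by exactly \<open>e\<close>, in the favourable
          direction because r is at most 1.\<close>
        also have "\<dots> \<le> A * (\<bar>u x - u y\<bar> powr p * r powr (- (n + s * p)))"
        proof (intro mult_left_mono powr_mono')
          have "- \<beta> * (q - p) - (n + s' * q) = e - n - s * p + (\<beta> * p + s * p - n)" by (simp add: e_def algebra_simps)
          also have "\<beta> * p + s * p - n = 0" using p by (simp add: \<beta>_def field_simps)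
          finally show "- (n + s * p) \<le> - \<beta> * (q - p) - (n + s' * q)" using e by simp
        qed (use r True tau(1,2) A(1) in auto)
        also have "\<dots> = A * (\<bar>u x - u y\<bar> powr p / r powr (n + s * p))" by (simp only: powr_minus divide_inverse)
        also have "\<dots> \<le> A * (\<bar>u x - u y\<bar> powr p / r powr (n + s * p) + (2 + a + b) * r powr (e - n))"
          using A ab by (intro mult_left_mono) auto
        finally show ?thesis .
      next
        case False
        have "\<bar>u x\<bar> \<le> K0 * \<tau> powr - \<beta>" "\<bar>u y\<bar> \<le> K0 * \<tau> powr - \<beta>"
          using gr1[OF tau(1,2) x good(1)[OF tau(1)]] gr1[OF tau(1,2) y good(2)[OF tau(1)]] by auto
        hence "\<bar>u x - u y\<bar> \<le> 2 * K0 * \<tau> powr - \<beta>" by linarith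
        hence "\<bar>u x - u y\<bar> powr q \<le> (2 * K0 * \<tau> powr - \<beta>) powr q" using q by (intro powr_mono2) auto
        also have "\<dots> = (2 * K0) powr q * \<tau> powr (- \<beta> * q)" using K0 by (simp add: powr_mult powr_powr)
        also have "\<dots> \<le> A * \<tau> powr (- \<beta> * q)" by (intro mult_right_mono A) auto
        finally have "\<bar>u x - u y\<bar> powr q / r powr (n + s' * q) \<le> A * \<tau> powr (- \<beta> * q) / r powr (n + s' * q)"
          by (intro divide_right_mono) auto
        also have "\<dots> = A * (\<tau> powr (- \<beta> * q) * (r powr (- s' * q - e) * r powr (e - n)))"
        proof -
          have "r powr (- s' * q - e) * r powr (e - n) = r powr (- (n + s' * q))"
            by (simp only: powr_add[symmetric]) (simp add: algebra_simps)
          thus ?thesis unfolding powr_minus divide_inverse by simp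
        qed
        \<comment> \<open>Here r exceeds \<tau>: one power of r is kept as the kernel and the other,
          which is negative, may be evaluated at \<tau>. The exponents of \<tau> then add up to
          -n.\<close>
        also have "\<dots> \<le> A * (\<tau> powr (- \<beta> * q) * (\<tau> powr (- s' * q - e) * r powr (e - n)))"
        proof (intro mult_left_mono mult_right_mono powr_mono2')
          have "0 \<le> s' * q" using s(2) q by simp
          thus "- s' * q - e \<le> 0" using e by simp
        qed (use False tau(1) A(1) in auto)
        also have "\<dots> = A * (\<tau> powr (- \<beta> * q + (- s' * q - e)) * r powr (e - n))"
          by (simp only: powr_add mult.assoc)
        also have "- \<beta> * q + (- s' * q - e) = - n" by (simp add: e_def algebra_simps)
        finally have "\<bar>u x - u y\<bar> powr q / r powr (n + s' * q) \<le> A * ((2 + a + b) * r powr (e - n))" by (simp only: tau(3))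
        also have "\<dots> \<le> A * (\<bar>u x - u y\<bar> powr p / r powr (n + s * p) + (2 + a + b) * r powr (e - n))"
          using A by (intro mult_left_mono) auto
        finally show ?thesis .
      qed
      hence "diff_quot s' q u x y \<le> ennreal (A * (\<bar>u x - u y\<bar> powr p / r powr (n + s * p) + (2 + a + b) * r powr (e - n)))"
        unfolding diff_quot_def n_def r_def by (intro ennreal_leI)
      also have "\<dots> = ennreal A * (diff_quot s p u x y + ((1 + ?d x) * ?w x y + (1 + ?d y) * ?w x y))"
      proof -
        have "1 + ennreal a = ennreal (1 + a)" "1 + ennreal b = ennreal (1 + b)" using ab by auto
        thus ?thesis unfolding ab unfolding diff_quot_def n_def[symmetric] r_def[symmetric]
          using A(1) ab(2,4)
          by (simp add: ennreal_plus[symmetric] ennreal_mult[symmetric] del: ennreal_plus) (simp add: algebra_simps)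
      qed
      finally show ?thesis .
    qed
    have dm[measurable]: "?d \<in> borel_measurable M" by simp
    have w1: "(\<integral>\<^sup>+x. \<integral>\<^sup>+y. (1 + ?d x) * ?w x y \<partial>M \<partial>M) \<le> ennreal ((V + 1) * W)"
    proof -
      have "(\<integral>\<^sup>+x. \<integral>\<^sup>+y. (1 + ?d x) * ?w x y \<partial>M \<partial>M) = (\<integral>\<^sup>+x. (1 + ?d x) * (\<integral>\<^sup>+y. ?w x y \<partial>M) \<partial>M)"
        by (intro nn_integral_cong nn_integral_cmult) simp
      also have "\<dots> \<le> (\<integral>\<^sup>+x. (1 + ?d x) * ennreal W \<partial>M)"
        by (intro nn_integral_mono mult_left_mono W) auto
      also have "\<dots> = (ennreal V + (\<integral>\<^sup>+x. ?d x \<partial>M)) * ennreal W"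
        by (subst nn_integral_multc, simp, subst nn_integral_add) (auto simp: Vn[simplified])
      also have "\<dots> \<le> (ennreal V + 1) * ennreal W" by (intro mult_right_mono add_mono Id) auto
      also have "\<dots> = ennreal ((V + 1) * W)" using W V0 
        by (simp add: ennreal_plus[symmetric] ennreal_mult[symmetric] ennreal_1[symmetric] del: ennreal_plus ennreal_1)
      finally show ?thesis .
    qed
    interpret MM: pair_sigma_finite M M ..
    have w2: "(\<integral>\<^sup>+x. \<integral>\<^sup>+y. (1 + ?d y) * ?w x y \<partial>M \<partial>M) = (\<integral>\<^sup>+x. \<integral>\<^sup>+y. (1 + ?d x) * ?w x y \<partial>M \<partial>M)"
      by (subst MM.Fubini') (simp_all add: norm_minus_commute)
    have "energy M s' q u \<le> (\<integral>\<^sup>+x. \<integral>\<^sup>+y. ennreal A * (diff_quot s p u x y + ((1 + ?d x) * ?w x y + (1 + ?d y) * ?w x y)) \<partial>M \<partial>M)"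
      unfolding energy_def by (intro nn_integral_mono pw)
    also have "\<dots> = ennreal A * (energy M s p u + ((\<integral>\<^sup>+x. \<integral>\<^sup>+y. (1 + ?d x) * ?w x y \<partial>M \<partial>M) + (\<integral>\<^sup>+x. \<integral>\<^sup>+y. (1 + ?d y) * ?w x y \<partial>M \<partial>M)))"
      unfolding energy_def
      by (simp add: nn_integral_cmult nn_integral_add cong: nn_integral_cong)
    also have "\<dots> \<le> ennreal A * (1 + (ennreal ((V + 1) * W) + ennreal ((V + 1) * W)))"
      unfolding w2 by (intro mult_left_mono add_mono I w1) auto
    also have "\<dots> = ennreal (A * (1 + 2 * (V + 1) * W))"
      using A W V0 by (simp add: ennreal_plus[symmetric] ennreal_mult[symmetric] ennreal_1[symmetric]
              del: ennreal_plus ennreal_1)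
    finally show "energy M s' q u \<le> ennreal (A * (1 + 2 * (V + 1) * W))" .
    \<comment> \<open>The same device with a single point and \<tau>^(-n) = 1 + a; it suffices
      because \<beta> q < n, again by \<open>e > 0\<close>.\<close>
    have pJ: "ennreal (\<bar>u x\<bar> powr q) \<le> ennreal A * (1 + ?d x)" if x: "x \<in> space M" for x
    proof (cases "?d x = \<infinity>")
      case True
      then show ?thesis using A by (simp add: ennreal_mult_top)
    next
      case False
      then obtain a where a: "?d x = ennreal a" "0 \<le> a" 
        by (metis ennreal_cases infinity_ennreal_def)
      define \<tau> where "\<tau> = (1 + a) powr (- (1 / n))"
      have tau: "0 < \<tau>" "\<tau> \<le> 1" "\<tau> powr - n = 1 + a"
      proof -
        show "\<tau> powr - n = 1 + a" using n0 a by (simp add: \<tau>_def powr_powr)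
        have "\<tau> \<le> (1 + a) powr 0" unfolding \<tau>_def using n0 a by (intro powr_mono) auto
        thus "\<tau> \<le> 1" using a by simp
      qed (use a in \<open>simp add: \<tau>_def\<close>)
      have "a \<le> m * (1 + a)" using m a mult_mono[of 1 m a "1 + a"] by auto
      hence "?d x \<le> ennreal (m * \<tau> powr - n)" unfolding tau(3) a by (rule ennreal_leI)
      hence "\<bar>u x\<bar> \<le> K0 * \<tau> powr - \<beta>" by (rule gr1[OF tau(1,2) x])
      hence "\<bar>u x\<bar> powr q \<le> (2 * K0 * \<tau> powr - \<beta>) powr q" using K0 q tau by (intro powr_mono2) auto
      also have "\<dots> = (2 * K0) powr q * \<tau> powr (- \<beta> * q)" using K0 by (simp add: powr_mult powr_powr)
      also have "\<dots> \<le> A * \<tau> powr (- n)"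
      proof (intro mult_mono A powr_mono')
        have "0 \<le> q * s'" using q s by simp
        thus "- n \<le> - \<beta> * q" using e(1) by (simp add: e_def algebra_simps)
      qed (use tau(1,2) A(1) in auto)
      finally show ?thesis unfolding tau(3) using a A
        by (simp add: ennreal_plus[symmetric] ennreal_mult[symmetric] ennreal_1[symmetric] ennreal_leI del: ennreal_plus ennreal_1)
    qed
    have "pintegral M q u \<le> (\<integral>\<^sup>+x. ennreal A * (1 + ?d x) \<partial>M)"
      unfolding pintegral_def by (intro nn_integral_mono pJ)
    also have "\<dots> = ennreal A * (ennreal V + (\<integral>\<^sup>+x. ?d x \<partial>M))"
      by (subst nn_integral_cmult, simp, subst nn_integral_add) (auto simp: Vn[simplified])
    also have "\<dots> \<le> ennreal A * (ennreal V + 1)" by (intro mult_left_mono add_mono Id) auto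
    also have "\<dots> = ennreal (A * (V + 1))" using V0 A
        by (simp add: ennreal_plus[symmetric] ennreal_mult[symmetric] ennreal_1[symmetric] del: ennreal_plus ennreal_1)
    finally show "pintegral M q u \<le> ennreal (A * (V + 1))" .
  qed
  have "0 \<le> V" "0 \<le> A" using A by (auto simp: V_def)
  hence 0: "0 \<le> max (A * (1 + 2 * (V + 1) * W)) (A * (V + 1))" by (simp add: le_max_iff_disj)
  show ?thesis
  proof (rule exI, rule conjI[OF 0], intro ballI impI)
    fix u assume u: "u \<in> borel_measurable M" "pintegral M p u \<le> 1" "energy M s p u \<le> 1"
    show "energy M s' q u \<le> ennreal (max (A * (1 + 2 * (V + 1) * W)) (A * (V + 1))) \<and>
      pintegral M q u \<le> ennreal (max (A * (1 + 2 * (V + 1) * W)) (A * (V + 1)))"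
      using bound[OF u] by (meson ennreal_leI max.cobounded1 max.cobounded2 order_trans)
  qed
qed

lemma young_powr_le:
  fixes a b \<theta> :: real
  assumes "0 \<le> a" "0 \<le> b" "0 < \<theta>" "\<theta> < 1"
  shows "a powr \<theta> * b powr (1 - \<theta>) \<le> a + b"
proof -
  have "a powr \<theta> * b powr (1 - \<theta>) \<le> max a b powr \<theta> * max a b powr (1 - \<theta>)"
    using assms by (intro mult_mono powr_mono2) auto
  also have "\<dots> = max a b" using assms by (simp add: powr_add[symmetric])
  finally show ?thesis using assms by auto
qed

text \<open>The target integrand is the geometric mean, with weights \<open>\<theta>\<close> and
  \<open>1 - \<theta>\<close>, of the source integrand and the kernel |x - y|^(e - n). Matching the
  powers of |x - y| forces the value of \<open>e\<close>, which is positive because order is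
  lost.\<close>

lemma energy_embedding_small_exponent:
  fixes p q s s' :: real
  assumes p: "1 \<le> q" "q < p" and s: "0 < s'" "s' < s"
  shows "\<exists>K\<ge>0. \<forall>u\<in>borel_measurable M. energy M s' q u \<le> energy M s p u + ennreal K"
proof -
  define n where "n = real DIM('a)"
  have n0: "0 < n" by (simp add: n_def)
  define \<theta> where "\<theta> = q / p"
  have th: "0 < \<theta>" "\<theta> < 1" using p by (auto simp: \<theta>_def)
  define e where "e = (s - s') * q / (1 - \<theta>)"
  have e: "0 < e" using s p th by (auto simp: e_def)
  from kernel_integral_bound[of e] e obtain W where W: "W \<ge> 0" 
    "\<And>x. x \<in> space M \<Longrightarrow> (\<integral>\<^sup>+y. ennreal (norm (x - y) powr (e - n)) \<partial>M) \<le> ennreal W" unfolding n_def by auto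
  define V where "V = measure M (space M)"
  have "energy M s' q u \<le> energy M s p u + ennreal (W * V)" if u[measurable]: "u \<in> borel_measurable M" for u
  proof -
    have pw: "diff_quot s' q u x y \<le> diff_quot s p u x y + ennreal (norm (x - y) powr (e - n))" for x y
    proof (cases "x = y")
      case False
      define r where "r = norm (x - y)"
      have r: "0 < r" using False by (simp add: r_def)
      have "\<bar>u x - u y\<bar> powr q / r powr (n + s' * q)
        = (\<bar>u x - u y\<bar> powr p / r powr (n + s * p)) powr \<theta> * (r powr (e - n)) powr (1 - \<theta>)"
      proof -
        have "(\<bar>u x - u y\<bar> powr p / r powr (n + s * p)) powr \<theta> * (r powr (e - n)) powr (1 - \<theta>)
          = \<bar>u x - u y\<bar> powr (p * \<theta>) * (r powr ((e - n) * (1 - \<theta>)) / r powr ((n + s * p) * \<theta>))"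
          using r by (subst powr_divide) (auto simp: powr_powr)
        also have "\<dots> = \<bar>u x - u y\<bar> powr (p * \<theta>) * r powr ((e - n) * (1 - \<theta>) - (n + s * p) * \<theta>)"
          by (simp add: powr_diff)
        also have "p * \<theta> = q" using p by (simp add: \<theta>_def)
        also have "(e - n) * (1 - \<theta>) - (n + s * p) * \<theta> = e * (1 - \<theta>) - n - s * (p * \<theta>)"
          by (simp add: algebra_simps)
        also have "\<dots> = - (n + s' * q)"
        proof -
          have "e * (1 - \<theta>) = (s - s') * q" using th by (simp add: e_def)
          thus ?thesis unfolding \<open>p * \<theta> = q\<close> by (simp add: algebra_simps)
        qed
        finally show ?thesis unfolding powr_minus[of r "n + s' * q"] divide_inverse by simp
      qed
      also have "\<dots> \<le> \<bar>u x - u y\<bar> powr p / r powr (n + s * p) + r powr (e - n)"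
        using th by (intro young_powr_le) auto
      finally show ?thesis unfolding diff_quot_def n_def r_def
        by (simp add: ennreal_plus[symmetric] ennreal_leI del: ennreal_plus)
    qed (use p in \<open>simp add: diff_quot_def\<close>)
    have "energy M s' q u \<le> (\<integral>\<^sup>+x. (\<integral>\<^sup>+y. diff_quot s p u x y + ennreal (norm (x - y) powr (e - n)) \<partial>M) \<partial>M)"
      unfolding energy_def by (intro nn_integral_mono pw)
    also have "\<dots> = energy M s p u + (\<integral>\<^sup>+x. (\<integral>\<^sup>+y. ennreal (norm (x - y) powr (e - n)) \<partial>M) \<partial>M)"
      unfolding energy_def by (simp add: nn_integral_add cong: nn_integral_cong)
    also have "\<dots> \<le> energy M s p u + (\<integral>\<^sup>+x. ennreal W \<partial>M)"
      by (intro add_mono nn_integral_mono W) auto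
    also have "(\<integral>\<^sup>+x. ennreal W \<partial>M) = ennreal (W * V)"
      using W by (simp add: V_def emeasure_eq_measure ennreal_mult)
    finally show ?thesis .
  qed
  moreover have "0 \<le> W * V" using W by (simp add: V_def)
  ultimately show ?thesis by blast
qed

end

section \<open>Compactness\<close>

text \<open>A form of Vitali's theorem. Below the height \<open>L\<close> bounded convergence
  applies; above it |f|^b is at most L^(b - a) |f|^a, which the bound in the higher power makes
  small uniformly in n.\<close>

lemma powr_integral_tendsto_zero:
  fixes f :: "nat \<Rightarrow> 'a \<Rightarrow> real" and a b C :: real
  assumes M: "finite_measure M" and [measurable]: "\<And>n. f n \<in> borel_measurable M"
    and ae: "AE x in M. (\<lambda>n. f n x) \<longlonglongrightarrow> 0"
    and C: "\<And>n. (\<integral>\<^sup>+x. ennreal (\<bar>f n x\<bar> powr a) \<partial>M) \<le> ennreal C"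
    and ab: "0 < b" "b < a"
  shows "(\<lambda>n. \<integral>\<^sup>+x. ennreal (\<bar>f n x\<bar> powr b) \<partial>M) \<longlonglongrightarrow> 0"
proof (rule order_tendstoI)
  interpret finite_measure M by fact
  fix e :: ennreal assume "0 < e"
  then obtain z where z: "0 < z" "z < e" using dense by blast
  then obtain d where "z = ennreal d" "0 \<le> d" by (cases z) auto
  with z have d: "0 < d" "ennreal d < e" by auto
  \<comment> \<open>Solves L^(b - a) |C| \<le> d / 2. Adding 1 to |C| keeps the base
    positive.\<close>
  define L where "L = max 1 ((2 * (\<bar>C\<bar> + 1) / d) powr (1 / (a - b)))"
  have L: "1 \<le> L" by (simp add: L_def)
  have LC: "L powr (b - a) * \<bar>C\<bar> \<le> d / 2"
  proof -
    have "2 * (\<bar>C\<bar> + 1) / d = ((2 * (\<bar>C\<bar> + 1) / d) powr (1 / (a - b))) powr (a - b)"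
      using ab d by (simp add: powr_powr)
    also have "\<dots> \<le> L powr (a - b)" using ab by (intro powr_mono2) (auto simp: L_def)
    finally have "2 * (\<bar>C\<bar> + 1) \<le> L powr (a - b) * d" using d by (simp add: field_simps)
    hence "2 * \<bar>C\<bar> \<le> L powr (a - b) * d" by (rule order_trans[rotated]) simp
    hence "L powr (b - a) * (2 * \<bar>C\<bar>) \<le> L powr (b - a) * (L powr (a - b) * d)"
      by (rule mult_left_mono) simp
    also have "\<dots> = (L powr (b - a) * L powr (a - b)) * d" by simp
    also have "L powr (b - a) * L powr (a - b) = 1" using L by (simp only: powr_add[symmetric]) simp
    finally show ?thesis by simp
  qed
  define g where "g n x = ennreal ((min \<bar>f n x\<bar> L) powr b)" for n x
  have [measurable]: "g n \<in> borel_measurable M" for n unfolding g_def by measurable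
  have le: "ennreal (\<bar>f n x\<bar> powr b) \<le> g n x + ennreal (L powr (b - a)) * ennreal (\<bar>f n x\<bar> powr a)" for n x
  proof (cases "\<bar>f n x\<bar> \<le> L")
    case True
    then show ?thesis by (simp add: g_def)
  next
    case False
    have "\<bar>f n x\<bar> powr b = \<bar>f n x\<bar> powr (b - a) * \<bar>f n x\<bar> powr a" by (simp add: powr_add[symmetric])
    also have "\<dots> \<le> L powr (b - a) * \<bar>f n x\<bar> powr a"
      using ab L False by (intro mult_right_mono powr_mono2') auto
    finally show ?thesis by (auto simp: ennreal_mult[symmetric] add_increasing ennreal_leI)
  qed
  have "(\<lambda>n. \<integral>\<^sup>+x. g n x \<partial>M) \<longlonglongrightarrow> (\<integral>\<^sup>+x. 0 \<partial>M)"
  proof (rule nn_integral_dominated_convergence[where w="\<lambda>_. ennreal (L powr b)"])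
    show "AE x in M. g j x \<le> ennreal (L powr b)" for j
      using ab L by (auto simp: g_def intro!: ennreal_leI powr_mono2)
    show "(\<integral>\<^sup>+ x. ennreal (L powr b) \<partial>M) < \<infinity>" by (simp add: emeasure_eq_measure ennreal_mult[symmetric])
    show "AE x in M. (\<lambda>i. g i x) \<longlonglongrightarrow> 0"
      using ae
    proof (eventually_elim)
      case (elim x)
      have "(\<lambda>i. (min \<bar>f i x\<bar> L) powr b) \<longlonglongrightarrow> (min \<bar>0\<bar> L) powr b"
        using ab by (intro tendsto_powr' tendsto_min tendsto_rabs elim tendsto_const) auto
      hence "(\<lambda>i. ennreal ((min \<bar>f i x\<bar> L) powr b)) \<longlonglongrightarrow> ennreal 0" using L by (intro tendsto_ennrealI) simp
      thus ?case by (simp add: g_def)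
    qed
  qed auto
  hence "eventually (\<lambda>n. (\<integral>\<^sup>+x. g n x \<partial>M) < ennreal (d / 2)) sequentially"
    using d by (intro order_tendstoD) auto
  thus "eventually (\<lambda>n. (\<integral>\<^sup>+x. ennreal (\<bar>f n x\<bar> powr b) \<partial>M) < e) sequentially"
  proof eventually_elim
    case (elim n)
    have "(\<integral>\<^sup>+x. ennreal (\<bar>f n x\<bar> powr b) \<partial>M) \<le> (\<integral>\<^sup>+x. g n x + ennreal (L powr (b - a)) * ennreal (\<bar>f n x\<bar> powr a) \<partial>M)"
      by (intro nn_integral_mono le)
    also have "\<dots> = (\<integral>\<^sup>+x. g n x \<partial>M) + ennreal (L powr (b - a)) * (\<integral>\<^sup>+x. ennreal (\<bar>f n x\<bar> powr a) \<partial>M)"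
      by (simp add: nn_integral_add nn_integral_cmult)
    also have "\<dots> \<le> ennreal (d / 2) + ennreal (L powr (b - a)) * ennreal \<bar>C\<bar>"
      using elim by (intro add_mono mult_left_mono order_trans[OF C]) (auto intro: ennreal_leI)
    also have "\<dots> \<le> ennreal (d / 2) + ennreal (d / 2)"
      using LC by (intro add_mono) (auto simp: ennreal_mult[symmetric] intro!: ennreal_leI)
    also have "\<dots> = ennreal d" using d by (simp add: ennreal_plus[symmetric] del: ennreal_plus)
    also note d(2)
    finally show ?case .
  qed
qed auto

lemma abs_diff_powr_le:
  fixes a b p :: real
  assumes "0 \<le> p"
  shows "\<bar>a - b\<bar> powr p \<le> 2 powr p * (\<bar>a\<bar> powr p + \<bar>b\<bar> powr p)"
proof -
  have "\<bar>a - b\<bar> powr p \<le> (2 * max \<bar>a\<bar> \<bar>b\<bar>) powr p" using assms by (intro powr_mono2) auto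
  also have "\<dots> = 2 powr p * max \<bar>a\<bar> \<bar>b\<bar> powr p" by (simp add: powr_mult)
  also have "\<dots> \<le> 2 powr p * (\<bar>a\<bar> powr p + \<bar>b\<bar> powr p)" by (intro mult_left_mono) (auto simp: max_def)
  finally show ?thesis .
qed

section \<open>Compactness in L^1 and almost everywhere convergence\<close>

context regular_measure
begin

text \<open>Differences up to t^s are paid for by the volume of the ball, larger ones by the energy,
  since for them |a| \<le> t^(s (1 - p)) |a|^p. The order t^(n + s) is what matters: dividing by the
  volume t^n leaves t^s, which tends to 0.\<close>

lemma near_difference_integral:
  fixes s p :: real
  assumes p: "1 \<le> p" and s: "0 < s"
  shows "\<exists>K\<ge>0. \<forall>t u. 0 < t \<longrightarrow> u \<in> borel_measurable M \<longrightarrow> energy M s p u \<le> 1 \<longrightarrow>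
    (\<integral>\<^sup>+x. \<integral>\<^sup>+y. ennreal \<bar>u x - u y\<bar> * indicator (ball x (2 * t)) y \<partial>M \<partial>M) \<le> ennreal (K * t powr (DIM('a) + s))"
proof -
  define n where "n = real DIM('a)"
  define V where "V = measure M (space M)"
  define K where "K = \<bar>C\<bar> * 2 powr n * V + 2 powr (n + s * p)"
  have n0: "0 < n" by (simp add: n_def)
  have "(\<integral>\<^sup>+x. \<integral>\<^sup>+y. ennreal \<bar>u x - u y\<bar> * indicator (ball x (2 * t)) y \<partial>M \<partial>M) \<le> ennreal (K * t powr (n + s))"
    if t: "0 < t" and u[measurable]: "u \<in> borel_measurable M" and I: "energy M s p u \<le> 1" for t u
  proof -
    define B where "B = t powr (s * (1 - p)) * (2 * t) powr (n + s * p)"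
    have pw: "ennreal \<bar>u x - u y\<bar> * indicator (ball x (2 * t)) y
       \<le> ennreal (t powr s) * indicator (ball x (2 * t) \<inter> space M) y + ennreal B * diff_quot s p u x y"
      if "y \<in> space M" for x y
    proof (cases "y \<in> ball x (2 * t) \<and> t powr s < \<bar>u x - u y\<bar>")
      case True
      define r where "r = norm (x - y)"
      have xy: "x \<noteq> y" using True by auto
      have r: "0 < r" "r < 2 * t" using True xy by (auto simp: r_def dist_norm)
      have "\<bar>u x - u y\<bar> = \<bar>u x - u y\<bar> powr (1 - p) * \<bar>u x - u y\<bar> powr p"
        using True by (simp add: powr_add[symmetric])
      also have "\<dots> \<le> (t powr s) powr (1 - p) * \<bar>u x - u y\<bar> powr p"
        using p True t by (intro mult_right_mono powr_mono2') auto
      also have "\<dots> = t powr (s * (1 - p)) * (\<bar>u x - u y\<bar> powr p * 1)" by (simp add: powr_powr)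
      also have "\<dots> \<le> t powr (s * (1 - p)) * (\<bar>u x - u y\<bar> powr p * ((2 * t) powr (n + s * p) / r powr (n + s * p)))"
        using r s p n0 by (intro mult_left_mono) (auto simp: le_divide_eq intro!: powr_mono2)
      also have "\<dots> = B * (\<bar>u x - u y\<bar> powr p / r powr (n + s * p))" by (simp add: B_def)
      finally have "ennreal \<bar>u x - u y\<bar> \<le> ennreal B * diff_quot s p u x y"
        unfolding diff_quot_def n_def r_def by (subst ennreal_mult[symmetric]) (auto simp: B_def intro!: ennreal_leI)
      thus ?thesis using True by (simp add: add_increasing)
    next
      case False
      thus ?thesis using that by (auto simp: indicator_def intro!: add_increasing2 ennreal_leI)
    qed
    have "(\<integral>\<^sup>+x. \<integral>\<^sup>+y. ennreal \<bar>u x - u y\<bar> * indicator (ball x (2 * t)) y \<partial>M \<partial>M)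
      \<le> (\<integral>\<^sup>+x. \<integral>\<^sup>+y. ennreal (t powr s) * indicator (ball x (2 * t) \<inter> space M) y + ennreal B * diff_quot s p u x y \<partial>M \<partial>M)"
      by (intro nn_integral_mono pw)
    also have "\<dots> = (\<integral>\<^sup>+x. ennreal (t powr s) * emeasure M (ball x (2 * t) \<inter> space M) + ennreal B * (\<integral>\<^sup>+y. diff_quot s p u x y \<partial>M) \<partial>M)"
      by (intro nn_integral_cong) (simp add: nn_integral_add nn_integral_cmult nn_integral_cmult_indicator)
    also have "\<dots> \<le> (\<integral>\<^sup>+x. ennreal (t powr s * (\<bar>C\<bar> * (2 * t) powr n)) + ennreal B * (\<integral>\<^sup>+y. diff_quot s p u x y \<partial>M) \<partial>M)"
    proof (intro nn_integral_mono add_mono order_refl)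
      fix x
      have "emeasure M (ball x (2 * t) \<inter> space M) \<le> ennreal (\<bar>C\<bar> * (2 * t) powr n)"
        using t by (intro order_trans[OF upper]) (auto simp: n_def intro!: ennreal_leI mult_right_mono)
      thus "ennreal (t powr s) * emeasure M (ball x (2 * t) \<inter> space M) \<le> ennreal (t powr s * (\<bar>C\<bar> * (2 * t) powr n))"
        by (subst ennreal_mult) (auto intro!: mult_left_mono)
    qed
    also have "\<dots> = ennreal (t powr s * (\<bar>C\<bar> * (2 * t) powr n)) * ennreal V + ennreal B * energy M s p u"
      unfolding energy_def by (subst nn_integral_add) (auto simp: nn_integral_cmult V_def emeasure_eq_measure)
    also have "\<dots> \<le> ennreal (t powr s * (\<bar>C\<bar> * (2 * t) powr n)) * ennreal V + ennreal B * 1"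
      by (intro add_mono mult_left_mono I) auto
    also have "\<dots> = ennreal (t powr s * (\<bar>C\<bar> * (2 * t) powr n) * V + B)"
      by (simp add: V_def B_def ennreal_mult[symmetric] ennreal_plus[symmetric] del: ennreal_plus)
    also have "t powr s * (\<bar>C\<bar> * (2 * t) powr n) * V + B = K * t powr (n + s)"
    proof -
      have "B = 2 powr (n + s * p) * (t powr (s * (1 - p)) * t powr (n + s * p))"
        using t by (simp add: B_def powr_mult)
      also have "t powr (s * (1 - p)) * t powr (n + s * p) = t powr (n + s)"
        by (simp only: powr_add[symmetric]) (simp add: algebra_simps)
      finally have "B = 2 powr (n + s * p) * t powr (n + s)" .
      moreover have "t powr s * (\<bar>C\<bar> * (2 * t) powr n) * V = \<bar>C\<bar> * 2 powr n * V * t powr (n + s)"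
        using t by (simp add: powr_mult powr_add)
      ultimately show ?thesis by (simp add: K_def algebra_simps)
    qed
    finally show ?thesis .
  qed
  moreover have "0 \<le> K" by (simp add: K_def V_def)
  ultimately show ?thesis unfolding n_def by blast
qed

text \<open>The centres have to lie in the space itself and not just in its closure, so that
  \<open>lower\<close> applies to the balls around them.\<close>

lemma finite_net:
  assumes "0 < t"
  obtains D where "finite D" "D \<subseteq> space M" "space M \<subseteq> (\<Union>d\<in>D. ball d t)"
proof -
  have "bounded (space M)"
    unfolding bounded_two_points using diameter(2) by (auto simp: dist_norm)
  hence comp: "compact (closure (space M))" by (simp add: compact_closure)
  have sub: "closure (space M) \<subseteq> (\<Union>d\<in>space M. ball d t)"
    using assms by (force simp: closure_approachable)
  obtain D where D: "D \<subseteq> space M" "finite D" "closure (space M) \<subseteq> (\<Union>d\<in>D. ball d t)"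
    by (rule compactE_image[OF comp _ sub]) auto
  show ?thesis by (rule that[OF D(2,1) order_trans[OF closure_subset D(3)]])
qed

lemma integrable_if_pintegral:
  assumes [measurable]: "u \<in> borel_measurable M" and p: "1 \<le> p" and J: "pintegral M p u < \<infinity>"
  shows "integrable M u" "(\<integral>x. \<bar>u x\<bar> \<partial>M) \<le> measure M (space M) + enn2real (pintegral M p u)"
proof -
  have "\<bar>u x\<bar> \<le> 1 + \<bar>u x\<bar> powr p" for x
  proof (cases "\<bar>u x\<bar> \<le> 1")
    case False
    hence "\<bar>u x\<bar> powr 1 \<le> \<bar>u x\<bar> powr p" using p by (intro powr_mono) auto
    thus ?thesis by simp
  qed (auto intro: add_increasing2)
  hence "(\<integral>\<^sup>+x. ennreal \<bar>u x\<bar> \<partial>M) \<le> (\<integral>\<^sup>+x. 1 + ennreal (\<bar>u x\<bar> powr p) \<partial>M)"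
    by (intro nn_integral_mono) (simp add: ennreal_plus[symmetric] ennreal_1[symmetric] ennreal_leI del: ennreal_plus ennreal_1)
  also have "\<dots> = ennreal (measure M (space M)) + pintegral M p u"
    unfolding pintegral_def by (subst nn_integral_add) (auto simp: emeasure_eq_measure)
  also have "\<dots> = ennreal (measure M (space M) + enn2real (pintegral M p u))"
    using J by (simp add: ennreal_plus)
  finally have *: "(\<integral>\<^sup>+x. ennreal \<bar>u x\<bar> \<partial>M) \<le> ennreal (measure M (space M) + enn2real (pintegral M p u))" .
  show int: "integrable M u"
    using * by (intro integrableI_bounded) (auto simp: order.strict_trans1)
  show "(\<integral>x. \<bar>u x\<bar> \<partial>M) \<le> measure M (space M) + enn2real (pintegral M p u)"
    by (subst integral_eq_nn_integral) (use * in \<open>auto simp: enn2real_leI\<close>)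
qed

text \<open>Averages over balls around x are replaced by integrals over the balls of a net, so that
  only finitely many functionals of \<open>w\<close> remain. If x lies in the ball around d, that
  ball lies in the one of radius 2 t around x; integrating w x = (w x - w y) + w y over the net ball
  gives the pointwise bound.\<close>

lemma L1_le_near_difference:
  assumes w: "integrable M w" and t: "0 < t" "t \<le> 1"
    and D: "finite D" "D \<subseteq> space M" "space M \<subseteq> (\<Union>d\<in>D. ball d t)"
  shows "ennreal (c * t powr DIM('a)) * (\<integral>\<^sup>+x. ennreal \<bar>w x\<bar> \<partial>M) \<le>
    (\<integral>\<^sup>+x. \<integral>\<^sup>+y. ennreal \<bar>w x - w y\<bar> * indicator (ball x (2 * t)) y \<partial>M \<partial>M) +
    ennreal (measure M (space M) * (\<Sum>d\<in>D. \<bar>\<integral>y. w y * indicator (ball d t \<inter> space M) y \<partial>M\<bar>))"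
proof -
  note [measurable] = borel_measurable_integrable[OF w]
  let ?S = "\<Sum>d\<in>D. \<bar>\<integral>y. w y * indicator (ball d t \<inter> space M) y \<partial>M\<bar>"
  have pw: "ennreal (c * t powr DIM('a)) * ennreal \<bar>w x\<bar> \<le>
    (\<integral>\<^sup>+y. ennreal \<bar>w x - w y\<bar> * indicator (ball x (2 * t)) y \<partial>M) + ennreal ?S" if x: "x \<in> space M" for x
  proof -
    obtain d where d: "d \<in> D" "x \<in> ball d t" using D x by blast
    define B where "B = ball d t \<inter> space M"
    have [measurable]: "B \<in> sets M" by (simp add: B_def)
    have wi: "integrable M (\<lambda>y. w y * indicator B y)" using w by (intro integrable_mult_indicator[of B M w, simplified mult.commute[of "indicat_real _ _"] real_scaleR_def]) auto
    have di: "integrable M (\<lambda>y. (w x - w y) * indicator B y)"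
    proof -
      have "integrable M (\<lambda>y. w x * indicator B y)"
        by (intro integrable_mult_right integrable_real_indicator) (auto simp: emeasure_eq_measure)
      from Bochner_Integration.integrable_diff[OF this wi] show ?thesis by (simp add: left_diff_distrib)
    qed
    have "c * t powr DIM('a) \<le> measure M B"
      using lower[of d t] d D t c_pos by (auto simp: B_def emeasure_eq_measure)
    hence "c * t powr DIM('a) * \<bar>w x\<bar> \<le> measure M B * \<bar>w x\<bar>" by (intro mult_right_mono) auto
    also have "\<dots> = \<bar>\<integral>y. w x * indicator B y \<partial>M\<bar>" by (simp add: abs_mult)
    also have "(\<integral>y. w x * indicator B y \<partial>M) = (\<integral>y. (w x - w y) * indicator B y \<partial>M) + (\<integral>y. w y * indicator B y \<partial>M)"
      by (subst Bochner_Integration.integral_add[OF di wi, symmetric])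
        (intro Bochner_Integration.integral_cong refl, simp add: left_diff_distrib)
    also have "\<bar>\<dots>\<bar> \<le> (\<integral>y. \<bar>(w x - w y) * indicator B y\<bar> \<partial>M) + ?S"
    proof (rule order_trans[OF abs_triangle_ineq], rule add_mono)
      show "\<bar>\<integral>y. w y * indicator B y \<partial>M\<bar> \<le> ?S"
        using d(1) D(1) unfolding B_def
        by (intro member_le_sum[of d D "\<lambda>d. \<bar>\<integral>y. w y * indicator (ball d t \<inter> space M) y \<partial>M\<bar>"]) auto
    qed (rule integral_abs_bound)
    finally have "ennreal (c * t powr DIM('a) * \<bar>w x\<bar>) \<le> ennreal (\<integral>y. \<bar>(w x - w y) * indicator B y\<bar> \<partial>M) + ennreal ?S"
      by (simp add: ennreal_plus[symmetric] sum_nonneg ennreal_leI del: ennreal_plus)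
    also have "ennreal (\<integral>y. \<bar>(w x - w y) * indicator B y\<bar> \<partial>M) = (\<integral>\<^sup>+y. ennreal \<bar>(w x - w y) * indicator B y\<bar> \<partial>M)"
      using di by (intro nn_integral_eq_integral[symmetric]) auto
    also have "\<dots> \<le> (\<integral>\<^sup>+y. ennreal \<bar>w x - w y\<bar> * indicator (ball x (2 * t)) y \<partial>M)"
    proof (intro nn_integral_mono)
      fix y assume "y \<in> space M"
      have "dist x y < 2 * t" if "y \<in> B"
        using that d dist_triangle2[of x y d] by (auto simp: B_def dist_commute)
      thus "ennreal \<bar>(w x - w y) * indicator B y\<bar> \<le> ennreal \<bar>w x - w y\<bar> * indicator (ball x (2 * t)) y"
        by (cases "y \<in> B") auto
    qed
    finally show ?thesis using c_pos by (simp add: ennreal_mult)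
  qed
  have "ennreal (c * t powr DIM('a)) * (\<integral>\<^sup>+x. ennreal \<bar>w x\<bar> \<partial>M) = (\<integral>\<^sup>+x. ennreal (c * t powr DIM('a)) * ennreal \<bar>w x\<bar> \<partial>M)"
    by (simp add: nn_integral_cmult)
  also have "\<dots> \<le> (\<integral>\<^sup>+x. (\<integral>\<^sup>+y. ennreal \<bar>w x - w y\<bar> * indicator (ball x (2 * t)) y \<partial>M) + ennreal ?S \<partial>M)"
    by (intro nn_integral_mono pw)
  also have "\<dots> = (\<integral>\<^sup>+x. \<integral>\<^sup>+y. ennreal \<bar>w x - w y\<bar> * indicator (ball x (2 * t)) y \<partial>M \<partial>M) + ennreal ?S * ennreal (measure M (space M))"
  proof (subst nn_integral_add)
    have "(\<lambda>(x, y). ennreal \<bar>w x - w y\<bar> * (if dist x y < 2 * t then 1 else 0)) \<in> borel_measurable (M \<Otimes>\<^sub>M M)" by measurable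
    moreover have "(\<lambda>(x, y). ennreal \<bar>w x - w y\<bar> * (if dist x y < 2 * t then 1 else 0)) =
        (\<lambda>(x, y). ennreal \<bar>w x - w y\<bar> * indicator (ball x (2 * t)) y)"
      by (auto simp: fun_eq_iff indicator_def)
    ultimately show "(\<lambda>x. \<integral>\<^sup>+y. ennreal \<bar>w x - w y\<bar> * indicator (ball x (2 * t)) y \<partial>M) \<in> borel_measurable M"
      by (intro borel_measurable_nn_integral) (simp only:)
  qed (auto simp: emeasure_eq_measure)
  also have "ennreal ?S * ennreal (measure M (space M)) = ennreal (measure M (space M) * ?S)"
    by (subst ennreal_mult[symmetric]) (auto simp: mult.commute intro!: sum_nonneg)
  finally show ?thesis .
qed

lemma near_difference_integral_diff:
  assumes [measurable]: "u \<in> borel_measurable M" "v \<in> borel_measurable M"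
  shows "(\<integral>\<^sup>+x. \<integral>\<^sup>+y. ennreal \<bar>(u x - v x) - (u y - v y)\<bar> * indicator (ball x (2 * t)) y \<partial>M \<partial>M) \<le>
    (\<integral>\<^sup>+x. \<integral>\<^sup>+y. ennreal \<bar>u x - u y\<bar> * indicator (ball x (2 * t)) y \<partial>M \<partial>M) +
    (\<integral>\<^sup>+x. \<integral>\<^sup>+y. ennreal \<bar>v x - v y\<bar> * indicator (ball x (2 * t)) y \<partial>M \<partial>M)"
proof -
  have eq: "indicator (ball x (2 * t)) y = (if dist x y < 2 * t then 1 else 0::ennreal)" for x y :: 'a by auto
  have "(\<integral>\<^sup>+x. \<integral>\<^sup>+y. ennreal \<bar>(u x - v x) - (u y - v y)\<bar> * indicator (ball x (2 * t)) y \<partial>M \<partial>M) \<le>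
    (\<integral>\<^sup>+x. \<integral>\<^sup>+y. ennreal \<bar>u x - u y\<bar> * indicator (ball x (2 * t)) y + ennreal \<bar>v x - v y\<bar> * indicator (ball x (2 * t)) y \<partial>M \<partial>M)"
    by (intro nn_integral_mono)
      (auto simp: indicator_def ennreal_plus[symmetric] simp del: ennreal_plus intro!: ennreal_leI)
  also have "\<dots> = (\<integral>\<^sup>+x. \<integral>\<^sup>+y. ennreal \<bar>u x - u y\<bar> * indicator (ball x (2 * t)) y \<partial>M \<partial>M) +
    (\<integral>\<^sup>+x. \<integral>\<^sup>+y. ennreal \<bar>v x - v y\<bar> * indicator (ball x (2 * t)) y \<partial>M \<partial>M)"
    unfolding eq by (subst nn_integral_add[symmetric]) (auto intro!: nn_integral_cong nn_integral_add)
  finally show ?thesis .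
qed

text \<open>The integrals over all net balls, for all scales 1 / (k + 1), are countably many bounded
  functionals. Along a diagonal subsequence they all converge, and \<open>key\<close> makes that
  subsequence Cauchy in L^1.\<close>

lemma ae_compactness:
  fixes u :: "nat \<Rightarrow> 'a \<Rightarrow> real" and s p :: real
  assumes p: "1 \<le> p" and s: "0 < s" and u[measurable]: "\<And>n. u n \<in> borel_measurable M"
    and J: "\<And>n. pintegral M p (u n) \<le> 1" and I: "\<And>n. energy M s p (u n) \<le> 1"
  obtains r v where "strict_mono r" "v \<in> borel_measurable M" "AE x in M. (\<lambda>k. u (r k) x) \<longlonglongrightarrow> v x"
proof -
  define n where "n = real DIM('a)"
  define V where "V = measure M (space M)"
  have V0: "0 \<le> V" by (simp add: V_def)
  have int: "integrable M (u k)" "(\<integral>x. \<bar>u k x\<bar> \<partial>M) \<le> V + 1" for k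
  proof -
    have fin: "pintegral M p (u k) < \<infinity>" using J[of k] by (auto simp: order.strict_trans1)
    show "integrable M (u k)" by (rule integrable_if_pintegral(1)[OF u p fin])
    have "enn2real (pintegral M p (u k)) \<le> 1" using J[of k] by (intro enn2real_leI) auto
    thus "(\<integral>x. \<bar>u k x\<bar> \<partial>M) \<le> V + 1" using integrable_if_pintegral(2)[OF u p fin] by (simp add: V_def)
  qed
  define t where "t k = 1 / (real k + 1)" for k
  have t: "0 < t k" "t k \<le> 1" for k by (auto simp: t_def)
  have "\<forall>k. \<exists>D. finite D \<and> D \<subseteq> space M \<and> space M \<subseteq> (\<Union>d\<in>D. ball d (t k))"
    using finite_net[OF t(1)] by metis
  then obtain D where D: "\<And>k. finite (D k)" "\<And>k. D k \<subseteq> space M" "\<And>k. space M \<subseteq> (\<Union>d\<in>D k. ball d (t k))"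
    by metis
  define a where "a m = (\<lambda>(k, d). \<integral>y. u m y * indicator (ball d (t k) \<inter> space M) y \<partial>M)" for m
  have indi: "integrable M (\<lambda>y. u m y * indicator (ball d (t k) \<inter> space M) y)" for m k d
    using integrable_mult_indicator[OF ball_sets int(1), of d "t k" m] by (simp add: mult.commute)
  have "norm (a m i) \<le> V + 1" for m i
  proof -
    obtain k d where i: "i = (k, d)" by fastforce
    have "\<bar>a m i\<bar> \<le> (\<integral>y. \<bar>u m y * indicator (ball d (t k) \<inter> space M) y\<bar> \<partial>M)"
      unfolding a_def i by simp
    also have "\<dots> \<le> (\<integral>y. \<bar>u m y\<bar> \<partial>M)"
      using int(1) indi by (intro integral_mono) (auto simp: indicator_def)
    also have "\<dots> \<le> V + 1" by (rule int)
    finally show ?thesis by simp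
  qed
  moreover have "countable (Sigma UNIV D)" using D(1) by (intro countable_SIGMA) (auto intro: countable_finite)
  \<comment> \<open>The diagonal argument; \<open>function_convergent_subsequence\<close>
    accompanies Montel's theorem, whence the import from complex analysis.\<close>
  ultimately obtain r0 where r0: "strict_mono r0" "\<And>i. i \<in> Sigma UNIV D \<Longrightarrow> \<exists>l. (\<lambda>m. a (r0 m) i) \<longlonglongrightarrow> l"
    using function_convergent_subsequence[of "Sigma UNIV D" a "V + 1"] by metis
  then obtain l where l: "\<And>k d. d \<in> D k \<Longrightarrow> (\<lambda>m. a (r0 m) (k, d)) \<longlonglongrightarrow> l (k, d)"
    by (metis SigmaI UNIV_I)
  obtain K where K: "0 \<le> K" and near: "\<And>t u. 0 < t \<Longrightarrow> u \<in> borel_measurable M \<Longrightarrow> energy M s p u \<le> 1 \<Longrightarrow>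
    (\<integral>\<^sup>+x. \<integral>\<^sup>+y. ennreal \<bar>u x - u y\<bar> * indicator (ball x (2 * t)) y \<partial>M \<partial>M) \<le> ennreal (K * t powr (n + s))"
    using near_difference_integral[OF p s] unfolding n_def by blast
  have key: "(\<integral>x. \<bar>u i x - u j x\<bar> \<partial>M) \<le> 2 * K / c * t k powr s + V / (c * t k powr n) * (\<Sum>d\<in>D k. \<bar>a i (k, d) - a j (k, d)\<bar>)"
    for i j k
  proof -
    let ?w = "\<lambda>x. u i x - u j x"
    let ?S = "\<Sum>d\<in>D k. \<bar>a i (k, d) - a j (k, d)\<bar>"
    have w: "integrable M ?w" by (intro Bochner_Integration.integrable_diff int)
    have cS: "0 < c * t k powr n" using c_pos t[of k] by auto
    have Seq: "(\<Sum>d\<in>D k. \<bar>\<integral>y. ?w y * indicator (ball d (t k) \<inter> space M) y \<partial>M\<bar>) = ?S"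
      using indi by (simp add: a_def left_diff_distrib)
    have "ennreal (c * t k powr n) * (\<integral>\<^sup>+x. ennreal \<bar>?w x\<bar> \<partial>M) \<le>
      (\<integral>\<^sup>+x. \<integral>\<^sup>+y. ennreal \<bar>?w x - ?w y\<bar> * indicator (ball x (2 * t k)) y \<partial>M \<partial>M) + ennreal (V * ?S)"
      using L1_le_near_difference[OF w t(1)[of k] t(2)[of k] D(1)[of k] D(2)[of k] D(3)[of k]] unfolding Seq n_def V_def .
    also have "(\<integral>\<^sup>+x. \<integral>\<^sup>+y. ennreal \<bar>?w x - ?w y\<bar> * indicator (ball x (2 * t k)) y \<partial>M \<partial>M)
        \<le> ennreal (K * t k powr (n + s)) + ennreal (K * t k powr (n + s))"
      by (intro order_trans[OF near_difference_integral_diff] add_mono near u I t)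
    also have "(\<integral>\<^sup>+x. ennreal \<bar>?w x\<bar> \<partial>M) = ennreal (\<integral>x. \<bar>?w x\<bar> \<partial>M)"
      using w by (intro nn_integral_eq_integral) auto
    finally have "ennreal (c * t k powr n * (\<integral>x. \<bar>?w x\<bar> \<partial>M)) \<le> ennreal (2 * K * t k powr (n + s) + V * ?S)"
      using cS K V0 by (simp add: ennreal_mult[symmetric] ennreal_plus[symmetric] sum_nonneg del: ennreal_plus)
    hence "c * t k powr n * (\<integral>x. \<bar>?w x\<bar> \<partial>M) \<le> 2 * K * t k powr (n + s) + V * ?S"
      using K V0 by (subst (asm) ennreal_le_iff) (auto intro!: add_nonneg_nonneg mult_nonneg_nonneg sum_nonneg)
    hence "(\<integral>x. \<bar>?w x\<bar> \<partial>M) \<le> (2 * K * t k powr (n + s) + V * ?S) / (c * t k powr n)"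
      using cS by (simp add: pos_le_divide_eq mult.commute)
    also have "\<dots> = 2 * K / c * t k powr s + V / (c * t k powr n) * ?S"
      using cS c_pos t[of k] by (simp add: add_divide_distrib powr_add)
    finally show ?thesis .
  qed
  have cauchy: "\<exists>N. \<forall>i\<ge>N. \<forall>j\<ge>N. (\<integral>x. norm (u (r0 i) x - u (r0 j) x) \<partial>M) < e" if e: "0 < e" for e
  proof -
    have "(\<lambda>k. 2 * K / c * t k powr s) \<longlonglongrightarrow> 2 * K / c * 0 powr s"
    proof (intro tendsto_mult tendsto_const tendsto_powr')
      have "t = (\<lambda>k. inverse (real (Suc k)))" by (auto simp: t_def inverse_eq_divide add.commute)
      thus "t \<longlonglongrightarrow> 0" using LIMSEQ_inverse_real_of_nat by simp
      show "(0::real) \<noteq> 0 \<or> 0 < s \<and> (\<forall>\<^sub>F k in sequentially. 0 \<le> t k)"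
        using s t(1) by (auto intro!: always_eventually less_imp_le)
    qed
    hence "eventually (\<lambda>k. 2 * K / c * t k powr s < e / 2) sequentially"
      using e by (intro order_tendstoD) auto
    \<comment> \<open>The scale \<open>k\<close> is fixed before \<open>N\<close>: the part from
      near differences is small uniformly along the sequence, and the finitely many functionals of
      this one scale converge.\<close>
    then obtain k where k: "2 * K / c * t k powr s < e / 2" by (auto simp: eventually_sequentially)
    define B where "B = V / (c * t k powr n)"
    define g where "g i = B * (\<Sum>d\<in>D k. \<bar>a (r0 i) (k, d) - l (k, d)\<bar>)" for i
    have "g \<longlonglongrightarrow> B * (\<Sum>d\<in>D k. \<bar>l (k, d) - l (k, d)\<bar>)"
      unfolding g_def by (intro tendsto_intros l)
    hence "eventually (\<lambda>i. g i < e / 4) sequentially" using e by (intro order_tendstoD) auto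
    then obtain N where N: "\<And>i. i \<ge> N \<Longrightarrow> g i < e / 4" by (auto simp: eventually_sequentially)
    have "(\<integral>x. norm (u (r0 i) x - u (r0 j) x) \<partial>M) < e" if "i \<ge> N" "j \<ge> N" for i j
    proof -
      have "B * (\<Sum>d\<in>D k. \<bar>a (r0 i) (k, d) - a (r0 j) (k, d)\<bar>) \<le> B * (\<Sum>d\<in>D k. \<bar>a (r0 i) (k, d) - l (k, d)\<bar> + \<bar>a (r0 j) (k, d) - l (k, d)\<bar>)"
        using V0 c_pos t[of k] by (intro mult_left_mono sum_mono) (auto simp: B_def)
      also have "\<dots> = g i + g j" by (simp add: g_def sum.distrib distrib_left)
      finally show ?thesis using key[of "r0 i" "r0 j" k] N[OF that(1)] N[OF that(2)] k by (simp add: B_def)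
    qed
    thus ?thesis by blast
  qed
  obtain r1 where r1: "strict_mono r1" "AE x in M. Cauchy (\<lambda>i. u (r0 (r1 i)) x)"
    using cauchy_L1_AE_cauchy_subseq[of M "\<lambda>i. u (r0 i)"] int(1) cauchy by metis
  define v where "v x = lim (\<lambda>i. u (r0 (r1 i)) x)" for x
  have "v \<in> borel_measurable M" unfolding v_def by measurable
  moreover have "AE x in M. (\<lambda>i. u ((r0 \<circ> r1) i) x) \<longlonglongrightarrow> v x"
    using r1(2) by eventually_elim (simp add: v_def Cauchy_convergent_iff convergent_LIMSEQ_iff)
  ultimately show ?thesis using that[of "r0 \<circ> r1" v] strict_mono_o[OF r0(1) r1(1)] by blast
qed

end

section \<open>From almost everywhere convergence to convergence in the target norm\<close>

lemma nn_integral_le_of_AE_tendsto: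
  fixes f :: "nat \<Rightarrow> 'a \<Rightarrow> ennreal"
  assumes [measurable]: "\<And>k. f k \<in> borel_measurable M"
    and lim: "AE x in M. (\<lambda>k. f k x) \<longlonglongrightarrow> g x" and K: "\<And>k. (\<integral>\<^sup>+x. f k x \<partial>M) \<le> K"
  shows "(\<integral>\<^sup>+x. g x \<partial>M) \<le> K"
proof -
  have "(\<integral>\<^sup>+x. g x \<partial>M) = (\<integral>\<^sup>+x. liminf (\<lambda>k. f k x) \<partial>M)"
    using lim by (intro nn_integral_cong_AE) (auto elim!: eventually_mono dest: lim_imp_Liminf[rotated])
  also have "\<dots> \<le> liminf (\<lambda>k. \<integral>\<^sup>+x. f k x \<partial>M)" by (intro nn_integral_liminf) simp
  also have "\<dots> \<le> limsup (\<lambda>k. \<integral>\<^sup>+x. f k x \<partial>M)" by (intro Liminf_le_Limsup) simp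
  also have "\<dots> \<le> K" by (intro Limsup_bounded) (simp add: K)
  finally show ?thesis .
qed

lemma AE_pair_both:
  assumes "sigma_finite_measure M" and "AE x in M. P x"
  shows "AE z in M \<Otimes>\<^sub>M M. P (fst z) \<and> P (snd z)"
proof -
  interpret sigma_finite_measure M by fact
  from assms(2) obtain N where N: "{x \<in> space M. \<not> P x} \<subseteq> N" "emeasure M N = 0" "N \<in> sets M" by (rule AE_E)
  show ?thesis
  proof (rule AE_I)
    show "{z \<in> space (M \<Otimes>\<^sub>M M). \<not> (P (fst z) \<and> P (snd z))} \<subseteq> N \<times> space M \<union> space M \<times> N"
      using N(1) by (auto simp: space_pair_measure)
    have "emeasure (M \<Otimes>\<^sub>M M) (N \<times> space M) = 0" "emeasure (M \<Otimes>\<^sub>M M) (space M \<times> N) = 0"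
      using N by (auto simp: emeasure_pair_measure_Times)
    thus "emeasure (M \<Otimes>\<^sub>M M) (N \<times> space M \<union> space M \<times> N) = 0"
      using N(3) by (subst emeasure_Un_null_set) (auto intro!: null_setsI)
  qed (use N(3) in auto)
qed

context regular_measure
begin

lemma energy_eq_pair_integral:
  assumes [measurable]: "u \<in> borel_measurable M"
  shows "energy M s p u = (\<integral>\<^sup>+z. diff_quot s p u (fst z) (snd z) \<partial>(M \<Otimes>\<^sub>M M))"
proof -
  have [measurable]: "(\<lambda>z. diff_quot s p u (fst z) (snd z)) \<in> borel_measurable (M \<Otimes>\<^sub>M M)"
    using diff_quot_measurable[OF assms, of s p] by (simp add: split_beta')
  show ?thesis unfolding energy_def by (subst nn_integral_fst[symmetric]) auto
qed

lemma pintegral_diff_le: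
  assumes [measurable]: "u \<in> borel_measurable M" "v \<in> borel_measurable M" and p: "0 \<le> p"
  shows "pintegral M p (\<lambda>x. u x - v x) \<le> ennreal (2 powr p) * (pintegral M p u + pintegral M p v)"
proof -
  have "pintegral M p (\<lambda>x. u x - v x) \<le> (\<integral>\<^sup>+x. ennreal (2 powr p) * (ennreal (\<bar>u x\<bar> powr p) + ennreal (\<bar>v x\<bar> powr p)) \<partial>M)"
    unfolding pintegral_def using abs_diff_powr_le[OF p]
    by (intro nn_integral_mono) (simp add: ennreal_mult[symmetric] ennreal_plus[symmetric] ennreal_leI del: ennreal_plus)
  also have "\<dots> = ennreal (2 powr p) * (pintegral M p u + pintegral M p v)"
    unfolding pintegral_def by (simp add: nn_integral_cmult nn_integral_add)
  finally show ?thesis .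
qed

lemma energy_diff_le:
  assumes [measurable]: "u \<in> borel_measurable M" "v \<in> borel_measurable M" and p: "0 \<le> p"
  shows "energy M s p (\<lambda>x. u x - v x) \<le> ennreal (2 powr p) * (energy M s p u + energy M s p v)"
proof -
  have pw: "diff_quot s p (\<lambda>x. u x - v x) x y \<le> ennreal (2 powr p) * (diff_quot s p u x y + diff_quot s p v x y)" for x y
  proof -
    define R where "R = norm (x - y) powr (real DIM('a) + s * p)"
    have "\<bar>u x - v x - (u y - v y)\<bar> powr p / R \<le> 2 powr p * (\<bar>u x - u y\<bar> powr p + \<bar>v x - v y\<bar> powr p) / R"
      using abs_diff_powr_le[OF p, of "u x - u y" "v x - v y"]
      by (intro divide_right_mono) (auto simp: R_def algebra_simps)
    also have "\<dots> = 2 powr p * (\<bar>u x - u y\<bar> powr p / R + \<bar>v x - v y\<bar> powr p / R)" by (simp only: add_divide_distrib times_divide_eq_right distrib_left)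
    finally show ?thesis unfolding diff_quot_def R_def[symmetric]
      by (simp add: ennreal_mult[symmetric] ennreal_plus[symmetric] R_def ennreal_leI del: ennreal_plus)
  qed
  have "energy M s p (\<lambda>x. u x - v x) \<le> (\<integral>\<^sup>+x. \<integral>\<^sup>+y. ennreal (2 powr p) * (diff_quot s p u x y + diff_quot s p v x y) \<partial>M \<partial>M)"
    unfolding energy_def by (intro nn_integral_mono pw)
  also have "\<dots> = ennreal (2 powr p) * (energy M s p u + energy M s p v)"
    unfolding energy_def by (simp add: nn_integral_cmult nn_integral_add cong: nn_integral_cong)
  finally show ?thesis .
qed

lemma energy_embedding:
  fixes p q s s' :: real
  assumes p: "1 \<le> p" "1 \<le> q" and s: "s * p < DIM('a)" "0 < s'" "s' < s" and sub: "DIM('a) / p - s < DIM('a) / q - s'"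
  shows "\<exists>K\<ge>0. \<forall>u\<in>borel_measurable M. pintegral M p u \<le> 1 \<longrightarrow> energy M s p u \<le> 1 \<longrightarrow>
    energy M s' q u \<le> ennreal K \<and> pintegral M q u \<le> ennreal K"
proof (cases "p \<le> q")
  case True
  show ?thesis by (rule energy_embedding_large_exponent[OF p(1) True s sub])
next
  case False
  hence "q < p" by simp
  from energy_embedding_small_exponent[OF p(2) this s(2,3)] obtain K where K: "0 \<le> K"
    "\<And>u. u \<in> borel_measurable M \<Longrightarrow> energy M s' q u \<le> energy M s p u + ennreal K" by blast
  define V where "V = measure M (space M)"
  have "energy M s' q u \<le> ennreal (1 + K + V) \<and> pintegral M q u \<le> ennreal (1 + K + V)"
    if u[measurable]: "u \<in> borel_measurable M" and J: "pintegral M p u \<le> 1" and I: "energy M s p u \<le> 1" for u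
  proof
    have "energy M s' q u \<le> 1 + ennreal K" using K(2)[OF u] I by (meson add_right_mono order_trans)
    also have "\<dots> = ennreal (1 + K)" using K by simp
    also have "\<dots> \<le> ennreal (1 + K + V)" by (intro ennreal_leI) (simp add: V_def)
    finally show "energy M s' q u \<le> ennreal (1 + K + V)" .
    have "\<bar>a\<bar> powr q \<le> 1 + \<bar>a\<bar> powr p" for a :: real
    proof (cases "\<bar>a\<bar> \<le> 1")
      case True
      hence "\<bar>a\<bar> powr q \<le> 1" using p by (intro powr_le1) auto
      thus ?thesis by (auto intro: add_increasing2)
    next
      case False
      hence "\<bar>a\<bar> powr q \<le> \<bar>a\<bar> powr p" using \<open>q < p\<close> by (intro powr_mono) auto
      thus ?thesis by simp
    qed
    hence "pintegral M q u \<le> (\<integral>\<^sup>+x. 1 + ennreal (\<bar>u x\<bar> powr p) \<partial>M)"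
      unfolding pintegral_def
      by (intro nn_integral_mono) (simp add: ennreal_plus[symmetric] ennreal_1[symmetric] ennreal_leI del: ennreal_plus ennreal_1)
    also have "\<dots> = ennreal V + pintegral M p u"
      unfolding pintegral_def by (subst nn_integral_add) (auto simp: emeasure_eq_measure V_def)
    also have "\<dots> \<le> ennreal V + 1" by (intro add_mono J) simp
    also have "\<dots> = ennreal (V + 1)" by (simp add: V_def)
    also have "\<dots> \<le> ennreal (1 + K + V)" using K by (intro ennreal_leI) simp
    finally show "pintegral M q u \<le> ennreal (1 + K + V)" .
  qed
  moreover have "0 \<le> 1 + K + V" using K by (simp add: V_def)
  ultimately show ?thesis by blast
qed

lemma energy_compactness:
  fixes p q s s' :: real and u :: "nat \<Rightarrow> 'a \<Rightarrow> real"
  assumes p: "1 \<le> p" "1 \<le> q" and s: "s * p < DIM('a)" "0 \<le> s'" "s' < s" and sub: "DIM('a) / p - s < DIM('a) / q - s'"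
    and u[measurable]: "\<And>n. u n \<in> borel_measurable M"
    and J: "\<And>n. pintegral M p (u n) \<le> 1" and I: "\<And>n. energy M s p (u n) \<le> 1"
  obtains r v where "strict_mono r" "v \<in> borel_measurable M"
    "pintegral M p v \<le> 1" "energy M s p v \<le> 1"
    "(\<lambda>k. pintegral M q (\<lambda>x. u (r k) x - v x)) \<longlonglongrightarrow> 0"
    "(\<lambda>k. energy M s' q (\<lambda>x. u (r k) x - v x)) \<longlonglongrightarrow> 0"
proof -
  define n where "n = real DIM('a)"
  have n0: "0 < n" by (simp add: n_def)
  have s0: "0 < s" using s by simp
  \<comment> \<open>Moving to \<open>(s2, q2)\<close> costs \<open>2 * e\<close>, and a third of the
    slack keeps the inequality strict; half of the loss of order keeps \<open>s2 < s\<close>; the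
    last term keeps the denominator of \<open>q2\<close> positive.\<close>
  define e where "e = min (min ((n / q - s' - (n / p - s)) / 3) ((s - s') / 2)) (n / (2 * q))"
  have e: "0 < e" using sub s p n0 by (auto simp: e_def n_def)
  have e': "3 * e \<le> n / q - s' - (n / p - s)" "2 * e \<le> s - s'" "e \<le> n / (2 * q)"
  proof -
    have "e \<le> (n / q - s' - (n / p - s)) / 3" "e \<le> (s - s') / 2" unfolding e_def
      by (meson min.cobounded1 min.cobounded2 min.coboundedI1)+
    thus "3 * e \<le> n / q - s' - (n / p - s)" "2 * e \<le> s - s'" by simp_all
  qed (simp add: e_def)
  define q2 where "q2 = n / (n / q - e)"
  define s2 where "s2 = s' + e"
  have nq: "n / q = 2 * (n / (2 * q))" by simp
  have den: "0 < n / q - e" using e' e nq by linarith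
  have q2: "n / q2 = n / q - e" using n0 by (simp add: q2_def)
  have qq2: "q < q2" unfolding q2_def using den e p n0 by (simp add: less_divide_eq right_diff_distrib)
  have al: "(n / q + s') * q = n + s' * q" "(n / q + s') * q2 = n + s2 * q2"
  proof -
    show "(n / q + s') * q = n + s' * q" using p by (simp add: distrib_right)
    have "n / q + s' = n / q2 + s2" by (simp add: q2 s2_def)
    thus "(n / q + s') * q2 = n + s2 * q2" using p qq2 by (simp add: distrib_right)
  qed
  have "1 \<le> q2" "0 < s2" "s2 < s" "n / p - s < n / q2 - s2"
    using p qq2 s e e' by (auto simp: s2_def q2)
  from energy_embedding[OF p(1) this(1) s(1) this(2-)[unfolded n_def]] obtain K where K: "0 \<le> K"
    "\<And>u. u \<in> borel_measurable M \<Longrightarrow> pintegral M p u \<le> 1 \<Longrightarrow> energy M s p u \<le> 1 \<Longrightarrow> energy M s2 q2 u \<le> ennreal K"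
    "\<And>u. u \<in> borel_measurable M \<Longrightarrow> pintegral M p u \<le> 1 \<Longrightarrow> energy M s p u \<le> 1 \<Longrightarrow> pintegral M q2 u \<le> ennreal K"
    by blast
  obtain r v where r: "strict_mono r" and v[measurable]: "v \<in> borel_measurable M"
    and ae: "AE x in M. (\<lambda>k. u (r k) x) \<longlonglongrightarrow> v x"
    by (rule ae_compactness[OF p(1) s0 u J I]) (erule (2) that)
  interpret MM: pair_sigma_finite M M ..
  note ae2 = AE_pair_both[OF sigma_finite_measure_axioms ae]
  have dqm[measurable]: "(\<lambda>z. diff_quot s p w (fst z) (snd z)) \<in> borel_measurable (M \<Otimes>\<^sub>M M)"
    if "w \<in> borel_measurable M" for w s p using diff_quot_measurable[OF that, of s p] by (simp add: split_beta')
  \<comment> \<open>Fatou keeps the limit in the unit ball, so the differences from it are bounded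
    in the stronger norm too.\<close>
  have Jv: "pintegral M p v \<le> 1"
    unfolding pintegral_def
  proof (rule nn_integral_le_of_AE_tendsto[where f = "\<lambda>k x. ennreal (\<bar>u (r k) x\<bar> powr p)"])
    show "AE x in M. (\<lambda>k. ennreal (\<bar>u (r k) x\<bar> powr p)) \<longlonglongrightarrow> ennreal (\<bar>v x\<bar> powr p)"
      using ae by eventually_elim (use p in \<open>intro tendsto_ennrealI tendsto_powr' tendsto_rabs tendsto_const; auto\<close>)
    show "(\<integral>\<^sup>+x. ennreal (\<bar>u (r k) x\<bar> powr p) \<partial>M) \<le> 1" for k using J by (simp add: pintegral_def)
  qed measurable
  have Iv: "energy M s p v \<le> 1"
    unfolding energy_eq_pair_integral[OF v]
  proof (rule nn_integral_le_of_AE_tendsto[where f = "\<lambda>k z. diff_quot s p (u (r k)) (fst z) (snd z)"])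
    show "AE z in M \<Otimes>\<^sub>M M. (\<lambda>k. diff_quot s p (u (r k)) (fst z) (snd z)) \<longlonglongrightarrow> diff_quot s p v (fst z) (snd z)"
      using ae2
    proof eventually_elim
      case (elim z)
      have "(\<lambda>k. \<bar>u (r k) (fst z) - u (r k) (snd z)\<bar> powr p * inverse (norm (fst z - snd z) powr (DIM('a) + s * p)))
        \<longlonglongrightarrow> \<bar>v (fst z) - v (snd z)\<bar> powr p * inverse (norm (fst z - snd z) powr (DIM('a) + s * p))"
        using elim p by (intro tendsto_mult tendsto_powr' tendsto_rabs tendsto_diff tendsto_const) auto
      thus ?case unfolding diff_quot_def divide_inverse by (rule tendsto_ennrealI)
    qed
    show "(\<integral>\<^sup>+z. diff_quot s p (u (r k)) (fst z) (snd z) \<partial>(M \<Otimes>\<^sub>M M)) \<le> 1" for k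
      using I[of "r k"] by (simp add: energy_eq_pair_integral)
  qed measurable
  define w where "w k = (\<lambda>x. u (r k) x - v x)" for k
  have w[measurable]: "w k \<in> borel_measurable M" for k unfolding w_def by measurable
  have aew: "AE x in M. (\<lambda>k. w k x) \<longlonglongrightarrow> 0"
    using ae by eventually_elim (simp add: w_def LIM_zero)
  have bd: "pintegral M q2 (w k) \<le> ennreal (2 powr q2 * (K + K))" "energy M s2 q2 (w k) \<le> ennreal (2 powr q2 * (K + K))" for k
  proof -
    have "pintegral M q2 (w k) \<le> ennreal (2 powr q2) * (pintegral M q2 (u (r k)) + pintegral M q2 v)"
      unfolding w_def using p qq2 by (intro pintegral_diff_le) auto
    also have "\<dots> \<le> ennreal (2 powr q2) * (ennreal K + ennreal K)"
      by (intro mult_left_mono add_mono K J I Jv Iv u v) auto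
    finally show "pintegral M q2 (w k) \<le> ennreal (2 powr q2 * (K + K))" using K(1) by (simp add: ennreal_mult[symmetric] ennreal_plus[symmetric] del: ennreal_plus)
    have "energy M s2 q2 (w k) \<le> ennreal (2 powr q2) * (energy M s2 q2 (u (r k)) + energy M s2 q2 v)"
      unfolding w_def using p qq2 by (intro energy_diff_le) auto
    also have "\<dots> \<le> ennreal (2 powr q2) * (ennreal K + ennreal K)"
      by (intro mult_left_mono add_mono K J I Jv Iv u v) auto
    finally show "energy M s2 q2 (w k) \<le> ennreal (2 powr q2 * (K + K))" using K(1) by (simp add: ennreal_mult[symmetric] ennreal_plus[symmetric] del: ennreal_plus)
  qed
  have "(\<lambda>k. pintegral M q (w k)) \<longlonglongrightarrow> 0"
    unfolding pintegral_def
    by (rule powr_integral_tendsto_zero[OF finite_measure_axioms w aew bd(1)[unfolded pintegral_def]]) (use p qq2 in auto)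
  moreover have "(\<lambda>k. energy M s' q (w k)) \<longlonglongrightarrow> 0"
  proof -
    define f where "f k z = (w k (fst z) - w k (snd z)) / norm (fst z - snd z) powr (n / q + s')" for k z
    have fm[measurable]: "f k \<in> borel_measurable (M \<Otimes>\<^sub>M M)" for k unfolding f_def by measurable
    have f1: "ennreal (\<bar>f k z\<bar> powr q) = diff_quot s' q (w k) (fst z) (snd z)" for k z
      unfolding f_def diff_quot_def n_def[symmetric] al(1)[symmetric]
      by (simp add: powr_divide powr_powr)
    have f2: "ennreal (\<bar>f k z\<bar> powr q2) = diff_quot s2 q2 (w k) (fst z) (snd z)" for k z
      unfolding f_def diff_quot_def n_def[symmetric] al(2)[symmetric]
      by (simp add: powr_divide powr_powr)
    have "(\<lambda>k. \<integral>\<^sup>+z. ennreal (\<bar>f k z\<bar> powr q) \<partial>(M \<Otimes>\<^sub>M M)) \<longlonglongrightarrow> 0"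
    proof (rule powr_integral_tendsto_zero)
      show "finite_measure (M \<Otimes>\<^sub>M M)" 
        by (intro finite_measureI) (simp add: space_pair_measure emeasure_pair_measure_Times emeasure_eq_measure ennreal_mult_eq_top_iff)
      show "AE z in M \<Otimes>\<^sub>M M. (\<lambda>k. f k z) \<longlonglongrightarrow> 0"
        using AE_pair_both[OF sigma_finite_measure_axioms aew]
      proof eventually_elim
        case (elim z)
        have "(\<lambda>k. (w k (fst z) - w k (snd z)) * inverse (norm (fst z - snd z) powr (n / q + s'))) \<longlonglongrightarrow>
           (0 - 0) * inverse (norm (fst z - snd z) powr (n / q + s'))"
          using elim by (intro tendsto_intros) auto
        thus ?case by (simp add: f_def divide_inverse)
      qed
      show "(\<integral>\<^sup>+z. ennreal (\<bar>f k z\<bar> powr q2) \<partial>(M \<Otimes>\<^sub>M M)) \<le> ennreal (2 powr q2 * (K + K))" for k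
        unfolding f2 using bd(2)[of k] by (simp add: energy_eq_pair_integral)
    qed (use p qq2 in auto)
    thus ?thesis unfolding f1 by (simp add: energy_eq_pair_integral)
  qed
  ultimately show ?thesis by (intro that[OF r v Jv Iv]) (simp_all add: w_def)
qed

end

section \<open>Smooth bump functions\<close>

text \<open>The functions P(1 / t) exp(-1 / t) form a family closed under differentiation, so that
  smoothness becomes an induction in which the polynomial varies.\<close>

definition bump :: "real poly \<Rightarrow> real \<Rightarrow> real" where
  "bump P t = (if 0 < t then poly P (1 / t) * exp (- (1 / t)) else 0)"

text \<open>With y = 1 / t the chain rule contributes -y^2, and the derivative of P(y) exp(-y) in y
  is (P' - P)(y) exp(-y). The factor \<open>[:0, 0, 1:]\<close> is y^2.\<close>

definition bump_deriv :: "real poly \<Rightarrow> real poly" where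
  "bump_deriv P = (P - pderiv P) * [:0, 0, 1:]"

lemma poly_exp_tendsto_0: "((\<lambda>y. poly P y * exp (- y)) \<longlongrightarrow> (0::real)) at_top"
proof -
  have "((\<lambda>y. \<Sum>i\<le>degree P. coeff P i * (y ^ i / exp y)) \<longlongrightarrow> (\<Sum>i\<le>degree P. coeff P i * 0)) at_top"
    by (intro tendsto_intros tendsto_power_div_exp_0)
  moreover have "(\<lambda>y. \<Sum>i\<le>degree P. coeff P i * (y ^ i / exp y)) = (\<lambda>y. poly P y * exp (- y))"
    by (simp add: fun_eq_iff poly_altdef sum_divide_distrib exp_minus divide_inverse[symmetric])
  ultimately show ?thesis by simp
qed

lemma bump_has_real_derivative: "(bump P has_real_derivative bump (bump_deriv P) t) (at t)"
proof (cases t "0 :: real" rule: linorder_cases)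
  case less
  have "((\<lambda>_. 0) has_real_derivative 0) (at t)" by simp
  hence "(bump P has_real_derivative 0) (at t)"
    by (rule has_field_derivative_transform_within_open[of _ _ _ "{..<0}"]) (use less in \<open>auto simp: bump_def\<close>)
  thus ?thesis using less by (simp add: bump_def)
next
  case equal
  \<comment> \<open>The difference quotient at 0 from the right is again of this form: division by h
    multiplies \<open>P\<close> by its variable.\<close>
  have "((\<lambda>h. poly ([:0, 1:] * P) (inverse h) * exp (- inverse h)) \<longlongrightarrow> 0) (at_right 0)"
    using filterlim_compose[OF poly_exp_tendsto_0 filterlim_inverse_at_top_right] .
  hence "((\<lambda>h. bump P h / h) \<longlongrightarrow> 0) (at_right 0)"
    by (rule Lim_transform_eventually)
      (auto simp: eventually_at_right_field bump_def divide_inverse intro!: exI[of _ 1])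
  moreover have "((\<lambda>h. bump P h / h) \<longlongrightarrow> 0) (at_left 0)"
    by (rule Lim_transform_eventually[OF tendsto_const])
      (auto simp: eventually_at_left_field bump_def intro!: exI[of _ "-1"])
  ultimately have "((\<lambda>h. bump P h / h) \<longlongrightarrow> 0) (at 0)" by (simp add: filterlim_at_split)
  thus ?thesis unfolding equal by (simp add: DERIV_def bump_def)
next
  case greater
  have "((\<lambda>t. poly P (1 / t) * exp (- (1 / t))) has_real_derivative bump (bump_deriv P) t) (at t)"
    using greater
    by (auto intro!: derivative_eq_intros poly_DERIV[THEN DERIV_chain2] simp: bump_def bump_deriv_def field_simps power2_eq_square)
  thus ?thesis
    by (rule has_field_derivative_transform_within_open[of _ _ _ "{0<..}"]) (use greater in \<open>auto simp: bump_def\<close>)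
qed

lemma Ck_add: "Ck k f \<Longrightarrow> Ck k g \<Longrightarrow> Ck k (\<lambda>x. f x + g x)"
proof (induction k arbitrary: f g)
  case (Suc k)
  have "partial_deriv b (\<lambda>x. f x + g x) = (\<lambda>x. partial_deriv b f x + partial_deriv b g x)" for b
  proof
    fix x
    have "(f has_derivative frechet_derivative f (at x)) (at x)" "(g has_derivative frechet_derivative g (at x)) (at x)"
      using Suc.prems by (auto simp: differentiable_on_def frechet_derivative_works)
    hence "((\<lambda>x. f x + g x) has_derivative (\<lambda>h. frechet_derivative f (at x) h + frechet_derivative g (at x) h)) (at x)"
      by (rule has_derivative_add)
    from frechet_derivative_at[OF this, symmetric]
    show "partial_deriv b (\<lambda>x. f x + g x) x = partial_deriv b f x + partial_deriv b g x"
      unfolding partial_deriv_def by simp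
  qed
  then show ?case using Suc by (auto intro!: differentiable_on_add)
qed (auto intro: continuous_on_add)

lemma Ck_cmult: "Ck k f \<Longrightarrow> Ck k (\<lambda>x. c * f x)"
proof (induction k arbitrary: f)
  case (Suc k)
  have "partial_deriv b (\<lambda>x. c * f x) = (\<lambda>x. c * partial_deriv b f x)" for b
  proof
    fix x
    have "(f has_derivative frechet_derivative f (at x)) (at x)"
      using Suc.prems by (auto simp: differentiable_on_def frechet_derivative_works)
    hence "((\<lambda>x. c * f x) has_derivative (\<lambda>h. c * frechet_derivative f (at x) h)) (at x)"
      by (rule has_derivative_mult_right)
    from frechet_derivative_at[OF this, symmetric]
    show "partial_deriv b (\<lambda>x. c * f x) x = c * partial_deriv b f x"
      unfolding partial_deriv_def by simp
  qed
  then show ?case using Suc by (auto intro!: differentiable_on_mult)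
qed (auto intro: continuous_on_mult_left)

lemma Ck_zero: "Ck k (\<lambda>x. 0)"
  by (induction k) (auto simp: partial_deriv_def[abs_def])

lemma Ck_sum: "(\<And>i. i \<in> I \<Longrightarrow> Ck k (f i)) \<Longrightarrow> Ck k (\<lambda>x. \<Sum>i\<in>I. f i x)"
  by (induction I rule: infinite_finite_induct) (auto intro: Ck_zero Ck_add)

text \<open>One-dimensional bumps along arbitrary directions. Differentiation changes one polynomial
  and multiplies by a number, so partial derivatives are linear combinations of functions of the
  same kind; this drives the induction in \<open>Ck_ridge_product\<close>.\<close>

definition ridge_product :: "'i set \<Rightarrow> ('i \<Rightarrow> 'a::euclidean_space) \<Rightarrow> ('i \<Rightarrow> real) \<Rightarrow> ('i \<Rightarrow> real poly) \<Rightarrow> 'a \<Rightarrow> real" where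
  "ridge_product I a d P x = (\<Prod>i\<in>I. bump (P i) (a i \<bullet> x + d i))"

lemma ridge_product_has_derivative:
  assumes "finite I"
  shows "(ridge_product I a d P has_derivative
    (\<lambda>h. \<Sum>i\<in>I. (a i \<bullet> h) * ridge_product I a d (P(i := bump_deriv (P i))) x)) (at x)"
proof -
  have "((\<lambda>x. \<Prod>i\<in>I. bump (P i) (a i \<bullet> x + d i)) has_derivative
     (\<lambda>h. \<Sum>i\<in>I. (bump (bump_deriv (P i)) (a i \<bullet> x + d i) * (a i \<bullet> h)) * (\<Prod>j\<in>I - {i}. bump (P j) (a j \<bullet> x + d j)))) (at x)"
  proof (rule has_derivative_prod)
    fix i assume "i \<in> I"
    have "((\<lambda>x. a i \<bullet> x + d i) has_derivative (\<lambda>h. a i \<bullet> h)) (at x)" by (auto intro!: derivative_eq_intros)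
    from DERIV_compose_FDERIV[OF bump_has_real_derivative this]
    show "((\<lambda>x. bump (P i) (a i \<bullet> x + d i)) has_derivative (\<lambda>h. bump (bump_deriv (P i)) (a i \<bullet> x + d i) * (a i \<bullet> h))) (at x)"
      by (simp add: mult.commute)
  qed
  moreover have "(bump (bump_deriv (P i)) (a i \<bullet> x + d i) * (a i \<bullet> h)) * (\<Prod>j\<in>I - {i}. bump (P j) (a j \<bullet> x + d j))
     = (a i \<bullet> h) * ridge_product I a d (P(i := bump_deriv (P i))) x" if "i \<in> I" for i h
    unfolding ridge_product_def using assms that by (subst prod.remove[of I i]) auto
  ultimately show ?thesis unfolding ridge_product_def[abs_def] by (simp cong: sum.cong)
qed

lemma partial_deriv_ridge_product:
  assumes "finite I"
  shows "partial_deriv b (ridge_product I a d P) =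
    (\<lambda>x. \<Sum>i\<in>I. (a i \<bullet> b) * ridge_product I a d (P(i := bump_deriv (P i))) x)"
  unfolding partial_deriv_def fun_eq_iff frechet_derivative_at[OF ridge_product_has_derivative[OF assms], symmetric] by simp

lemma Ck_ridge_product:
  assumes "finite I"
  shows "Ck k (ridge_product I a d P)"
proof (induction k arbitrary: P)
  case 0
  show ?case using ridge_product_has_derivative[OF assms, THEN has_derivative_continuous]
    by (auto intro!: continuous_at_imp_continuous_on)
next
  case (Suc k)
  have "ridge_product I a d P differentiable_on UNIV"
    unfolding differentiable_on_def differentiable_def
    by (intro ballI exI) (rule ridge_product_has_derivative[OF assms, THEN has_derivative_at_withinI])
  then show ?case using Suc by (auto simp: partial_deriv_ridge_product[OF assms] intro!: Ck_sum Ck_cmult)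
qed

text \<open>Smooth functions increasing to the indicator of the open box as \<open>m \<rightarrow> \<infinity>\<close>: the factors are
  \<open>bump 1 (m (x - l))\<close> and \<open>bump 1 (m (h - x))\<close> in each coordinate.\<close>

definition box_bump :: "nat \<Rightarrow> 'a::euclidean_space \<Rightarrow> 'a \<Rightarrow> 'a \<Rightarrow> real" where
  "box_bump m l h = ridge_product (Basis \<times> UNIV)
     (\<lambda>(b, c). if c then real (Suc m) *\<^sub>R b else - (real (Suc m) *\<^sub>R b))
     (\<lambda>(b, c). if c then - real (Suc m) * (l \<bullet> b) else real (Suc m) * (h \<bullet> b)) (\<lambda>_. 1)"

lemma box_bump_eq:
  "box_bump m l h x = (\<Prod>b\<in>Basis. bump 1 (real (Suc m) * ((x - l) \<bullet> b)) * bump 1 (real (Suc m) * ((h - x) \<bullet> b)))"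
proof -
  have "box_bump m l h x = (\<Prod>b\<in>Basis. \<Prod>c\<in>UNIV. bump 1 (if c then real (Suc m) * ((x - l) \<bullet> b) else real (Suc m) * ((h - x) \<bullet> b)))"
    unfolding box_bump_def ridge_product_def prod.cartesian_product
    by (intro prod.cong refl) (auto simp: inner_diff_left algebra_simps inner_commute split: prod.split intro!: arg_cong[of _ _ "bump 1"])
  thus ?thesis by (simp add: UNIV_bool mult.commute)
qed

lemma bump_1: "bump 1 t = (if 0 < t then exp (- (1 / t)) else 0)"
  by (simp add: bump_def)

lemma box_bump_bounds: "0 \<le> box_bump m l h x" "box_bump m l h x \<le> 1"
  unfolding box_bump_eq by (auto simp: bump_1 intro!: prod_nonneg prod_le_1 mult_le_one)

lemma bump_outside: "t \<le> 0 \<Longrightarrow> bump P t = 0"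
  by (simp add: bump_def)

text \<open>Outside the open box some factor has a nonpositive argument, and that factor vanishes
  for every polynomial. So the derivatives vanish as well, also on the faces.\<close>

lemma box_bump_outside:
  assumes "x \<notin> box l h"
  shows "box_bump m l h x = 0" "partial_deriv b (box_bump m l h) x = 0"
proof -
  obtain b0 where b0: "b0 \<in> Basis" "(x - l) \<bullet> b0 \<le> 0 \<or> (h - x) \<bullet> b0 \<le> 0"
    using assms by (auto simp: mem_box inner_diff_left not_less)
  let ?a = "\<lambda>(b, c). if c then real (Suc m) *\<^sub>R b else - (real (Suc m) *\<^sub>R b)"
  let ?d = "\<lambda>(b, c). if c then - real (Suc m) * (l \<bullet> b) else real (Suc m) * (h \<bullet> b)"
  define c0 where "c0 = ((x - l) \<bullet> b0 \<le> 0)"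
  have "?a (b0, c0) \<bullet> x + ?d (b0, c0) = (if c0 then real (Suc m) * ((x - l) \<bullet> b0) else real (Suc m) * ((h - x) \<bullet> b0))"
    by (auto simp: inner_diff_left algebra_simps inner_commute)
  also have "\<dots> \<le> 0" using b0(2) by (auto simp: c0_def mult_le_0_iff)
  finally have neg: "?a (b0, c0) \<bullet> x + ?d (b0, c0) \<le> 0" .
  have zero: "ridge_product (Basis \<times> UNIV) ?a ?d P x = 0" for P
    unfolding ridge_product_def
    by (rule prod_zero, simp, rule bexI[of _ "(b0, c0)"], rule bump_outside[OF neg]) (simp add: b0(1))
  show "box_bump m l h x = 0" unfolding box_bump_def by (rule zero)
  show "partial_deriv b (box_bump m l h) x = 0"
    unfolding box_bump_def by (subst partial_deriv_ridge_product) (auto simp: zero)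
qed

lemma test_function_box_bump:
  assumes "cbox l h \<subseteq> \<Omega>"
  shows "test_function \<Omega> (box_bump m l h)"
proof -
  have "closure {x. box_bump m l h x \<noteq> 0} \<subseteq> cbox l h"
    using box_bump_outside(1)[of _ l h m] box_subset_cbox[of l h]
    by (intro closure_minimal) auto
  moreover from this have "compact (closure {x. box_bump m l h x \<noteq> 0})"
    using bounded_subset[OF bounded_cbox] by (auto simp: compact_eq_bounded_closed)
  moreover have "Ck k (box_bump m l h)" for k unfolding box_bump_def by (rule Ck_ridge_product) simp
  ultimately show ?thesis using assms by (auto simp: test_function_def)
qed

lemma box_bump_translate: "box_bump m l h (x - z) = box_bump m (l + z) (h + z) x"
  unfolding box_bump_eq by (simp add: algebra_simps)

lemma box_bump_tendsto: "(\<lambda>m. box_bump m l h x) \<longlonglongrightarrow> indicator (box l h) x"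
proof (cases "x \<in> box l h")
  case True
  have b1: "(\<lambda>m. bump 1 (real (Suc m) * t)) \<longlonglongrightarrow> 1" if "0 < t" for t
  proof -
    have "(\<lambda>m. exp (- (inverse (real (Suc m)) * (1 / t)))) \<longlonglongrightarrow> exp (- (0 * (1 / t)))"
      by (intro tendsto_intros LIMSEQ_inverse_real_of_nat)
    thus ?thesis using that by (simp add: bump_1 divide_inverse)
  qed
  have "(\<lambda>m. box_bump m l h x) \<longlonglongrightarrow> (\<Prod>b\<in>(Basis::'a set). 1 * 1)"
    unfolding box_bump_eq using True
    by (intro tendsto_prod tendsto_mult b1) (auto simp: mem_box inner_diff_left)
  thus ?thesis using True by simp
qed (simp add: box_bump_outside)

lemma continuous_on_box_bump:
  "continuous_on A (box_bump m l h)" "continuous_on A (partial_deriv b (box_bump m l h))"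
proof -
  let ?I = "Basis \<times> UNIV :: ('a \<times> bool) set"
  have c: "continuous_on A (ridge_product ?I a d P)" for a d P
    using Ck_ridge_product[of ?I 0 a d P] by (auto intro: continuous_on_subset)
  show "continuous_on A (box_bump m l h)" unfolding box_bump_def by (rule c)
  show "continuous_on A (partial_deriv b (box_bump m l h))"
    unfolding box_bump_def by (subst partial_deriv_ridge_product) (auto intro!: continuous_intros c)
qed

lemma bounded_partial_deriv_box_bump: "\<exists>B. \<forall>x. \<bar>partial_deriv b (box_bump m l h) x\<bar> \<le> B"
proof -
  have "compact (partial_deriv b (box_bump m l h) ` cbox l h)"
    by (intro compact_continuous_image continuous_on_box_bump compact_cbox)
  then obtain B where B: "\<And>y. y \<in> partial_deriv b (box_bump m l h) ` cbox l h \<Longrightarrow> \<bar>y\<bar> \<le> B"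
    using compact_imp_bounded bounded_iff by (metis real_norm_def)
  have "\<bar>partial_deriv b (box_bump m l h) x\<bar> \<le> max B 0" for x
  proof (cases "x \<in> box l h")
    case True
    thus ?thesis using B box_subset_cbox[of l h] by (auto simp: le_max_iff_disj)
  qed (simp add: box_bump_outside)
  thus ?thesis by blast
qed

lemma box_bump_has_derivative:
  "(box_bump m l h has_derivative (\<lambda>v. \<Sum>b\<in>Basis. (v \<bullet> b) * partial_deriv b (box_bump m l h) x)) (at x)"
proof -
  have d: "(box_bump m l h has_derivative frechet_derivative (box_bump m l h) (at x)) (at x)"
    unfolding box_bump_def frechet_derivative_works[symmetric] differentiable_def
    by (rule exI, rule ridge_product_has_derivative) simp
  then interpret linear "frechet_derivative (box_bump m l h) (at x)" by (rule has_derivative_linear)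
  have "frechet_derivative (box_bump m l h) (at x) v = (\<Sum>b\<in>Basis. (v \<bullet> b) * partial_deriv b (box_bump m l h) x)" for v
  proof -
    have "frechet_derivative (box_bump m l h) (at x) v = frechet_derivative (box_bump m l h) (at x) (\<Sum>b\<in>Basis. (v \<bullet> b) *\<^sub>R b)"
      by (simp add: euclidean_representation)
    also have "\<dots> = (\<Sum>b\<in>Basis. (v \<bullet> b) * partial_deriv b (box_bump m l h) x)"
      by (simp add: sum scale partial_deriv_def)
    finally show ?thesis .
  qed
  hence "frechet_derivative (box_bump m l h) (at x) = (\<lambda>v. \<Sum>b\<in>Basis. (v \<bullet> b) * partial_deriv b (box_bump m l h) x)"
    by (rule ext)
  thus ?thesis using d by (simp only:)
qed

section \<open>Differences of functions with a weak gradient\<close>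

lemma lborel_integral_translate:
  fixes F :: "'a::euclidean_space \<Rightarrow> 'b::{banach, second_countable_topology}"
  assumes [measurable]: "F \<in> borel_measurable borel"
  shows "(\<integral>x. F (x + z) \<partial>lborel) = (\<integral>x. F x \<partial>lborel)"
proof -
  have "(\<integral>x. F x \<partial>lborel) = (\<integral>x. F x \<partial>distr lborel borel ((+) z))" by (simp add: lborel_distr_plus)
  also have "\<dots> = (\<integral>x. F (z + x) \<partial>lborel)" by (subst integral_distr) auto
  finally show ?thesis by (simp add: add.commute)
qed

lemma lborel_nn_integral_translate:
  fixes F :: "'a::euclidean_space \<Rightarrow> ennreal"
  assumes [measurable]: "F \<in> borel_measurable borel"
  shows "(\<integral>\<^sup>+x. F (x + z) \<partial>lborel) = (\<integral>\<^sup>+x. F x \<partial>lborel)"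
proof -
  have "(\<integral>\<^sup>+x. F x \<partial>lborel) = (\<integral>\<^sup>+x. F x \<partial>distr lborel borel ((+) z))" by (simp add: lborel_distr_plus)
  also have "\<dots> = (\<integral>\<^sup>+x. F (z + x) \<partial>lborel)" by (subst nn_integral_distr) auto
  finally show ?thesis by (simp add: add.commute)
qed

lemma lborel_integrable_translate:
  fixes F :: "'a::euclidean_space \<Rightarrow> real"
  assumes F: "integrable lborel F"
  shows "integrable lborel (\<lambda>x. F (x + z))"
proof -
  have [measurable]: "F \<in> borel_measurable borel" using borel_measurable_integrable[OF F] by simp
  have "integrable (distr lborel borel ((+) z)) F" using F by (simp add: lborel_distr_plus)
  hence "integrable lborel (\<lambda>x. F (z + x))" by (subst (asm) integrable_distr_eq) auto
  thus ?thesis by (simp add: add.commute)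
qed

text \<open>For fixed \<tau> the translation by \<tau> z preserves Lebesgue measure, so integrating
  in x before \<tau> bounds the norm by \<open>B\<close> times that of \<open>W\<close>. This
  justifies the exchanges of integrals below.\<close>

lemma integrable_shear:
  fixes W :: "'a::euclidean_space \<Rightarrow> real" and A :: "'a \<times> real \<Rightarrow> real"
  assumes W: "integrable lborel W" and A[measurable]: "A \<in> borel_measurable borel" and B: "\<And>y. \<bar>A y\<bar> \<le> B"
  shows "integrable (lborel \<Otimes>\<^sub>M lborel) (\<lambda>(x, \<tau>). indicator {0..1} \<tau> * (W (x + \<tau> *\<^sub>R z) * A (x, \<tau>)))"
proof (rule integrableI_bounded)
  have [measurable]: "W \<in> borel_measurable borel" using borel_measurable_integrable[OF W] by simp
  let ?f = "\<lambda>(x::'a, \<tau>). indicator {0..1} \<tau> * (W (x + \<tau> *\<^sub>R z) * A (x, \<tau>))"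
  show m: "?f \<in> borel_measurable (lborel \<Otimes>\<^sub>M lborel)"
    unfolding lborel_prod by (simp add: borel_prod[symmetric])
  have B0: "0 \<le> B" using order_trans[OF abs_ge_zero B] by blast
  have "(\<integral>\<^sup>+z. ennreal (norm (?f z)) \<partial>(lborel \<Otimes>\<^sub>M lborel))
     = (\<integral>\<^sup>+\<tau>. \<integral>\<^sup>+x. ennreal (norm (?f (x, \<tau>))) \<partial>lborel \<partial>lborel)"
    using m by (intro lborel_pair.nn_integral_snd[symmetric]) measurable
  also have "\<dots> \<le> (\<integral>\<^sup>+\<tau>. indicator {0..1} \<tau> * (\<integral>\<^sup>+x. ennreal B * ennreal \<bar>W (x + \<tau> *\<^sub>R z)\<bar> \<partial>lborel) \<partial>lborel)"
  proof (intro nn_integral_mono)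
    fix \<tau> :: real
    have "(\<integral>\<^sup>+x. ennreal (norm (?f (x, \<tau>))) \<partial>lborel) \<le> (\<integral>\<^sup>+x. indicator {0..1} \<tau> * (ennreal B * ennreal \<bar>W (x + \<tau> *\<^sub>R z)\<bar>) \<partial>lborel)"
    proof (intro nn_integral_mono)
      fix x
      have "\<bar>W (x + \<tau> *\<^sub>R z) * A (x, \<tau>)\<bar> \<le> B * \<bar>W (x + \<tau> *\<^sub>R z)\<bar>"
        using mult_left_mono[OF B[of "(x, \<tau>)"] abs_ge_zero[of "W (x + \<tau> *\<^sub>R z)"]] by (simp add: abs_mult mult.commute)
      thus "ennreal (norm (?f (x, \<tau>))) \<le> indicator {0..1} \<tau> * (ennreal B * ennreal \<bar>W (x + \<tau> *\<^sub>R z)\<bar>)"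
        using B0 by (auto simp: indicator_def ennreal_mult[symmetric] intro!: ennreal_leI)
    qed
    also have "\<dots> = indicator {0..1} \<tau> * (\<integral>\<^sup>+x. ennreal B * ennreal \<bar>W (x + \<tau> *\<^sub>R z)\<bar> \<partial>lborel)"
      by (intro nn_integral_cmult) measurable
    finally show "(\<integral>\<^sup>+x. ennreal (norm (?f (x, \<tau>))) \<partial>lborel) \<le> indicator {0..1} \<tau> * (\<integral>\<^sup>+x. ennreal B * ennreal \<bar>W (x + \<tau> *\<^sub>R z)\<bar> \<partial>lborel)" .
  qed
  also have "\<dots> = (\<integral>\<^sup>+\<tau>. indicator {0..1::real} \<tau> * (ennreal B * (\<integral>\<^sup>+x. ennreal \<bar>W x\<bar> \<partial>lborel)) \<partial>lborel)"
    by (simp add: nn_integral_cmult lborel_nn_integral_translate[of "\<lambda>x. ennreal \<bar>W x\<bar>"])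
  also have "\<dots> = ennreal B * (\<integral>\<^sup>+x. ennreal \<bar>W x\<bar> \<partial>lborel)"
    by (subst nn_integral_multc) (auto simp: nn_integral_indicator)
  also have "\<dots> < \<infinity>"
    using W by (auto simp: ennreal_mult_less_top integrable_iff_bounded)
  finally show "(\<integral>\<^sup>+z. ennreal (norm (?f z)) \<partial>(lborel \<Otimes>\<^sub>M lborel)) < \<infinity>" .
qed

text \<open>Borel functions on the whole space, because translation and Fubini are applied to
  functions of a point and a segment parameter together. The weak identity can be integrated over
  the whole space since test functions vanish off \<open>\<Omega>\<close>.\<close>

locale borel_weak_gradient =
  fixes \<Omega> :: "'a::euclidean_space set" and u :: "'a \<Rightarrow> real" and g :: "'a \<Rightarrow> 'a"
  assumes \<Omega>_open: "open \<Omega>"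
    and u_borel [measurable]: "u \<in> borel_measurable borel" and g_borel [measurable]: "g \<in> borel_measurable borel"
    and u_integrable: "compact K \<Longrightarrow> K \<subseteq> \<Omega> \<Longrightarrow> integrable lborel (\<lambda>x. indicator K x * u x)"
    and g_integrable: "compact K \<Longrightarrow> K \<subseteq> \<Omega> \<Longrightarrow> integrable lborel (\<lambda>x. indicator K x *\<^sub>R g x)"
    and weak: "test_function \<Omega> \<phi> \<Longrightarrow> b \<in> Basis \<Longrightarrow>
      (\<integral>x. u x * partial_deriv b \<phi> x \<partial>lborel) = - (\<integral>x. (g x \<bullet> b) * \<phi> x \<partial>lborel)"
begin

text \<open>The difference is moved from \<open>U\<close> to the bump by translation, written as an
  integral over \<tau> of derivatives of translated bumps, converted by the weak identity for each
  \<tau>, and translated back. \<open>K\<close> contains all segments starting in the box, so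
  cutting off by its indicator is invisible to the translated bumps and makes \<open>U\<close> and
  \<open>G\<close> integrable.\<close>

lemma difference_against_box_bump:
  assumes Kc: "compact K" and KO: "K \<subseteq> \<Omega>"
    and seg: "\<And>x \<tau>. x \<in> cbox l h \<Longrightarrow> \<tau> \<in> {0..1} \<Longrightarrow> x + \<tau> *\<^sub>R f \<in> K"
  defines "U \<equiv> \<lambda>x. indicator K x * u x" and "G \<equiv> \<lambda>x. indicator K x * (g x \<bullet> f)"
  shows "integrable lborel U" "integrable lborel G"
    and "(\<integral>x. box_bump m l h x * (U (x + f) - U x) \<partial>lborel) =
      (\<integral>x. box_bump m l h x * (\<integral>\<tau>. indicator {0..1} \<tau> * G (x + \<tau> *\<^sub>R f) \<partial>lborel) \<partial>lborel)"
proof -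
  let ?\<phi> = "box_bump m l h"
  have [measurable]: "K \<in> sets borel" using Kc by (simp add: compact_imp_closed borel_closed)
  show U: "integrable lborel U" unfolding U_def by (rule u_integrable[OF Kc KO])
  have Gb: "integrable lborel (\<lambda>x. indicator K x * (g x \<bullet> b))" for b
    using integrable_inner_left[OF g_integrable[OF Kc KO], of b] by simp
  show G: "integrable lborel G" unfolding G_def by (rule Gb)
  have [measurable]: "U \<in> borel_measurable borel" "G \<in> borel_measurable borel"
    unfolding U_def G_def by measurable
  have phim[measurable]: "box_bump m l h \<in> borel_measurable borel" for l h
    by (intro borel_measurable_continuous_onI continuous_on_box_bump)
  have pdm[measurable]: "partial_deriv b ?\<phi> \<in> borel_measurable borel" for b
    by (intro borel_measurable_continuous_onI continuous_on_box_bump)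
  \<comment> \<open>Chosen so that \<open>\<psi>\<close> at y - \<tau> f is the derivative in \<tau>
    of the bump at y - \<tau> f.\<close>
  define \<psi> where "\<psi> y = - (\<Sum>b\<in>Basis. (f \<bullet> b) * partial_deriv b ?\<phi> y)" for y
  have [measurable]: "\<psi> \<in> borel_measurable borel" unfolding \<psi>_def by measurable
  have "\<exists>B. \<forall>b. \<forall>x. \<bar>partial_deriv b ?\<phi> x\<bar> \<le> B b"
    using bounded_partial_deriv_box_bump[of _ m l h] by (intro choice) blast
  then obtain B where B: "\<And>b x. \<bar>partial_deriv b ?\<phi> x\<bar> \<le> B b" by blast
  have psiB: "\<bar>\<psi> y\<bar> \<le> (\<Sum>b\<in>Basis. \<bar>f \<bullet> b\<bar> * B b)" for y
  proof -
    have "\<bar>\<psi> y\<bar> \<le> (\<Sum>b\<in>Basis. \<bar>(f \<bullet> b) * partial_deriv b ?\<phi> y\<bar>)" unfolding \<psi>_def by (simp add: sum_abs)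
    also have "\<dots> \<le> (\<Sum>b\<in>Basis. \<bar>f \<bullet> b\<bar> * B b)" by (intro sum_mono) (auto simp: abs_mult intro!: mult_left_mono B)
    finally show ?thesis .
  qed
  have ftc: "?\<phi> (y - f) - ?\<phi> y = (\<integral>\<tau>. indicator {0..1} \<tau> * \<psi> (y - \<tau> *\<^sub>R f) \<partial>lborel)" for y
  proof -
    have "(\<integral>\<tau>. indicator {0..1} \<tau> *\<^sub>R \<psi> (y - \<tau> *\<^sub>R f) \<partial>lborel) = ?\<phi> (y - 1 *\<^sub>R f) - ?\<phi> (y - 0 *\<^sub>R f)"
    proof (rule integral_FTC_Icc)
      fix \<tau> :: real
      have "((\<lambda>\<tau>. ?\<phi> (y - \<tau> *\<^sub>R f)) has_derivative
         (\<lambda>d. \<Sum>b\<in>Basis. ((- (d *\<^sub>R f)) \<bullet> b) * partial_deriv b ?\<phi> (y - \<tau> *\<^sub>R f))) (at \<tau>)"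
        by (rule has_derivative_compose[OF _ box_bump_has_derivative]) (auto intro!: derivative_eq_intros)
      also have "(\<lambda>d. \<Sum>b\<in>Basis. ((- (d *\<^sub>R f)) \<bullet> b) * partial_deriv b ?\<phi> (y - \<tau> *\<^sub>R f)) = (\<lambda>d. d *\<^sub>R \<psi> (y - \<tau> *\<^sub>R f))"
        by (auto simp: \<psi>_def sum_distrib_left sum_negf mult.assoc)
      finally show "((\<lambda>\<tau>. ?\<phi> (y - \<tau> *\<^sub>R f)) has_vector_derivative \<psi> (y - \<tau> *\<^sub>R f)) (at \<tau> within {0..1})"
        unfolding has_vector_derivative_def by (rule has_derivative_at_withinI)
    next
      show "continuous_on {0..1} (\<lambda>\<tau>. \<psi> (y - \<tau> *\<^sub>R f))"
        unfolding \<psi>_def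
        by (intro continuous_intros continuous_on_compose2[OF continuous_on_box_bump(2)[of UNIV]]) auto
    qed auto
    thus ?thesis by simp
  qed
  have inK: "y \<in> K" if "y - \<tau> *\<^sub>R f \<in> box l h" "\<tau> \<in> {0..1}" for y \<tau>
    using that box_subset_cbox[of l h] seg[of "y - \<tau> *\<^sub>R f" \<tau>] by auto
  \<comment> \<open>The translated closed box consists of points on segments, so it lies in
    \<open>K\<close>, and its bump is a test function on \<open>\<Omega>\<close>.\<close>
  have shift: "(\<integral>y. U y * \<psi> (y - \<tau> *\<^sub>R f) \<partial>lborel) = (\<integral>y. G y * ?\<phi> (y - \<tau> *\<^sub>R f) \<partial>lborel)"
    if \<tau>: "\<tau> \<in> {0..1}" for \<tau>
  proof -
    let ?\<phi>t = "box_bump m (l + \<tau> *\<^sub>R f) (h + \<tau> *\<^sub>R f)"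
    have sub: "cbox (l + \<tau> *\<^sub>R f) (h + \<tau> *\<^sub>R f) \<subseteq> \<Omega>"
    proof
      fix y assume "y \<in> cbox (l + \<tau> *\<^sub>R f) (h + \<tau> *\<^sub>R f)"
      hence "y - \<tau> *\<^sub>R f \<in> cbox l h" by (simp add: mem_box inner_add_left inner_diff_left algebra_simps)
      from seg[OF this, of \<tau>] \<tau> KO show "y \<in> \<Omega>" by auto
    qed
    have tr: "?\<phi>t = (\<lambda>y. ?\<phi> (y - \<tau> *\<^sub>R f))" by (simp add: box_bump_translate)
    have pd: "partial_deriv b ?\<phi>t y = partial_deriv b ?\<phi> (y - \<tau> *\<^sub>R f)" if "b \<in> Basis" for b y
    proof -
      have "(?\<phi>t has_derivative (\<lambda>v. \<Sum>b\<in>Basis. (v \<bullet> b) * partial_deriv b ?\<phi> (y - \<tau> *\<^sub>R f))) (at y)"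
        unfolding tr by (rule has_derivative_compose[OF _ box_bump_has_derivative]) (auto intro!: derivative_eq_intros)
      from frechet_derivative_at[OF this, symmetric]
      have "partial_deriv b ?\<phi>t y = (\<Sum>b'\<in>Basis. (b \<bullet> b') * partial_deriv b' ?\<phi> (y - \<tau> *\<^sub>R f))"
        unfolding partial_deriv_def by simp
      also have "\<dots> = (\<Sum>b'\<in>Basis. if b' = b then partial_deriv b' ?\<phi> (y - \<tau> *\<^sub>R f) else 0)"
        using that by (intro sum.cong) (auto simp: inner_Basis)
      finally show ?thesis using that by simp
    qed
    have zero: "y \<in> K \<or> ?\<phi>t y = 0 \<and> partial_deriv b ?\<phi>t y = 0" for y b
    proof (cases "y \<in> box (l + \<tau> *\<^sub>R f) (h + \<tau> *\<^sub>R f)")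
      case True
      hence "y - \<tau> *\<^sub>R f \<in> box l h" by (simp add: mem_box inner_add_left inner_diff_left algebra_simps)
      thus ?thesis using inK \<tau> by blast
    qed (simp add: box_bump_outside)
    have w: "(\<integral>y. U y * partial_deriv b ?\<phi> (y - \<tau> *\<^sub>R f) \<partial>lborel) = - (\<integral>y. (indicator K y * (g y \<bullet> b)) * ?\<phi>t y \<partial>lborel)"
      if b: "b \<in> Basis" for b
    proof -
      have "(\<integral>y. U y * partial_deriv b ?\<phi> (y - \<tau> *\<^sub>R f) \<partial>lborel) = (\<integral>y. u y * partial_deriv b ?\<phi>t y \<partial>lborel)"
        using zero[of _ b] by (intro Bochner_Integration.integral_cong) (auto simp: U_def indicator_def pd[OF b, symmetric])
      also have "\<dots> = - (\<integral>y. (g y \<bullet> b) * ?\<phi>t y \<partial>lborel)" by (rule weak[OF test_function_box_bump[OF sub] b])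
      also have "(\<integral>y. (g y \<bullet> b) * ?\<phi>t y \<partial>lborel) = (\<integral>y. (indicator K y * (g y \<bullet> b)) * ?\<phi>t y \<partial>lborel)"
        using zero[of _ b] by (intro Bochner_Integration.integral_cong) (auto simp: indicator_def)
      finally show ?thesis .
    qed
    have bnd: "integrable lborel (\<lambda>y. W y * F y)" if W: "integrable lborel W" and [measurable]: "F \<in> borel_measurable borel"
      and F: "\<And>y. \<bar>F y\<bar> \<le> D" for W F :: "'a \<Rightarrow> real" and D
    proof (rule Bochner_Integration.integrable_bound[OF integrable_mult_left[OF W, of D]])
      have [measurable]: "W \<in> borel_measurable borel" using borel_measurable_integrable[OF W] by simp
      show "(\<lambda>y. W y * F y) \<in> borel_measurable lborel" by measurable
      show "AE y in lborel. norm (W y * F y) \<le> norm (W y * D)"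
        using order_trans[OF F abs_ge_self[of D]] by (auto simp: abs_mult intro!: mult_left_mono)
    qed
    have phib: "\<bar>?\<phi>t y\<bar> \<le> 1" for y using box_bump_bounds[of m "l + \<tau> *\<^sub>R f" "h + \<tau> *\<^sub>R f" y] by simp
    have "(\<integral>y. U y * \<psi> (y - \<tau> *\<^sub>R f) \<partial>lborel) = (\<integral>y. (\<Sum>b\<in>Basis. - (f \<bullet> b) * (U y * partial_deriv b ?\<phi> (y - \<tau> *\<^sub>R f))) \<partial>lborel)"
      by (intro Bochner_Integration.integral_cong) (auto simp: \<psi>_def sum_distrib_left sum_negf algebra_simps)
    also have "\<dots> = (\<Sum>b\<in>Basis. - (f \<bullet> b) * (\<integral>y. U y * partial_deriv b ?\<phi> (y - \<tau> *\<^sub>R f) \<partial>lborel))"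
      by (subst Bochner_Integration.integral_sum) (auto intro!: bnd[OF U] B)
    also have "\<dots> = (\<Sum>b\<in>Basis. (f \<bullet> b) * (\<integral>y. (indicator K y * (g y \<bullet> b)) * ?\<phi>t y \<partial>lborel))"
      by (intro sum.cong) (simp_all add: w)
    also have "\<dots> = (\<integral>y. (\<Sum>b\<in>Basis. (f \<bullet> b) * ((indicator K y * (g y \<bullet> b)) * ?\<phi>t y)) \<partial>lborel)"
      by (subst Bochner_Integration.integral_sum)
        (auto intro!: bnd[OF Gb _ phib])
    also have "\<dots> = (\<integral>y. G y * ?\<phi> (y - \<tau> *\<^sub>R f) \<partial>lborel)"
    proof (intro Bochner_Integration.integral_cong refl)
      fix y
      have "g y \<bullet> f = (\<Sum>b\<in>Basis. (g y \<bullet> b) * (f \<bullet> b))" by (rule euclidean_inner)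
      thus "(\<Sum>b\<in>Basis. (f \<bullet> b) * ((indicator K y * (g y \<bullet> b)) * ?\<phi>t y)) = G y * ?\<phi> (y - \<tau> *\<^sub>R f)"
        unfolding tr G_def by (simp add: sum_distrib_left sum_distrib_right mult_ac)
    qed
    finally show ?thesis .
  qed
  have Uphi: "integrable lborel (\<lambda>x. ?\<phi> x * U x)" "integrable lborel (\<lambda>x. ?\<phi> x * U (x + f))"
  proof -
    have *: "integrable lborel (\<lambda>x. ?\<phi> x * W x)" if W: "integrable lborel W" for W :: "'a \<Rightarrow> real"
    proof (rule Bochner_Integration.integrable_bound[OF W])
      have [measurable]: "W \<in> borel_measurable borel" using borel_measurable_integrable[OF W] by simp
      show "(\<lambda>y. ?\<phi> y * W y) \<in> borel_measurable lborel" by measurable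
      show "AE y in lborel. norm (?\<phi> y * W y) \<le> norm (W y)"
        using box_bump_bounds[of m l h] by (auto simp: abs_mult mult_left_le_one_le)
    qed
    show "integrable lborel (\<lambda>x. ?\<phi> x * U x)" by (rule *[OF U])
    show "integrable lborel (\<lambda>x. ?\<phi> x * U (x + f))" by (rule *[OF lborel_integrable_translate[OF U]])
  qed
  have "(\<integral>x. ?\<phi> x * (U (x + f) - U x) \<partial>lborel) = (\<integral>x. ?\<phi> x * U (x + f) \<partial>lborel) - (\<integral>x. ?\<phi> x * U x \<partial>lborel)"
    using Uphi by (simp add: right_diff_distrib)
  also have "(\<integral>x. ?\<phi> x * U (x + f) \<partial>lborel) = (\<integral>y. ?\<phi> (y - f) * U y \<partial>lborel)"
    using lborel_integral_translate[of "\<lambda>y. ?\<phi> (y - f) * U y" f] by simp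
  also have "\<dots> - (\<integral>x. ?\<phi> x * U x \<partial>lborel) = (\<integral>y. ?\<phi> (y - f) * U y - ?\<phi> y * U y \<partial>lborel)"
  proof (intro Bochner_Integration.integral_diff[symmetric] Uphi)
    show "integrable lborel (\<lambda>y. ?\<phi> (y - f) * U y)"
      using lborel_integrable_translate[OF Uphi(2), of "- f"] by simp
  qed
  \<comment> \<open>The shear by the zero vector is written out so that
    \<open>integrable_shear\<close> covers this exchange as well.\<close>
  also have "\<dots> = (\<integral>y. (\<integral>\<tau>. indicator {0..1} \<tau> * (U (y + \<tau> *\<^sub>R 0) * \<psi> (y - \<tau> *\<^sub>R f)) \<partial>lborel) \<partial>lborel)"
  proof (intro Bochner_Integration.integral_cong refl)
    fix y
    have "?\<phi> (y - f) * U y - ?\<phi> y * U y = U y * (?\<phi> (y - f) - ?\<phi> y)" by (simp add: algebra_simps)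
    also have "\<dots> = (\<integral>\<tau>. U y * (indicator {0..1} \<tau> * \<psi> (y - \<tau> *\<^sub>R f)) \<partial>lborel)" unfolding ftc by simp
    finally show "?\<phi> (y - f) * U y - ?\<phi> y * U y = (\<integral>\<tau>. indicator {0..1} \<tau> * (U (y + \<tau> *\<^sub>R 0) * \<psi> (y - \<tau> *\<^sub>R f)) \<partial>lborel)"
      by (simp add: mult.left_commute)
  qed
  also have "\<dots> = (\<integral>\<tau>. (\<integral>y. indicator {0..1} \<tau> * (U (y + \<tau> *\<^sub>R 0) * \<psi> (y - \<tau> *\<^sub>R f)) \<partial>lborel) \<partial>lborel)"
  proof (rule lborel_pair.Fubini_integral[symmetric])
    have "(\<lambda>z. \<psi> (fst z - snd z *\<^sub>R f)) \<in> borel_measurable (borel \<Otimes>\<^sub>M borel)" by measurable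
    hence "(\<lambda>z. \<psi> (fst z - snd z *\<^sub>R f)) \<in> borel_measurable borel" by (simp add: borel_prod)
    from integrable_shear[OF U this psiB, of 0]
    show "integrable (lborel \<Otimes>\<^sub>M lborel) (\<lambda>(y, \<tau>). indicator {0..1} \<tau> * (U (y + \<tau> *\<^sub>R 0) * \<psi> (y - \<tau> *\<^sub>R f)))" by simp
  qed
  also have "\<dots> = (\<integral>\<tau>. (\<integral>x. indicator {0..1} \<tau> * (G (x + \<tau> *\<^sub>R f) * ?\<phi> x) \<partial>lborel) \<partial>lborel)"
  proof (rule Bochner_Integration.integral_cong[OF refl])
    fix \<tau> :: real
    show "(\<integral>y. indicator {0..1} \<tau> * (U (y + \<tau> *\<^sub>R 0) * \<psi> (y - \<tau> *\<^sub>R f)) \<partial>lborel) =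
      (\<integral>x. indicator {0..1} \<tau> * (G (x + \<tau> *\<^sub>R f) * ?\<phi> x) \<partial>lborel)"
    proof (cases "\<tau> \<in> {0..1}")
      case True
      have "(\<integral>x. G (x + \<tau> *\<^sub>R f) * ?\<phi> x \<partial>lborel) = (\<integral>y. G y * ?\<phi> (y - \<tau> *\<^sub>R f) \<partial>lborel)"
        using lborel_integral_translate[of "\<lambda>y. G y * ?\<phi> (y - \<tau> *\<^sub>R f)" "\<tau> *\<^sub>R f"] by simp
      thus ?thesis using shift[OF True] by simp
    qed simp
  qed
  also have "\<dots> = (\<integral>x. (\<integral>\<tau>. indicator {0..1} \<tau> * (G (x + \<tau> *\<^sub>R f) * ?\<phi> x) \<partial>lborel) \<partial>lborel)"
  proof (rule lborel_pair.Fubini_integral)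
    have "(\<lambda>z. ?\<phi> (fst z)) \<in> borel_measurable (borel \<Otimes>\<^sub>M (borel :: real measure))" by measurable
    hence m: "(\<lambda>z::'a \<times> real. ?\<phi> (fst z)) \<in> borel_measurable borel" by (simp add: borel_prod)
    have "\<bar>?\<phi> (fst y)\<bar> \<le> 1" for y :: "'a \<times> real" using box_bump_bounds[of m l h "fst y"] by simp
    from integrable_shear[OF G m this, of f]
    show "integrable (lborel \<Otimes>\<^sub>M lborel) (\<lambda>(x, \<tau>). indicator {0..1} \<tau> * (G (x + \<tau> *\<^sub>R f) * ?\<phi> x))" by simp
  qed
  also have "\<dots> = (\<integral>x. ?\<phi> x * (\<integral>\<tau>. indicator {0..1} \<tau> * G (x + \<tau> *\<^sub>R f) \<partial>lborel) \<partial>lborel)"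
  proof (intro Bochner_Integration.integral_cong refl)
    fix x
    have "(\<integral>\<tau>. indicator {0..1} \<tau> * (G (x + \<tau> *\<^sub>R f) * ?\<phi> x) \<partial>lborel) = (\<integral>\<tau>. ?\<phi> x * (indicator {0..1} \<tau> * G (x + \<tau> *\<^sub>R f)) \<partial>lborel)"
      by (simp add: mult_ac)
    thus "(\<integral>\<tau>. indicator {0..1} \<tau> * (G (x + \<tau> *\<^sub>R f) * ?\<phi> x) \<partial>lborel) = ?\<phi> x * (\<integral>\<tau>. indicator {0..1} \<tau> * G (x + \<tau> *\<^sub>R f) \<partial>lborel)"
      by simp
  qed
  finally show "(\<integral>x. box_bump m l h x * (U (x + f) - U x) \<partial>lborel) =
      (\<integral>x. box_bump m l h x * (\<integral>\<tau>. indicator {0..1} \<tau> * G (x + \<tau> *\<^sub>R f) \<partial>lborel) \<partial>lborel)" .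
qed

end

text \<open>Open boxes are stable under intersection and generate the Borel sets, so a Dynkin
  argument reaches all Borel sets. Its complement step needs total integral 0, which follows since
  \<open>k\<close> vanishes outside one box.\<close>

lemma AE_zero_if_box_integrals_zero:
  fixes k :: "'a::euclidean_space \<Rightarrow> real"
  assumes k: "integrable lborel k" and zero: "\<And>l h. (\<integral>x. indicator (box l h) x * k x \<partial>lborel) = 0"
    and out: "\<And>x. x \<notin> box a b \<Longrightarrow> k x = 0"
  shows "AE x in lborel. k x = 0"
proof (rule density_unique_real[OF k])
  have [measurable]: "k \<in> borel_measurable borel" using borel_measurable_integrable[OF k] by simp
  have si: "set_integrable lborel A k" if "A \<in> sets borel" for A
    unfolding set_integrable_def using integrable_mult_indicator[OF _ k, of A] that by simp
  have tot: "(\<integral>x. k x \<partial>lborel) = 0"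
  proof -
    have "(\<lambda>x. indicator (box a b) x * k x) = k" using out by (auto simp: indicator_def fun_eq_iff)
    thus ?thesis using zero[of a b] by simp
  qed
  fix A :: "'a set" assume "A \<in> sets lborel"
  hence A: "A \<in> sigma_sets UNIV (range (\<lambda>(a, b). box a b))" by (simp add: borel_eq_box)
  have stable: "Int_stable (range (\<lambda>(a, b). box a b :: 'a set))" unfolding Int_stable_def
  proof (intro ballI)
    fix X Y :: "'a set" assume "X \<in> range (\<lambda>(a, b). box a b)" "Y \<in> range (\<lambda>(a, b). box a b)"
    then obtain a b c d where "X = box a b" "Y = box c d" by auto
    thus "X \<inter> Y \<in> range (\<lambda>(a, b). box a b)" by (auto simp: box_Int_box)
  qed
  have "(\<integral>x\<in>A. k x \<partial>lborel) = 0"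
    using stable subset_UNIV[of "range (\<lambda>(a, b). box a b :: 'a set)", folded Pow_UNIV] A
  proof (induction rule: sigma_sets_induct_disjoint)
    case (basic A)
    then show ?case using zero by (auto simp: set_lebesgue_integral_def)
  next
    case empty
    show ?case by (simp add: set_lebesgue_integral_def)
  next
    case (compl A)
    hence A: "A \<in> sets borel" by (simp add: borel_eq_box)
    have "(\<integral>x\<in>UNIV - A. k x \<partial>lborel) = (\<integral>x. k x - indicator A x *\<^sub>R k x \<partial>lborel)"
      unfolding set_lebesgue_integral_def by (intro Bochner_Integration.integral_cong) (auto simp: indicator_def)
    also have "\<dots> = (\<integral>x. k x \<partial>lborel) - (\<integral>x\<in>A. k x \<partial>lborel)"
      unfolding set_lebesgue_integral_def using si[OF A]
      by (intro Bochner_Integration.integral_diff k) (simp add: set_integrable_def)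
    finally show ?case using tot compl by simp
  next
    case (union A)
    hence A: "A i \<in> sets borel" for i by (auto simp: borel_eq_box)
    have "(\<integral>x\<in>(\<Union>i. A i). k x \<partial>lborel) = (\<Sum>i. \<integral>x\<in>A i. k x \<partial>lborel)"
      using union(1) A by (intro lebesgue_integral_countable_add si) (auto simp: disjoint_family_on_def)
    thus ?case using union(3) by simp
  qed
  thus "(\<integral>x\<in>A. k x \<partial>lborel) = (\<integral>x\<in>A. 0 \<partial>lborel)" by (simp add: set_lebesgue_integral_def)
qed simp

text \<open>Jensen's inequality with the lossy constant 2^p. With c = i / 2, integrating a \<le> c +
  c^(1 - p) a^p leaves half of \<open>i\<close> on the left.\<close>

lemma powr_le_integral_powr:
  fixes a :: "real \<Rightarrow> real" and p i :: real
  assumes [measurable]: "a \<in> borel_measurable borel" and a: "\<And>t. 0 \<le> a t" and p: "1 \<le> p" and i: "0 \<le> i"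
    and le: "ennreal i \<le> (\<integral>\<^sup>+t\<in>{0..1}. ennreal (a t) \<partial>lborel)"
  shows "ennreal (i powr p) \<le> ennreal (2 powr p) * (\<integral>\<^sup>+t\<in>{0..1}. ennreal (a t powr p) \<partial>lborel)"
proof (cases "i = 0 \<or> (\<integral>\<^sup>+t\<in>{0..1}. ennreal (a t powr p) \<partial>lborel) = \<infinity>")
  case True
  thus ?thesis using p by (auto simp: ennreal_mult_top)
next
  case False
  define J where "J = enn2real (\<integral>\<^sup>+t\<in>{0..1}. ennreal (a t powr p) \<partial>lborel)"
  have J: "(\<integral>\<^sup>+t\<in>{0..1}. ennreal (a t powr p) \<partial>lborel) = ennreal J" "0 \<le> J"
    using False by (auto simp: J_def less_top)
  define c where "c = i / 2"
  have c: "0 < c" using False i by (simp add: c_def)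
  have "a t \<le> c + c powr (1 - p) * a t powr p" for t
  proof (cases "a t \<le> c")
    case False
    have "a t = a t powr (1 - p) * a t powr p" using False c by (simp add: powr_add[symmetric])
    also have "\<dots> \<le> c powr (1 - p) * a t powr p" using False c p by (intro mult_right_mono powr_mono2') auto
    finally show ?thesis using c by simp
  qed (auto intro: add_increasing2)
  hence "(\<integral>\<^sup>+t\<in>{0..1}. ennreal (a t) \<partial>lborel) \<le> (\<integral>\<^sup>+t. ennreal c * indicator {0..1} t + ennreal (c powr (1 - p)) * (ennreal (a t powr p) * indicator {0..1} t) \<partial>lborel)"
    using c by (intro nn_integral_mono)
      (auto simp: indicator_def ennreal_mult[symmetric] ennreal_plus[symmetric] simp del: ennreal_plus intro!: ennreal_leI)
  also have "\<dots> = ennreal c + ennreal (c powr (1 - p)) * ennreal J"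
    by (subst nn_integral_add) (auto simp: nn_integral_cmult nn_integral_cmult_indicator J(1)[simplified mult.commute])
  also have "\<dots> = ennreal (c + c powr (1 - p) * J)" using c J(2) by (simp add: ennreal_mult)
  finally have "ennreal i \<le> ennreal (c + c powr (1 - p) * J)" using le by (rule order_trans[rotated])
  hence "i \<le> c + c powr (1 - p) * J" using c J(2) by (subst (asm) ennreal_le_iff) (auto intro!: add_nonneg_nonneg)
  hence "c \<le> c powr (1 - p) * J" by (simp add: c_def)
  hence "c powr (p - 1) * c \<le> c powr (p - 1) * (c powr (1 - p) * J)" by (intro mult_left_mono) auto
  also have "c powr (p - 1) * (c powr (1 - p) * J) = J" using c by (simp add: mult.assoc[symmetric] powr_add[symmetric])
  also have "c powr (p - 1) * c = c powr p" using c by (simp add: powr_diff)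
  finally have "c powr p \<le> J" .
  hence "2 powr p * c powr p \<le> 2 powr p * J" by simp
  also have "2 powr p * c powr p = i powr p" using i by (simp add: c_def powr_mult[symmetric])
  finally show ?thesis unfolding J(1) using J(2) by (simp add: ennreal_mult[symmetric] ennreal_leI)
qed

context borel_weak_gradient
begin

definition segment_domain :: "'a \<Rightarrow> 'a set" where
  "segment_domain f = {x. \<forall>\<tau>\<in>{0..1}. x + \<tau> *\<^sub>R f \<in> \<Omega>}"

lemma open_segment_domain: "open (segment_domain f)"
  unfolding open_contains_ball
proof
  fix x assume x: "x \<in> segment_domain f"
  let ?S = "(\<lambda>\<tau>. x + \<tau> *\<^sub>R f) ` {0..1::real}"
  have "compact ?S" by (intro compact_continuous_image continuous_intros) auto
  moreover have "?S \<subseteq> \<Omega>" using x by (auto simp: segment_domain_def)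
  ultimately obtain e where e: "0 < e" "(\<Union>y\<in>?S. ball y e) \<subseteq> \<Omega>"
    using compact_subset_open_imp_ball_epsilon_subset[OF _ \<Omega>_open] by metis
  have "ball x e \<subseteq> segment_domain f"
  proof
    fix y assume "y \<in> ball x e"
    hence "y + \<tau> *\<^sub>R f \<in> ball (x + \<tau> *\<^sub>R f) e" for \<tau> by (simp add: dist_norm)
    thus "y \<in> segment_domain f" using e(2) unfolding segment_domain_def by blast
  qed
  thus "\<exists>e>0. ball x e \<subseteq> segment_domain f" using e(1) by blast
qed

text \<open>As the bumps tend to the indicator, the defect \<open>k\<close> has vanishing integral
  over every box whose closed box lies in \<open>cbox a b\<close>. Cut off to
  \<open>box a b\<close>, it meets the hypotheses of
  \<open>AE_zero_if_box_integrals_zero\<close>.\<close>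

lemma AE_difference_eq_box:
  assumes sub: "cbox a b \<subseteq> segment_domain f"
  shows "AE x in lborel. x \<in> box a b \<longrightarrow>
    u (x + f) - u x = (\<integral>\<tau>. indicator {0..1} \<tau> * (g (x + \<tau> *\<^sub>R f) \<bullet> f) \<partial>lborel)"
proof -
  define K where "K = (\<lambda>(x, \<tau>). x + \<tau> *\<^sub>R f) ` (cbox a b \<times> {0..1})"
  have Kc: "compact K" unfolding K_def split_beta'
    by (intro compact_continuous_image continuous_intros compact_Times) auto
  have KO: "K \<subseteq> \<Omega>" using sub by (auto simp: K_def segment_domain_def)
  have seg: "x + \<tau> *\<^sub>R f \<in> K" if "x \<in> cbox a b" "\<tau> \<in> {0..1}" for x \<tau>
    unfolding K_def using that by (intro image_eqI[of _ _ "(x, \<tau>)"]) auto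
  define U where "U = (\<lambda>x. indicator K x * u x)"
  define G where "G = (\<lambda>x. indicator K x * (g x \<bullet> f))"
  define D where "D x = (\<integral>\<tau>. indicator {0..1} \<tau> * G (x + \<tau> *\<^sub>R f) \<partial>lborel)" for x
  define k where "k x = U (x + f) - U x - D x" for x
  have U: "integrable lborel U" and G: "integrable lborel G"
    unfolding U_def G_def by (rule difference_against_box_bump(1,2)[OF Kc KO seg], assumption, assumption)+
  have D: "integrable lborel D"
    unfolding D_def using lborel_pair.integrable_fst'[OF integrable_shear[OF G, of "\<lambda>_. 1" 1 f]] by simp
  have k: "integrable lborel k"
    unfolding k_def by (intro Bochner_Integration.integrable_diff lborel_integrable_translate U D)
  have [measurable]: "k \<in> borel_measurable borel" using borel_measurable_integrable[OF k] by simp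
  have bm[measurable]: "box_bump m l h \<in> borel_measurable borel" for m and l h :: 'a
    by (intro borel_measurable_continuous_onI continuous_on_box_bump)
  have bi: "integrable lborel (\<lambda>x. box_bump m l h x * W x)" if W: "integrable lborel W" for W and m and l h :: 'a
  proof (rule Bochner_Integration.integrable_bound[OF W])
    have [measurable]: "W \<in> borel_measurable borel" using borel_measurable_integrable[OF W] by simp
    show "(\<lambda>y. box_bump m l h y * W y) \<in> borel_measurable lborel" by measurable
    show "AE y in lborel. norm (box_bump m l h y * W y) \<le> norm (W y)"
      using box_bump_bounds[of m l h] by (auto simp: abs_mult mult_left_le_one_le)
  qed
  have sub0: "(\<integral>x. indicator (box l h) x * k x \<partial>lborel) = 0" if lh: "cbox l h \<subseteq> cbox a b" for l h
  proof -
    have zero: "(\<integral>x. box_bump m l h x * k x \<partial>lborel) = 0" for m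
    proof -
      have "(\<integral>x. box_bump m l h x * k x \<partial>lborel) = (\<integral>x. box_bump m l h x * (U (x + f) - U x) - box_bump m l h x * D x \<partial>lborel)"
        by (simp add: k_def right_diff_distrib)
      also have "\<dots> = (\<integral>x. box_bump m l h x * (U (x + f) - U x) \<partial>lborel) - (\<integral>x. box_bump m l h x * D x \<partial>lborel)"
        by (intro Bochner_Integration.integral_diff bi Bochner_Integration.integrable_diff lborel_integrable_translate U D)
      also have "\<dots> = 0"
        unfolding D_def U_def G_def
        by (subst difference_against_box_bump(3)[OF Kc KO]) (use seg lh in auto)
      finally show ?thesis .
    qed
    have "(\<lambda>m. \<integral>x. box_bump m l h x * k x \<partial>lborel) \<longlonglongrightarrow> (\<integral>x. indicator (box l h) x * k x \<partial>lborel)"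
    proof (rule integral_dominated_convergence[where w = "\<lambda>x. \<bar>k x\<bar>"])
      show "AE x in lborel. (\<lambda>m. box_bump m l h x * k x) \<longlonglongrightarrow> indicator (box l h) x * k x"
        by (intro AE_I2 tendsto_mult box_bump_tendsto tendsto_const)
      show "AE x in lborel. norm (box_bump m l h x * k x) \<le> \<bar>k x\<bar>" for m
        using box_bump_bounds[of m l h] by (auto simp: abs_mult mult_left_le_one_le)
    qed (use k in auto)
    thus ?thesis using LIMSEQ_unique unfolding zero by (metis tendsto_const)
  qed
  have "AE x in lborel. indicator (box a b) x * k x = 0"
  proof (rule AE_zero_if_box_integrals_zero[where a = a and b = b])
    show "integrable lborel (\<lambda>x. indicator (box a b) x * k x)"
      using integrable_mult_indicator[OF _ k, of "box a b"] by simp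
    fix l h :: 'a
    obtain l' h' where lh: "box l h \<inter> box a b = box l' h'" unfolding box_Int_box by blast
    have "(\<integral>x. indicator (box l h) x * (indicator (box a b) x * k x) \<partial>lborel) = (\<integral>x. indicator (box l' h') x * k x \<partial>lborel)"
      unfolding lh[symmetric] by (simp add: indicator_inter_arith mult.assoc)
    also have "\<dots> = 0"
    \<comment> \<open>A degenerate closed box may stick out of \<open>cbox a b\<close>, but its open
      box is empty and the integral is trivially 0.\<close>
    proof (cases "box l' h' = {}")
      case False
      have "closure (box l' h') \<subseteq> closure (box a b)" using lh by (intro closure_mono) blast
      hence "cbox l' h' \<subseteq> cbox a b" using False closure_box[of l' h'] closure_minimal[OF box_subset_cbox closed_cbox, of a b] by auto
      thus ?thesis by (rule sub0)
    qed simp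
    finally show "(\<integral>x. indicator (box l h) x * (indicator (box a b) x * k x) \<partial>lborel) = 0" .
  qed auto
  thus ?thesis
  proof (eventually_elim, intro impI)
    fix x assume *: "indicator (box a b) x * k x = 0" and x: "x \<in> box a b"
    have xc: "x \<in> cbox a b" using x box_subset_cbox by blast
    have "U (x + f) = u (x + f)" "U x = u x"
      using seg[OF xc, of 1] seg[OF xc, of 0] by (auto simp: U_def)
    moreover have "D x = (\<integral>\<tau>. indicator {0..1} \<tau> * (g (x + \<tau> *\<^sub>R f) \<bullet> f) \<partial>lborel)"
      unfolding D_def using seg[OF xc] by (intro Bochner_Integration.integral_cong) (auto simp: indicator_def G_def)
    ultimately show "u (x + f) - u x = (\<integral>\<tau>. indicator {0..1} \<tau> * (g (x + \<tau> *\<^sub>R f) \<bullet> f) \<partial>lborel)"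
      using * x by (simp add: k_def)
  qed
qed

text \<open>Countably many closed boxes cover the open set, and their faces are null sets.\<close>

lemma AE_difference_eq:
  "AE x in lborel. x \<in> segment_domain f \<longrightarrow>
    u (x + f) - u x = (\<integral>\<tau>. indicator {0..1} \<tau> * (g (x + \<tau> *\<^sub>R f) \<bullet> f) \<partial>lborel)"
proof -
  let ?P = "\<lambda>x. u (x + f) - u x = (\<integral>\<tau>. indicator {0..1} \<tau> * (g (x + \<tau> *\<^sub>R f) \<bullet> f) \<partial>lborel)"
  obtain D where D: "countable D" "D \<subseteq> Pow (segment_domain f)" "\<And>X. X \<in> D \<Longrightarrow> \<exists>a b. X = cbox a b" "\<Union>D = segment_domain f"
    using open_countable_Union_open_cbox[OF open_segment_domain[of f]] by metis
  have "AE x in lborel. x \<in> X \<longrightarrow> ?P x" if X: "X \<in> D" for X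
  proof -
    obtain a b where ab: "X = cbox a b" using D(3) X by blast
    have "emeasure lborel (cbox a b - box a b) = 0"
      by (subst emeasure_Diff) (auto simp: box_subset_cbox emeasure_lborel_cbox_eq emeasure_lborel_box_eq)
    hence "AE x in lborel. x \<notin> cbox a b - box a b" by (intro AE_not_in) (auto intro!: null_setsI)
    moreover have "AE x in lborel. x \<in> box a b \<longrightarrow> ?P x"
      using D(2) X ab by (intro AE_difference_eq_box) auto
    ultimately show ?thesis by eventually_elim (auto simp: ab)
  qed
  hence "AE x in lborel. \<forall>X\<in>D. x \<in> X \<longrightarrow> ?P x" by (subst AE_ball_countable[OF D(1)]) blast
  thus ?thesis by eventually_elim (use D(4) in blast)
qed

text \<open>Jensen along each segment, followed by an exchange of integrals. For every \<tau> the
  points x + \<tau> f stay in \<open>\<Omega>\<close>, so translation invariance bounds the inner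
  integral independently of \<tau>.\<close>

lemma difference_powr_integral_le:
  assumes p: "1 \<le> p"
  shows "(\<integral>\<^sup>+x\<in>segment_domain f. ennreal (\<bar>u (x + f) - u x\<bar> powr p) \<partial>lborel)
    \<le> ennreal (2 powr p * norm f powr p) * (\<integral>\<^sup>+x\<in>\<Omega>. ennreal (norm (g x) powr p) \<partial>lborel)"
proof -
  let ?W = "segment_domain f"
  have [measurable]: "?W \<in> sets borel" "\<Omega> \<in> sets borel" using open_segment_domain[of f] \<Omega>_open by auto
  let ?h = "\<lambda>x \<tau>. ennreal (norm (g (x + \<tau> *\<^sub>R f)) powr p) * indicator {0..1::real} \<tau>"
  have [measurable]: "(\<lambda>(x, \<tau>). ?h x \<tau>) \<in> borel_measurable (lborel \<Otimes>\<^sub>M lborel)" by measurable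
  have pw: "AE x in lborel. ennreal (\<bar>u (x + f) - u x\<bar> powr p) * indicator ?W x
     \<le> ennreal (2 powr p * norm f powr p) * ((\<integral>\<^sup>+\<tau>. ?h x \<tau> \<partial>lborel) * indicator ?W x)"
    using AE_difference_eq[of f]
  proof eventually_elim
    case (elim x)
    show ?case
    proof (cases "x \<in> ?W")
      case True
      let ?a = "\<lambda>\<tau>. norm (g (x + \<tau> *\<^sub>R f)) * norm f"
      have "ennreal \<bar>u (x + f) - u x\<bar> \<le> (\<integral>\<^sup>+\<tau>. ennreal \<bar>indicator {0..1} \<tau> * (g (x + \<tau> *\<^sub>R f) \<bullet> f)\<bar> \<partial>lborel)"
      proof (cases "integrable lborel (\<lambda>\<tau>. indicator {0..1} \<tau> * (g (x + \<tau> *\<^sub>R f) \<bullet> f))")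
        case True
        show ?thesis using elim \<open>x \<in> ?W\<close> integral_norm_bound_ennreal[OF True] by simp
      next
        \<comment> \<open>The Bochner integral of a function that is not integrable is 0 by
          convention, so the difference vanishes at such x.\<close>
        case False
        thus ?thesis using elim \<open>x \<in> ?W\<close> by (simp add: not_integrable_integral_eq)
      qed
      also have "\<dots> \<le> (\<integral>\<^sup>+\<tau>\<in>{0..1}. ennreal (?a \<tau>) \<partial>lborel)"
        by (intro nn_integral_mono) (auto simp: indicator_def Cauchy_Schwarz_ineq2 intro!: ennreal_leI)
      finally have "ennreal (\<bar>u (x + f) - u x\<bar> powr p) \<le> ennreal (2 powr p) * (\<integral>\<^sup>+\<tau>\<in>{0..1}. ennreal (?a \<tau> powr p) \<partial>lborel)"
        using p by (intro powr_le_integral_powr) auto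
      also have "(\<integral>\<^sup>+\<tau>\<in>{0..1}. ennreal (?a \<tau> powr p) \<partial>lborel) = (\<integral>\<^sup>+\<tau>. ennreal (norm f powr p) * ?h x \<tau> \<partial>lborel)"
        by (intro nn_integral_cong) (simp add: powr_mult ennreal_mult mult_ac)
      also have "\<dots> = ennreal (norm f powr p) * (\<integral>\<^sup>+\<tau>. ?h x \<tau> \<partial>lborel)"
        by (intro nn_integral_cmult) measurable
      finally show ?thesis using True by (simp add: ennreal_mult mult.assoc)
    qed simp
  qed
  have "(\<integral>\<^sup>+x\<in>?W. ennreal (\<bar>u (x + f) - u x\<bar> powr p) \<partial>lborel)
     \<le> (\<integral>\<^sup>+x. ennreal (2 powr p * norm f powr p) * ((\<integral>\<^sup>+\<tau>. ?h x \<tau> \<partial>lborel) * indicator ?W x) \<partial>lborel)"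
    by (rule nn_integral_mono_AE[OF pw])
  also have "\<dots> = ennreal (2 powr p * norm f powr p) * (\<integral>\<^sup>+x. (\<integral>\<^sup>+\<tau>. ?h x \<tau> * indicator ?W x \<partial>lborel) \<partial>lborel)"
    by (simp add: nn_integral_cmult nn_integral_multc)
  also have "(\<integral>\<^sup>+x. (\<integral>\<^sup>+\<tau>. ?h x \<tau> * indicator ?W x \<partial>lborel) \<partial>lborel) = (\<integral>\<^sup>+\<tau>. (\<integral>\<^sup>+x. ?h x \<tau> * indicator ?W x \<partial>lborel) \<partial>lborel)"
    by (rule lborel_pair.Fubini'[symmetric]) measurable
  also have "\<dots> \<le> (\<integral>\<^sup>+\<tau>. (\<integral>\<^sup>+x\<in>\<Omega>. ennreal (norm (g x) powr p) \<partial>lborel) * indicator {0..1::real} \<tau> \<partial>lborel)"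
  proof (intro nn_integral_mono)
    fix \<tau> :: real
    have "(\<integral>\<^sup>+x. ?h x \<tau> * indicator ?W x \<partial>lborel)
      \<le> (\<integral>\<^sup>+x. (ennreal (norm (g (x + \<tau> *\<^sub>R f)) powr p) * indicator \<Omega> (x + \<tau> *\<^sub>R f)) * indicator {0..1} \<tau> \<partial>lborel)"
      by (intro nn_integral_mono) (auto simp: indicator_def segment_domain_def)
    also have "\<dots> = (\<integral>\<^sup>+x. ennreal (norm (g (x + \<tau> *\<^sub>R f)) powr p) * indicator \<Omega> (x + \<tau> *\<^sub>R f) \<partial>lborel) * indicator {0..1} \<tau>"
      by (intro nn_integral_multc) measurable
    also have "(\<integral>\<^sup>+x. ennreal (norm (g (x + \<tau> *\<^sub>R f)) powr p) * indicator \<Omega> (x + \<tau> *\<^sub>R f) \<partial>lborel) = (\<integral>\<^sup>+x\<in>\<Omega>. ennreal (norm (g x) powr p) \<partial>lborel)"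
      by (intro lborel_nn_integral_translate[of "\<lambda>x. ennreal (norm (g x) powr p) * indicator \<Omega> x"]) measurable
    finally show "(\<integral>\<^sup>+x. ?h x \<tau> * indicator ?W x \<partial>lborel) \<le> (\<integral>\<^sup>+x\<in>\<Omega>. ennreal (norm (g x) powr p) \<partial>lborel) * indicator {0..1} \<tau>" .
  qed
  also have "\<dots> = (\<integral>\<^sup>+x\<in>\<Omega>. ennreal (norm (g x) powr p) \<partial>lborel)"
    by (subst nn_integral_cmult_indicator) auto
  finally show ?thesis by (simp add: mult_left_mono)
qed

end

section \<open>Lipschitz domains\<close>

text \<open>A displacement \<tau> (e + w) raises the height by at least \<tau> (1 - \<delta>), while
  the projection moves by at most 2 \<delta> \<tau> and \<open>g\<close> therefore rises by at most
  2 \<delta> L \<tau>. The choice of \<open>\<delta>\<close> gives 2 \<delta> L + \<delta> \<le> 1,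
  so the point stays above the graph.\<close>

lemma lipschitz_boundary_cone:
  fixes \<Omega> :: "'a::euclidean_space set"
  assumes "open \<Omega>" "lipschitz_boundary \<Omega>" "x0 \<in> closure \<Omega>"
  shows "\<exists>r>0. \<exists>\<delta>>0. \<exists>e. \<delta> < 1 \<and> norm e = 1 \<and>
    (\<forall>y\<in>\<Omega> \<inter> ball x0 r. \<forall>\<tau>\<in>{0..r}. \<forall>w. norm w \<le> \<delta> \<longrightarrow> y + \<tau> *\<^sub>R (e + w) \<in> \<Omega>)"
proof -
  \<comment> \<open>A displacement has length at most 2 r, so a point starting within r stays within
    4 r. This is why charts are shrunk to a quarter of their radius.\<close>
  have small: "dist x0 (y + \<tau> *\<^sub>R (e + w)) < 4 * r"
    if "y \<in> ball x0 r" "\<tau> \<in> {0..r}" "norm w \<le> 1" "norm e = 1" for y w e :: 'a and \<tau> r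
  proof -
    have "norm (\<tau> *\<^sub>R (e + w)) \<le> r * (1 + 1)"
      using that norm_triangle_ineq[of e w] by (auto intro!: mult_mono)
    moreover have "dist x0 (y + \<tau> *\<^sub>R (e + w)) \<le> dist x0 y + norm (\<tau> *\<^sub>R (e + w))"
      using dist_triangle[of x0 "y + \<tau> *\<^sub>R (e + w)" y] by (simp add: dist_norm)
    moreover have "0 < r" using that(1) by (auto intro: le_less_trans[OF zero_le_dist])
    ultimately show ?thesis using that(1) by simp
  qed
  show ?thesis
  proof (cases "x0 \<in> \<Omega>")
    case True
    then obtain r0 where r0: "0 < r0" "ball x0 r0 \<subseteq> \<Omega>" using assms(1) by (auto simp: open_contains_ball)
    obtain e :: 'a where e: "norm e = 1" using norm_Basis nonempty_Basis by blast
    have "y + \<tau> *\<^sub>R (e + w) \<in> \<Omega>" if "y \<in> \<Omega> \<inter> ball x0 (r0 / 4)" "\<tau> \<in> {0..r0 / 4}" "norm w \<le> 1 / 2" for y \<tau> w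
      using small[of y "r0 / 4" \<tau> w e] that e r0 by auto
    thus ?thesis using r0 e by (intro exI[of _ "r0 / 4"] exI[of _ "1 / 2"] exI[of _ e] conjI) auto
  next
    case False
    hence "x0 \<in> frontier \<Omega>" using assms by (auto simp: frontier_def interior_open)
    from bspec[OF assms(2)[unfolded lipschitz_boundary_def] this]
    obtain r0 e g L where r0: "0 < r0" and e: "norm e = 1"
      and g: "L-lipschitz_on {y. y \<bullet> e = 0} (g :: 'a \<Rightarrow> real)"
      and eq: "\<Omega> \<inter> ball x0 r0 = {x \<in> ball x0 r0. g (x - (x \<bullet> e) *\<^sub>R e) < x \<bullet> e}"
      by (elim exE conjE) (erule (3) that)
    have L: "0 \<le> L" using g by (rule lipschitz_on_nonneg)
    have ee: "e \<bullet> e = 1" using e by (simp add: dot_square_norm)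
    define \<delta> where "\<delta> = 1 / (2 * (1 + L))"
    have d: "0 < \<delta>" "\<delta> < 1" "2 * \<delta> * L + \<delta> \<le> 1" using L by (auto simp: \<delta>_def field_simps)
    have "y + \<tau> *\<^sub>R (e + w) \<in> \<Omega>" if y: "y \<in> \<Omega> \<inter> ball x0 (r0 / 4)" and \<tau>: "\<tau> \<in> {0..r0 / 4}" and w: "norm w \<le> \<delta>" for y \<tau> w
    proof -
      define P where "P z = z - (z \<bullet> e) *\<^sub>R e" for z
      let ?z = "y + \<tau> *\<^sub>R (e + w)"
      have zb: "?z \<in> ball x0 r0" using small[of y "r0 / 4" \<tau> w e] y \<tau> w d e by auto
      have "y \<in> \<Omega> \<inter> ball x0 r0" using y r0 by auto
      hence gy: "g (P y) < y \<bullet> e" unfolding eq P_def by simp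
      have "\<bar>w \<bullet> e\<bar> \<le> norm w" using Cauchy_Schwarz_ineq2[of w e] e by simp
      hence we: "\<bar>w \<bullet> e\<bar> \<le> \<delta>" using w by simp
      have "P ?z - P y = \<tau> *\<^sub>R (w - (w \<bullet> e) *\<^sub>R e)"
        by (simp add: P_def inner_add_left ee algebra_simps)
      hence "dist (P ?z) (P y) = \<tau> * norm (w - (w \<bullet> e) *\<^sub>R e)" using \<tau> by (simp add: dist_norm)
      also have "\<dots> \<le> \<tau> * (2 * \<delta>)"
        using norm_triangle_ineq4[of w "(w \<bullet> e) *\<^sub>R e"] \<tau> w we e by (intro mult_left_mono) auto
      finally have "L * dist (P ?z) (P y) \<le> L * (\<tau> * (2 * \<delta>))" using L by (rule mult_left_mono)
      moreover have "dist (g (P ?z)) (g (P y)) \<le> L * dist (P ?z) (P y)"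
        using g by (rule lipschitz_onD) (auto simp: P_def inner_diff_left ee)
      ultimately have "g (P ?z) \<le> g (P y) + \<tau> * (2 * \<delta> * L)" by (auto simp: dist_real_def mult_ac)
      also have "\<dots> < y \<bullet> e + \<tau> * (1 - \<delta>)"
        using gy d \<tau> mult_left_mono[of "2 * \<delta> * L" "1 - \<delta>" \<tau>] by auto
      also have "\<dots> \<le> y \<bullet> e + \<tau> * (1 + w \<bullet> e)" using we \<tau> by (intro add_mono mult_left_mono) auto
      also have "\<dots> = ?z \<bullet> e" by (simp add: inner_add_left ee)
      finally have "?z \<in> \<Omega> \<inter> ball x0 r0" unfolding eq using zb by (simp add: P_def)
      thus ?thesis by simp
    qed
    thus ?thesis using r0 e d by (intro exI[of _ "r0 / 4"] exI[of _ \<delta>] exI[of _ e] conjI) auto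
  qed
qed

text \<open>A finite cover with constants common to all patches. \<open>\<rho>\<close> is a Lebesgue
  number: two points of \<open>\<Omega>\<close> at distance less than \<open>\<rho>\<close> lie in
  one patch and share its axis.\<close>

locale cone_cover =
  fixes \<Omega> :: "'a::euclidean_space set" and X :: "'a set" and r :: "'a \<Rightarrow> real" and e :: "'a \<Rightarrow> 'a" and \<rho> \<delta> t0 :: real
  assumes \<Omega>: "open \<Omega>" "bounded \<Omega>"
    and X: "finite X" and pos: "0 < \<rho>" "0 < \<delta>" "\<delta> < 1" "0 < t0" "t0 \<le> 1"
    and cover: "y \<in> \<Omega> \<Longrightarrow> \<exists>x\<in>X. ball y \<rho> \<subseteq> ball x (r x)"
    and e: "x \<in> X \<Longrightarrow> norm (e x) = 1"
    and cone: "x \<in> X \<Longrightarrow> y \<in> \<Omega> \<inter> ball x (r x) \<Longrightarrow> 0 \<le> \<tau> \<Longrightarrow> \<tau> \<le> t0 \<Longrightarrow> norm w \<le> \<delta> \<Longrightarrow> y + \<tau> *\<^sub>R (e x + w) \<in> \<Omega>"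

lemma cone_cover_exists:
  fixes \<Omega> :: "'a::euclidean_space set"
  assumes \<Omega>: "open \<Omega>" "bounded \<Omega>" and lip: "lipschitz_boundary \<Omega>"
  shows "\<exists>X r e \<rho> \<delta> t0. cone_cover \<Omega> X r e \<rho> \<delta> t0"
proof -
  define Q where "Q x r \<delta> e \<longleftrightarrow> 0 < r \<and> 0 < \<delta> \<and> \<delta> < 1 \<and> norm e = 1 \<and>
    (\<forall>y\<in>\<Omega> \<inter> ball x r. \<forall>\<tau>\<in>{0..r}. \<forall>w. norm w \<le> \<delta> \<longrightarrow> y + \<tau> *\<^sub>R (e + w) \<in> \<Omega>)" for x e :: 'a and r \<delta> :: real
  have "\<forall>x\<in>closure \<Omega>. \<exists>r \<delta> e. Q x r \<delta> e"
  proof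
    fix x assume "x \<in> closure \<Omega>"
    from lipschitz_boundary_cone[OF \<Omega>(1) lip this] show "\<exists>r \<delta> e. Q x r \<delta> e"
      unfolding Q_def by (elim exE conjE) (intro exI conjI)
  qed
  then obtain r \<delta> e where Q: "\<And>x. x \<in> closure \<Omega> \<Longrightarrow> Q x (r x) (\<delta> x) (e x)" by metis
  have comp: "compact (closure \<Omega>)" using \<Omega>(2) by (simp add: compact_closure)
  have cov: "closure \<Omega> \<subseteq> (\<Union>x\<in>closure \<Omega>. ball x (r x))" using Q by (force simp: Q_def)
  obtain X where X: "X \<subseteq> closure \<Omega>" "finite X" "closure \<Omega> \<subseteq> (\<Union>x\<in>X. ball x (r x))"
    by (rule compactE_image[OF comp _ cov]) auto
  obtain \<rho> where \<rho>: "0 < \<rho>" "\<And>y. y \<in> closure \<Omega> \<Longrightarrow> \<exists>G\<in>(\<lambda>x. ball x (r x)) ` X. ball y \<rho> \<subseteq> G"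
    by (rule Heine_Borel_lemma[OF comp X(3)]) auto
  \<comment> \<open>The inserted 1/2, and the 1 for \<open>t\<close>, keep the minima defined for
    empty \<open>X\<close> and provide the upper bounds required of both constants.\<close>
  define d where "d = Min (insert (1/2) (\<delta> ` X))"
  define t where "t = Min (insert 1 (r ` X))"
  have d: "0 < d" "d < 1" "\<And>x. x \<in> X \<Longrightarrow> d \<le> \<delta> x"
    using X(1,2) Q unfolding d_def by (auto simp: Q_def Min_gr_iff Min_less_iff intro!: Min_le)
  have t: "0 < t" "t \<le> 1" "\<And>x. x \<in> X \<Longrightarrow> t \<le> r x"
    using X(1,2) Q unfolding t_def by (auto simp: Q_def Min_gr_iff intro!: Min_le)
  have "cone_cover \<Omega> X r e \<rho> d t"
  proof
    fix y assume "y \<in> \<Omega>"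
    hence "y \<in> closure \<Omega>" using closure_subset by blast
    from \<rho>(2)[OF this] show "\<exists>x\<in>X. ball y \<rho> \<subseteq> ball x (r x)" by blast
  next
    fix x y w :: 'a and \<tau>
    assume *: "x \<in> X" "y \<in> \<Omega> \<inter> ball x (r x)" "0 \<le> \<tau>" "\<tau> \<le> t" "norm w \<le> d"
    have "Q x (r x) (\<delta> x) (e x)" using Q X(1) *(1) by blast
    moreover have "\<tau> \<in> {0..r x}" "norm w \<le> \<delta> x" using * d(3)[OF *(1)] t(3)[OF *(1)] by auto
    ultimately show "y + \<tau> *\<^sub>R (e x + w) \<in> \<Omega>" using *(2) unfolding Q_def by blast
  next
    fix x assume "x \<in> X"
    thus "norm (e x) = 1" using Q X(1) unfolding Q_def by blast
  qed (use \<Omega> X \<rho> d t in auto)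
  thus ?thesis by blast
qed

lemma emeasure_lborel_ball_eq:
  fixes x :: "'a::euclidean_space"
  assumes "0 < t"
  shows "emeasure lborel (ball x t) = ennreal (measure lebesgue (ball (0::'a) 1) * t powr DIM('a))"
proof -
  have "emeasure lborel (ball x t) = ennreal (measure lborel (ball x t))"
    using emeasure_lborel_ball_finite[of x t] by (subst emeasure_eq_ennreal_measure) auto
  also have "measure lborel (ball x t) = t ^ DIM('a) * measure lborel (ball (0::'a) 1)"
    using content_ball_conv_unit_ball[of t x] assms by simp
  finally show ?thesis using assms by (simp add: powr_realpow mult.commute)
qed

section \<open>Consequences of the uniform cone condition\<close>

context cone_cover
begin

text \<open>The ball of radius \<sigma> \<delta> around x + \<sigma> e sits in the cone at x. Its
  points are at distance less than 2 \<sigma> from x, and \<sigma> = t0 t / 2 with t0 \<le> 1 keeps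
  them within t.\<close>

lemma ball_lower:
  assumes x: "x \<in> \<Omega>" and t: "0 < t" "t \<le> 1"
  shows "ennreal (measure lebesgue (ball (0::'a) 1) * (t0 * \<delta> / 2) powr DIM('a) * t powr DIM('a)) \<le> emeasure lborel (ball x t \<inter> \<Omega>)"
proof -
  define \<sigma> where "\<sigma> = t0 * t / 2"
  have s: "0 < \<sigma>" "\<sigma> \<le> t0" "2 * \<sigma> \<le> t" using t pos mult_mono[of t0 1 t t] mult_mono[of t0 t0 t 1] by (auto simp: \<sigma>_def)
  obtain i where i: "i \<in> X" "ball x \<rho> \<subseteq> ball i (r i)" using cover[OF x] by blast
  have xi: "x \<in> \<Omega> \<inter> ball i (r i)" using x i(2) pos(1) by (meson IntI centre_in_ball subsetD)
  have "ball (x + \<sigma> *\<^sub>R e i) (\<sigma> * \<delta>) \<subseteq> ball x t \<inter> \<Omega>"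
  proof
    fix z assume z: "z \<in> ball (x + \<sigma> *\<^sub>R e i) (\<sigma> * \<delta>)"
    define w where "w = (z - (x + \<sigma> *\<^sub>R e i)) /\<^sub>R \<sigma>"
    have zw: "z = x + \<sigma> *\<^sub>R (e i + w)" using s by (simp add: w_def algebra_simps)
    have "norm w = norm (z - (x + \<sigma> *\<^sub>R e i)) / \<sigma>"
      unfolding w_def norm_scaleR using s by (simp add: divide_inverse mult.commute)
    moreover have "norm (z - (x + \<sigma> *\<^sub>R e i)) < \<sigma> * \<delta>" using z by (simp add: dist_norm norm_minus_commute)
    ultimately have wd: "norm w < \<delta>" using s by (simp add: pos_divide_less_eq mult.commute)
    moreover from this have "z \<in> \<Omega>" unfolding zw by (intro cone[OF i(1) xi]) (use s in auto)
    moreover have "norm (\<sigma> *\<^sub>R (e i + w)) < \<sigma> * 2"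
      using norm_triangle_ineq[of "e i" w] e[OF i(1)] wd pos s by auto
    hence "norm (\<sigma> *\<^sub>R (e i + w)) < t" using s(3) by linarith
    hence "dist x z < t" unfolding zw dist_norm by (metis add_diff_cancel_left' norm_minus_commute)
    ultimately show "z \<in> ball x t \<inter> \<Omega>" by simp
  qed
  hence "emeasure lborel (ball (x + \<sigma> *\<^sub>R e i) (\<sigma> * \<delta>)) \<le> emeasure lborel (ball x t \<inter> \<Omega>)"
    using \<Omega>(1) by (intro emeasure_mono) auto
  moreover have "(\<sigma> * \<delta>) powr DIM('a) = (t0 * \<delta> / 2) powr DIM('a) * t powr DIM('a)"
    using pos t by (subst powr_mult[symmetric]) (auto simp: \<sigma>_def mult_ac)
  ultimately show ?thesis
    using emeasure_lborel_ball_eq[of "\<sigma> * \<delta>" "x + \<sigma> *\<^sub>R e i"] s pos by (simp add: mult.assoc)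
qed

lemma emeasure_lebesgue_on_eq:
  assumes "A \<in> sets borel"
  shows "emeasure (lebesgue_on \<Omega>) (A \<inter> \<Omega>) = emeasure lborel (A \<inter> \<Omega>)"
proof -
  have "A \<inter> \<Omega> \<in> sets borel" using assms \<Omega>(1) by auto
  thus ?thesis using \<Omega>(1) by (subst emeasure_restrict_space) (auto simp: emeasure_completion)
qed

lemma regular_measure_lebesgue_on: "\<exists>c C R. regular_measure (lebesgue_on \<Omega>) c C R"
proof -
  define v where "v = measure lebesgue (ball (0::'a) 1)"
  have v: "0 < v" using content_ball_pos[of 1 "0::'a"] by (simp add: v_def)
  obtain R where R: "\<And>x y. x \<in> \<Omega> \<Longrightarrow> y \<in> \<Omega> \<Longrightarrow> dist x y \<le> R"
    using \<Omega>(2) unfolding bounded_two_points by auto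
  have "regular_measure (lebesgue_on \<Omega>) (v * (t0 * \<delta> / 2) powr DIM('a)) v (max 1 R)"
  proof (intro regular_measure.intro regular_measure_axioms.intro)
    show "finite_measure (lebesgue_on \<Omega>)"
      using \<Omega> by (intro finite_measure_lebesgue_on lmeasurable_open)
    show "(\<lambda>x. x) \<in> borel_measurable (lebesgue_on \<Omega>)" using id_borel_measurable_lebesgue_on[of \<Omega>] by (simp add: id_def)
    show "0 < v * (t0 * \<delta> / 2) powr DIM('a)" using v pos by simp
    show "1 \<le> max 1 R" by simp
    show "norm (x - y) \<le> max 1 R" if "x \<in> space (lebesgue_on \<Omega>)" "y \<in> space (lebesgue_on \<Omega>)" for x y
      using R[of x y] that by (auto simp: dist_norm)
    show "ennreal (v * (t0 * \<delta> / 2) powr DIM('a) * t powr DIM('a)) \<le> emeasure (lebesgue_on \<Omega>) (ball x t \<inter> space (lebesgue_on \<Omega>))"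
      if "x \<in> space (lebesgue_on \<Omega>)" "0 < t" "t \<le> 1" for x t
      using ball_lower[of x t] that by (simp add: emeasure_lebesgue_on_eq v_def)
    show "emeasure (lebesgue_on \<Omega>) (ball x t \<inter> space (lebesgue_on \<Omega>)) \<le> ennreal (v * t powr DIM('a))" if "0 < t" for x t
      using emeasure_mono[of "ball x t \<inter> \<Omega>" "ball x t" lborel] emeasure_lborel_ball_eq[OF that, of x]
      by (simp add: emeasure_lebesgue_on_eq v_def)
  qed
  thus ?thesis by blast
qed

text \<open>For \<open>x\<close> and \<open>y = x + h\<close> in the same patch, the point \<open>y + t e = x + (t e + h)\<close> with \<open>t = |h| / \<delta>\<close> is
  reached from both along segments inside the domain, since \<open>|h| \<le> t \<delta>\<close>.\<close>

lemma gradient_energy_bound: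
  fixes \<sigma> p :: real
  assumes p: "1 \<le> p" and \<sigma>: "0 < \<sigma>" "\<sigma> < 1"
  shows "\<exists>K\<ge>0. \<forall>u g. borel_weak_gradient \<Omega> u g \<longrightarrow>
    (\<integral>\<^sup>+x\<in>\<Omega>. ennreal (\<bar>u x\<bar> powr p) \<partial>lborel) \<le> 1 \<longrightarrow> (\<integral>\<^sup>+x\<in>\<Omega>. ennreal (norm (g x) powr p) \<partial>lborel) \<le> 1 \<longrightarrow>
    (\<integral>\<^sup>+x\<in>\<Omega>. (\<integral>\<^sup>+y\<in>\<Omega>. diff_quot \<sigma> p u x y \<partial>lborel) \<partial>lborel) \<le> ennreal K"
proof -
  define n where "n = real DIM('a)"
  \<comment> \<open>Closer than this, two points share a patch, the cone parameter |h| / \<delta>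
    stays below \<open>t0\<close>, and, as |h| \<le> 1, the exponent of |h| may be lowered to
    \<open>e0 - n\<close>.\<close>
  define \<rho>1 where "\<rho>1 = min (min \<rho> (\<delta> * t0)) 1"
  have r1: "0 < \<rho>1" "\<rho>1 \<le> \<rho>" "\<rho>1 \<le> \<delta> * t0" "\<rho>1 \<le> 1" using pos by (auto simp: \<rho>1_def)
  \<comment> \<open>The gradient gains |h|^p against the weight |h|^(-(n + \<sigma> p)), which
    leaves the exponent (1 - \<sigma>) p - n. The cap at n meets the hypothesis of
    \<open>singular_integral_bound\<close>.\<close>
  define e0 where "e0 = min ((1 - \<sigma>) * p) n"
  have e0: "0 < e0" "e0 \<le> n" "e0 \<le> (1 - \<sigma>) * p" using \<sigma> p by (auto simp: e0_def n_def)
  have b: "emeasure lborel (ball x t \<inter> space lborel) \<le> ennreal (measure lebesgue (ball (0::'a) 1) * t powr DIM('a))" if "0 < t" for x :: 'a and t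
    using emeasure_lborel_ball_eq[OF that, of x] by simp
  from singular_integral_bound[OF _ b e0(1) e0(2)[unfolded n_def]] obtain K0 where K0: "0 \<le> K0"
    "\<And>x::'a. (\<integral>\<^sup>+y. ennreal (norm (x - y) powr (e0 - n)) * indicator (ball x 1) y \<partial>lborel) \<le> ennreal K0"
    unfolding n_def by auto
  define V where "V = measure lborel \<Omega>"
  have Ofin: "emeasure lborel \<Omega> = ennreal V"
    using emeasure_bounded_finite[OF \<Omega>(2)] by (simp add: V_def emeasure_eq_ennreal_measure)
  have Om[measurable]: "\<Omega> \<in> sets borel" using \<Omega>(1) by simp
  define c1 where "c1 = 2 powr p * \<rho>1 powr (- (n + \<sigma> * p))"
  define c2 where "c2 = 2 powr p * (2 powr p * (1 / \<delta> + 1) powr p + 2 powr p * (1 / \<delta>) powr p)"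
  have c: "0 \<le> c1" "0 \<le> c2" by (auto simp: c1_def c2_def)
  have np: "0 \<le> n + \<sigma> * p" using p \<sigma> by (auto simp: n_def)
  have "(\<integral>\<^sup>+x\<in>\<Omega>. (\<integral>\<^sup>+y\<in>\<Omega>. diff_quot \<sigma> p u x y \<partial>lborel) \<partial>lborel) \<le> ennreal (c1 * (2 * V) + real (card X) * (c2 * K0))"
    if wg: "borel_weak_gradient \<Omega> u g" and J: "(\<integral>\<^sup>+x\<in>\<Omega>. ennreal (\<bar>u x\<bar> powr p) \<partial>lborel) \<le> 1"
      and G: "(\<integral>\<^sup>+x\<in>\<Omega>. ennreal (norm (g x) powr p) \<partial>lborel) \<le> 1" for u g
  proof -
    interpret borel_weak_gradient \<Omega> u g by fact
    define A where "A i = \<Omega> \<inter> ball i (r i)" for i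
    have Am[measurable]: "A i \<in> sets borel" for i by (simp add: A_def)
    define f where "f i h = (norm h / \<delta>) *\<^sub>R e i" for i and h :: 'a
    have fm[measurable]: "f i \<in> borel_measurable borel" for i unfolding f_def by measurable
    have [measurable]: "Measurable.pred borel (\<lambda>x. x \<in> ball (0::'a) t)" for t by simp
    define w where "w h = ennreal (norm h powr (- (n + \<sigma> * p))) * indicator (ball 0 \<rho>1) h" for h :: 'a
    have wm[measurable]: "w \<in> borel_measurable borel" unfolding w_def by measurable
    \<comment> \<open>The two legs to the common point x + h + f: from x along f + h, and from y = x
      + h along f. The indicators restrict to pairs in patch \<open>i\<close>.\<close>
    define d where "d i x h = (ennreal (\<bar>u (x + (f i h + h)) - u x\<bar> powr p) + ennreal (\<bar>u ((x + h) + f i h) - u (x + h)\<bar> powr p))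
       * (indicator (A i) x * indicator (A i) (x + h))" for i x h
    define near where "near i x h = w h * (ennreal (2 powr p) * d i x h)" for i x h
    have nm[measurable]: "(\<lambda>(x, h). near i x h) \<in> borel_measurable (borel \<Otimes>\<^sub>M borel)" for i
      unfolding near_def d_def by measurable
    have nm1[measurable]: "(\<lambda>h. near i x h) \<in> borel_measurable borel" for i x
      unfolding near_def d_def by measurable
    \<comment> \<open>Far pairs are controlled by the L^p norm alone. A near pair lies in some
      common patch, and summing over all patches avoids choosing one measurably.\<close>
    have pw: "diff_quot \<sigma> p u x y \<le> ennreal c1 * (ennreal (\<bar>u x\<bar> powr p) + ennreal (\<bar>u y\<bar> powr p)) + (\<Sum>i\<in>X. near i x (y - x))"
      if x: "x \<in> \<Omega>" and y: "y \<in> \<Omega>" for x y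
    proof (cases "norm (x - y) < \<rho>1")
      case False
      have "norm (x - y) powr (- (n + \<sigma> * p)) \<le> \<rho>1 powr (- (n + \<sigma> * p))"
        using False r1 np by (intro powr_mono2') auto
      hence "\<bar>u x - u y\<bar> powr p * norm (x - y) powr (- (n + \<sigma> * p)) \<le> (2 powr p * (\<bar>u x\<bar> powr p + \<bar>u y\<bar> powr p)) * \<rho>1 powr (- (n + \<sigma> * p))"
        using abs_diff_powr_le[of p "u x" "u y"] p by (intro mult_mono) auto
      hence "diff_quot \<sigma> p u x y \<le> ennreal (c1 * (\<bar>u x\<bar> powr p + \<bar>u y\<bar> powr p))"
        unfolding diff_quot_def n_def[symmetric] c1_def powr_minus divide_inverse by (intro ennreal_leI) (simp add: mult_ac)
      also have "\<dots> = ennreal c1 * (ennreal (\<bar>u x\<bar> powr p) + ennreal (\<bar>u y\<bar> powr p))" using c by (simp add: ennreal_mult)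
      finally show ?thesis by (rule order_trans) simp
    next
      case True
      define h where "h = y - x"
      have hy: "y = x + h" by (simp add: h_def)
      obtain i where i: "i \<in> X" "ball x \<rho> \<subseteq> ball i (r i)" using cover[OF x] by blast
      have xA: "x \<in> A i" "y \<in> A i" using i(2) x y True r1 pos(1) by (auto simp: A_def subset_iff dist_norm)
      have "\<bar>u x - u y\<bar> powr p = \<bar>(u ((x + h) + f i h) - u (x + h)) - (u (x + (f i h + h)) - u x)\<bar> powr p"
        by (simp add: hy algebra_simps)
      also have "\<dots> \<le> 2 powr p * (\<bar>u ((x + h) + f i h) - u (x + h)\<bar> powr p + \<bar>u (x + (f i h + h)) - u x\<bar> powr p)"
        using p by (intro abs_diff_powr_le) auto
      finally have "ennreal (\<bar>u x - u y\<bar> powr p) \<le> ennreal (2 powr p) * d i x h"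
        using xA by (simp add: d_def hy ennreal_mult[symmetric] ennreal_plus[symmetric] ennreal_leI add.commute del: ennreal_plus)
      hence "w h * ennreal (\<bar>u x - u y\<bar> powr p) \<le> near i x h" unfolding near_def by (intro mult_left_mono) auto
      moreover have "diff_quot \<sigma> p u x y = w h * ennreal (\<bar>u x - u y\<bar> powr p)"
        using True unfolding diff_quot_def n_def[symmetric] w_def h_def powr_minus divide_inverse
        by (simp add: ennreal_mult[symmetric] norm_minus_commute mult.commute)
      ultimately have "diff_quot \<sigma> p u x y \<le> near i x h" by simp
      also have "\<dots> \<le> (\<Sum>i\<in>X. near i x h)" using i(1) X by (intro member_le_sum) auto
      finally show ?thesis unfolding h_def by (simp add: add_increasing)
    qed
    have near_int: "(\<integral>\<^sup>+x. near i x h \<partial>lborel) \<le> ennreal c2 * (ennreal (norm (0 - h) powr (e0 - n)) * indicator (ball 0 1) h)"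
      if i: "i \<in> X" for i h
    proof (cases "h \<noteq> 0 \<and> norm h < \<rho>1")
      case False
      thus ?thesis by (auto simp: near_def w_def)
    next
      case True
      have h0: "0 < norm h" using True by simp
      have ti: "norm h / \<delta> \<le> t0" using True r1(3) pos by (simp add: pos_divide_le_eq mult.commute)
      have seg1: "x \<in> segment_domain (f i h + h)" if "x \<in> A i" for x
        unfolding segment_domain_def
      proof (intro CollectI ballI)
        fix \<tau> :: real assume t: "\<tau> \<in> {0..1}"
        define w where "w = (\<delta> / norm h) *\<^sub>R h"
        have "x + \<tau> *\<^sub>R (f i h + h) = x + (\<tau> * (norm h / \<delta>)) *\<^sub>R (e i + w)"
          using h0 pos by (simp add: f_def w_def scaleR_add_right)
        moreover have "x + (\<tau> * (norm h / \<delta>)) *\<^sub>R (e i + w) \<in> \<Omega>"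
        proof (rule cone[OF i])
          show "\<tau> * (norm h / \<delta>) \<le> t0" using t ti pos h0 mult_mono[of \<tau> 1 "norm h / \<delta>" t0] by auto
        qed (use that t pos in \<open>auto simp: A_def w_def\<close>)
        ultimately show "x + \<tau> *\<^sub>R (f i h + h) \<in> \<Omega>" by simp
      qed
      have seg2: "x \<in> segment_domain (f i h)" if "x \<in> A i" for x
        unfolding segment_domain_def
      proof (intro CollectI ballI)
        fix \<tau> :: real assume t: "\<tau> \<in> {0..1}"
        have "x + (\<tau> * (norm h / \<delta>)) *\<^sub>R (e i + 0) \<in> \<Omega>"
        proof (rule cone[OF i])
          show "\<tau> * (norm h / \<delta>) \<le> t0" using t ti pos h0 mult_mono[of \<tau> 1 "norm h / \<delta>" t0] by auto
        qed (use that t pos in \<open>auto simp: A_def\<close>)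
        thus "x + \<tau> *\<^sub>R f i h \<in> \<Omega>" by (simp add: f_def)
      qed
      have nf: "norm (f i h) = norm h * (1 / \<delta>)" using e[OF i] pos by (simp add: f_def)
      have nf1: "norm (f i h + h) \<le> norm h * (1 / \<delta> + 1)"
        using norm_triangle_ineq[of "f i h" h] nf by (simp add: algebra_simps)
      let ?D1 = "\<lambda>x. ennreal (\<bar>u (x + (f i h + h)) - u x\<bar> powr p) * indicator (segment_domain (f i h + h)) x"
      let ?D2 = "\<lambda>x. ennreal (\<bar>u (x + f i h) - u x\<bar> powr p) * indicator (segment_domain (f i h)) x"
      have [measurable]: "segment_domain z \<in> sets borel" for z using open_segment_domain[of z] by simp
      have "(\<integral>\<^sup>+x. d i x h \<partial>lborel) \<le> (\<integral>\<^sup>+x. ?D1 x + ?D2 (x + h) \<partial>lborel)"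
        by (intro nn_integral_mono) (auto simp: d_def indicator_def seg1 seg2)
      also have "\<dots> = (\<integral>\<^sup>+x. ?D1 x \<partial>lborel) + (\<integral>\<^sup>+x. ?D2 (x + h) \<partial>lborel)" by (intro nn_integral_add) measurable
      also have "(\<integral>\<^sup>+x. ?D2 (x + h) \<partial>lborel) = (\<integral>\<^sup>+x. ?D2 x \<partial>lborel)" by (rule lborel_nn_integral_translate) measurable
      also have "(\<integral>\<^sup>+x. ?D1 x \<partial>lborel) + (\<integral>\<^sup>+x. ?D2 x \<partial>lborel) \<le>
        ennreal (2 powr p * norm (f i h + h) powr p) * 1 + ennreal (2 powr p * norm (f i h) powr p) * 1"
        by (intro add_mono order_trans[OF difference_powr_integral_le[OF p]] mult_left_mono G) auto
      also have "\<dots> \<le> ennreal (2 powr p * (norm h * (1 / \<delta> + 1)) powr p) + ennreal (2 powr p * (norm h * (1 / \<delta>)) powr p)"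
        unfolding nf using nf1 p by (intro add_mono) (auto intro!: ennreal_leI mult_left_mono powr_mono2)
      also have "\<dots> = ennreal ((2 powr p * (1 / \<delta> + 1) powr p + 2 powr p * (1 / \<delta>) powr p) * norm h powr p)"
      proof -
        have "(norm h * (1 / \<delta> + 1)) powr p = norm h powr p * (1 / \<delta> + 1) powr p"
          "(norm h * (1 / \<delta>)) powr p = norm h powr p * (1 / \<delta>) powr p"
          by (rule powr_mult; use pos in simp)+
        thus ?thesis by (simp only: ennreal_plus[symmetric] mult_nonneg_nonneg powr_ge_zero distrib_right) (simp add: mult_ac)
      qed
      finally have dl: "(\<integral>\<^sup>+x. d i x h \<partial>lborel) \<le> ennreal ((2 powr p * (1 / \<delta> + 1) powr p + 2 powr p * (1 / \<delta>) powr p) * norm h powr p)" .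
      have dmeas: "(\<lambda>x. d i x h) \<in> borel_measurable lborel" unfolding d_def by measurable
      have "(\<integral>\<^sup>+x. near i x h \<partial>lborel) = w h * (ennreal (2 powr p) * (\<integral>\<^sup>+x. d i x h \<partial>lborel))"
        unfolding near_def using dmeas by (simp add: nn_integral_cmult)
      also have "\<dots> \<le> w h * (ennreal (2 powr p) * ennreal ((2 powr p * (1 / \<delta> + 1) powr p + 2 powr p * (1 / \<delta>) powr p) * norm h powr p))"
        by (intro mult_left_mono dl) auto
      also have "\<dots> = w h * ennreal (c2 * norm h powr p)"
        by (simp add: c2_def ennreal_mult[symmetric] mult.assoc)
      also have "\<dots> = ennreal (norm h powr (- (n + \<sigma> * p)) * (c2 * norm h powr p))"
        using True c by (simp add: w_def ennreal_mult)
      also have "norm h powr (- (n + \<sigma> * p)) * (c2 * norm h powr p) = c2 * norm h powr ((1 - \<sigma>) * p - n)"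
        by (simp add: powr_add[symmetric] mult.left_commute algebra_simps)
      also have "\<dots> \<le> c2 * norm h powr (e0 - n)"
        using True r1 e0 c by (intro mult_left_mono powr_mono') auto
      finally show ?thesis using True r1 c by (simp add: ennreal_mult ennreal_leI)
    qed
    have near_total: "(\<integral>\<^sup>+x. \<integral>\<^sup>+y. near i x (y - x) \<partial>lborel \<partial>lborel) \<le> ennreal (c2 * K0)" if i: "i \<in> X" for i
    proof -
      have "(\<integral>\<^sup>+y. near i x (y - x) \<partial>lborel) = (\<integral>\<^sup>+h. near i x h \<partial>lborel)" for x
        using lborel_nn_integral_translate[of "\<lambda>h. near i x h" "- x"] by simp
      hence "(\<integral>\<^sup>+x. \<integral>\<^sup>+y. near i x (y - x) \<partial>lborel \<partial>lborel) = (\<integral>\<^sup>+x. \<integral>\<^sup>+h. near i x h \<partial>lborel \<partial>lborel)" by simp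
      also have "\<dots> = (\<integral>\<^sup>+h. \<integral>\<^sup>+x. near i x h \<partial>lborel \<partial>lborel)"
        by (rule lborel_pair.Fubini'[symmetric]) (use nm in simp)
      also have "\<dots> \<le> (\<integral>\<^sup>+h. ennreal c2 * (ennreal (norm (0 - h :: 'a) powr (e0 - n)) * indicator (ball 0 1) h) \<partial>lborel)"
        by (intro nn_integral_mono near_int i)
      also have "\<dots> = ennreal c2 * (\<integral>\<^sup>+h. ennreal (norm (0 - h :: 'a) powr (e0 - n)) * indicator (ball 0 1) h \<partial>lborel)"
        by (intro nn_integral_cmult) measurable
      also have "\<dots> \<le> ennreal c2 * ennreal K0" by (intro mult_left_mono K0) auto
      finally show ?thesis using c K0 by (simp add: ennreal_mult)
    qed
    let ?F = "\<lambda>x y. ennreal c1 * (ennreal (\<bar>u x\<bar> powr p) * indicator \<Omega> x * indicator \<Omega> y + ennreal (\<bar>u y\<bar> powr p) * indicator \<Omega> y * indicator \<Omega> x)"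
    have "(\<integral>\<^sup>+x\<in>\<Omega>. (\<integral>\<^sup>+y\<in>\<Omega>. diff_quot \<sigma> p u x y \<partial>lborel) \<partial>lborel) \<le>
      (\<integral>\<^sup>+x. \<integral>\<^sup>+y. ?F x y + (\<Sum>i\<in>X. near i x (y - x)) \<partial>lborel \<partial>lborel)"
    proof (intro nn_integral_mono)
      fix x
      show "(\<integral>\<^sup>+y\<in>\<Omega>. diff_quot \<sigma> p u x y \<partial>lborel) * indicator \<Omega> x \<le> (\<integral>\<^sup>+y. ?F x y + (\<Sum>i\<in>X. near i x (y - x)) \<partial>lborel)"
      proof (cases "x \<in> \<Omega>")
        case True
        have "(\<integral>\<^sup>+y\<in>\<Omega>. diff_quot \<sigma> p u x y \<partial>lborel) \<le> (\<integral>\<^sup>+y. ?F x y + (\<Sum>i\<in>X. near i x (y - x)) \<partial>lborel)"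
          using pw[OF True] True by (intro nn_integral_mono) (auto simp: indicator_def)
        thus ?thesis using True by simp
      qed simp
    qed
    also have "\<dots> = (\<integral>\<^sup>+x. \<integral>\<^sup>+y. ?F x y \<partial>lborel \<partial>lborel) + (\<Sum>i\<in>X. \<integral>\<^sup>+x. \<integral>\<^sup>+y. near i x (y - x) \<partial>lborel \<partial>lborel)"
    proof -
      have m: "(\<lambda>(x, y). near i x (y - x)) \<in> borel_measurable (lborel \<Otimes>\<^sub>M lborel)" for i
        unfolding near_def d_def by measurable
      have m1: "(\<lambda>y. near i x (y - x)) \<in> borel_measurable lborel" for i x
        unfolding near_def d_def by measurable
      have m2[measurable]: "(\<lambda>x. \<integral>\<^sup>+y. near i x (y - x) \<partial>lborel) \<in> borel_measurable lborel" for i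
        using m[of i] by (intro lborel.borel_measurable_nn_integral) simp
      have "(\<integral>\<^sup>+y. ?F x y + (\<Sum>i\<in>X. near i x (y - x)) \<partial>lborel) = (\<integral>\<^sup>+y. ?F x y \<partial>lborel) + (\<Sum>i\<in>X. \<integral>\<^sup>+y. near i x (y - x) \<partial>lborel)" for x
        using m1 by (subst nn_integral_add) (auto simp: nn_integral_sum)
      moreover have "(\<lambda>x. \<integral>\<^sup>+y. ?F x y \<partial>lborel) \<in> borel_measurable lborel" by measurable
      ultimately show ?thesis by (simp add: nn_integral_add nn_integral_sum)
    qed
    also have "(\<integral>\<^sup>+x. \<integral>\<^sup>+y. ?F x y \<partial>lborel \<partial>lborel) \<le> ennreal (c1 * (2 * V))"
    proof -
      let ?J = "\<integral>\<^sup>+x\<in>\<Omega>. ennreal (\<bar>u x\<bar> powr p) \<partial>lborel"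
      have "(\<integral>\<^sup>+y. ?F x y \<partial>lborel) = ennreal c1 * (ennreal (\<bar>u x\<bar> powr p) * indicator \<Omega> x * ennreal V + ?J * indicator \<Omega> x)" for x
        by (simp add: nn_integral_cmult nn_integral_add nn_integral_multc Ofin)
      hence "(\<integral>\<^sup>+x. \<integral>\<^sup>+y. ?F x y \<partial>lborel \<partial>lborel) = ennreal c1 * (?J * ennreal V + ?J * ennreal V)"
        by (simp add: nn_integral_cmult nn_integral_add nn_integral_multc Ofin)
      also have "\<dots> \<le> ennreal c1 * (1 * ennreal V + 1 * ennreal V)" by (intro mult_left_mono add_mono mult_right_mono J) auto
      also have "\<dots> = ennreal (c1 * (2 * V))"
        using c by (simp add: V_def ennreal_plus[symmetric] ennreal_mult[symmetric] del: ennreal_plus)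
      finally show ?thesis .
    qed
    also have "(\<Sum>i\<in>X. \<integral>\<^sup>+x. \<integral>\<^sup>+y. near i x (y - x) \<partial>lborel \<partial>lborel) \<le> (\<Sum>i\<in>X. ennreal (c2 * K0))"
      by (intro sum_mono near_total)
    also have "(\<Sum>i\<in>X. ennreal (c2 * K0)) = ennreal (real (card X) * (c2 * K0))"
      using c K0(1) by (subst sum_ennreal) auto
    also have "ennreal (c1 * (2 * V)) + ennreal (real (card X) * (c2 * K0)) = ennreal (c1 * (2 * V) + real (card X) * (c2 * K0))"
      using c K0(1) by (intro ennreal_plus[symmetric]) (auto simp: V_def)
    finally show ?thesis by (simp add: add_mono)
  qed
  moreover have "0 \<le> c1 * (2 * V) + real (card X) * (c2 * K0)" using c K0(1) by (simp add: V_def)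
  ultimately show ?thesis by blast
qed

end

section \<open>Borel representatives\<close>

text \<open>Integrability on each compact box inside \<open>\<Omega>\<close> gives measurability
  there, and countably many such boxes exhaust the open set.\<close>

lemma locally_integrable_measurable:
  fixes f :: "'a::euclidean_space \<Rightarrow> 'b::euclidean_space"
  assumes "open \<Omega>" and f: "locally_integrable \<Omega> f"
  shows "f \<in> borel_measurable (lebesgue_on \<Omega>)"
proof -
  obtain D where D: "countable D" "D \<subseteq> Pow \<Omega>" "\<And>X. X \<in> D \<Longrightarrow> \<exists>a b. X = cbox a b" "\<Union>D = \<Omega>"
    using open_countable_Union_open_cbox[OF assms(1)] by metis
  show ?thesis
  proof (rule measurable_piecewise_restrict[OF D(1)])
    show "space (lebesgue_on \<Omega>) \<subseteq> \<Union>D" using D(4) by simp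
    fix X assume X: "X \<in> D"
    then obtain a b where ab: "X = cbox a b" using D(3) by blast
    have XO: "X \<subseteq> \<Omega>" using D(2) X by blast
    have "f absolutely_integrable_on X" using f XO by (auto simp: locally_integrable_def ab)
    hence "f \<in> borel_measurable (lebesgue_on X)"
      using absolutely_integrable_measurable[of X f] by (simp add: ab)
    moreover have "restrict_space (lebesgue_on \<Omega>) X = lebesgue_on X"
      using XO assms(1) by (subst restrict_restrict_space) (auto simp: ab Int_absorb1)
    ultimately show "f \<in> borel_measurable (restrict_space (lebesgue_on \<Omega>) X)" by simp
    show "X \<inter> space (lebesgue_on \<Omega>) \<in> sets (lebesgue_on \<Omega>)"
      using XO by (auto simp: sets_restrict_space ab Int_absorb1 intro!: image_eqI[of _ _ X])
  qed
qed

lemma lebesgue_on_borel_representative: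
  fixes u :: "'a::euclidean_space \<Rightarrow> real"
  assumes "open \<Omega>" "u \<in> borel_measurable (lebesgue_on \<Omega>)"
  shows "\<exists>v\<in>borel_measurable borel. AE x in lborel. v x = (if x \<in> \<Omega> then u x else 0)"
proof -
  have "(\<lambda>x. if x \<in> \<Omega> then u x else 0) \<in> borel_measurable lebesgue"
    using assms by (intro borel_measurable_if_I) auto
  from completion_ex_borel_measurable_real[OF this] obtain v where "v \<in> borel_measurable lborel"
     "AE x in lborel. (if x \<in> \<Omega> then u x else 0) = v x" by blast
  thus ?thesis by (intro bexI[of _ v]) (auto elim!: eventually_mono)
qed

lemma AE_lborel_lebesgue_on:
  assumes "open \<Omega>" "AE x in lborel. x \<in> \<Omega> \<longrightarrow> P x"
  shows "AE x in lebesgue_on \<Omega>. P x"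
  using assms AE_completion[OF assms(2)] by (subst AE_restrict_space_iff) auto

lemma nn_integral_lebesgue_on_lborel:
  assumes "open \<Omega>"
  shows "(\<integral>\<^sup>+x. f x \<partial>lebesgue_on \<Omega>) = (\<integral>\<^sup>+x\<in>\<Omega>. f x \<partial>lborel)"
  using assms by (subst nn_integral_restrict_space) (auto simp: nn_integral_completion)

text \<open>The representatives agree almost everywhere with the extensions by 0, so integrals
  against test functions do not change. The gradient is treated coordinatewise because
  \<open>lebesgue_on_borel_representative\<close> concerns real functions.\<close>

lemma borel_weak_gradient_exists:
  fixes u :: "'a::euclidean_space \<Rightarrow> real"
  assumes \<Omega>: "open \<Omega>" and wg: "has_weak_gradient \<Omega> u g"
  shows "\<exists>v h. borel_weak_gradient \<Omega> v h \<and> (AE x in lebesgue_on \<Omega>. u x = v x \<and> g x = h x)"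
proof -
  have lu: "locally_integrable \<Omega> u" and lg: "locally_integrable \<Omega> g" using wg by (auto simp: has_weak_gradient_def)
  have um: "u \<in> borel_measurable (lebesgue_on \<Omega>)" and gm[measurable]: "g \<in> borel_measurable (lebesgue_on \<Omega>)"
    using lu lg by (auto intro!: locally_integrable_measurable \<Omega>)
  from lebesgue_on_borel_representative[OF \<Omega> um] obtain v where v[measurable]: "v \<in> borel_measurable borel"
    and vAE: "AE x in lborel. v x = (if x \<in> \<Omega> then u x else 0)" by blast
  have "\<forall>b. \<exists>h. h \<in> borel_measurable borel \<and> (AE x in lborel. h x = (if x \<in> \<Omega> then g x \<bullet> b else 0))"
  proof
    fix b
    have "(\<lambda>x. g x \<bullet> b) \<in> borel_measurable (lebesgue_on \<Omega>)" by measurable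
    from lebesgue_on_borel_representative[OF \<Omega> this]
    show "\<exists>h. h \<in> borel_measurable borel \<and> (AE x in lborel. h x = (if x \<in> \<Omega> then g x \<bullet> b else 0))" by blast
  qed
  from choice[OF this] obtain hb where
    *: "\<forall>b. hb b \<in> borel_measurable borel \<and> (AE x in lborel. hb b x = (if x \<in> \<Omega> then g x \<bullet> b else 0))" ..
  have hb[measurable]: "hb b \<in> borel_measurable borel"
    and hbAE: "AE x in lborel. hb b x = (if x \<in> \<Omega> then g x \<bullet> b else 0)" for b
    using spec[OF *, of b] by simp_all
  define h where "h x = (\<Sum>b\<in>Basis. hb b x *\<^sub>R b)" for x
  have h[measurable]: "h \<in> borel_measurable borel" unfolding h_def by measurable
  have "AE x in lborel. \<forall>b\<in>Basis. hb b x = (if x \<in> \<Omega> then g x \<bullet> b else 0)"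
    using hbAE by (subst AE_ball_countable) (auto intro: countable_finite)
  hence hAE: "AE x in lborel. h x = (if x \<in> \<Omega> then g x else 0)"
  proof eventually_elim
    case (elim x)
    have "h x = (\<Sum>b\<in>Basis. (if x \<in> \<Omega> then g x \<bullet> b else 0) *\<^sub>R b)"
      unfolding h_def using elim by (intro sum.cong) auto
    thus ?case by (simp add: euclidean_representation)
  qed
  note AEc = AE_completion[OF vAE] AE_completion[OF hAE]
  have "borel_weak_gradient \<Omega> v h"
  proof
    fix K assume K: "compact K" "K \<subseteq> \<Omega>"
    have [measurable]: "K \<in> sets borel" using K(1) by (simp add: compact_imp_closed borel_closed)
    have i: "integrable lebesgue (\<lambda>x. indicator K x *\<^sub>R u x)" "integrable lebesgue (\<lambda>x. indicator K x *\<^sub>R g x)"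
      using lu lg K by (auto simp: locally_integrable_def set_integrable_def)
    have a1: "AE x in lebesgue. indicator K x *\<^sub>R u x = indicator K x * v x"
      using AEc(1) by eventually_elim (use K in \<open>auto simp: indicator_def\<close>)
    have a2: "AE x in lebesgue. indicator K x *\<^sub>R g x = indicator K x *\<^sub>R h x"
      using AEc(2) by eventually_elim (use K in \<open>auto simp: indicator_def\<close>)
    have m1: "(\<lambda>x. indicator K x * v x) \<in> borel_measurable lborel" and m2: "(\<lambda>x. indicator K x *\<^sub>R h x) \<in> borel_measurable lborel"
      by measurable
    show "integrable lborel (\<lambda>x. indicator K x * v x)"
      using integrable_cong_AE_imp[OF i(1) measurable_completion[OF m1] a1] by (simp only: integrable_completion[OF m1])
    show "integrable lborel (\<lambda>x. indicator K x *\<^sub>R h x)"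
      using integrable_cong_AE_imp[OF i(2) measurable_completion[OF m2] a2] by (simp only: integrable_completion[OF m2])
  next
    fix \<phi> b assume \<phi>: "test_function \<Omega> \<phi>" and b: "b \<in> (Basis :: 'a set)"
    have "Ck 0 \<phi>" "Ck (Suc 0) \<phi>" using \<phi> by (auto simp: test_function_def simp del: Ck.simps)
    hence [measurable]: "\<phi> \<in> borel_measurable borel" "partial_deriv b \<phi> \<in> borel_measurable borel"
      using b by (auto intro: borel_measurable_continuous_onI)
    have "(\<integral>x. v x * partial_deriv b \<phi> x \<partial>lborel) = (\<integral>x. v x * partial_deriv b \<phi> x \<partial>lebesgue)"
      by (subst integral_completion) auto
    also have "\<dots> = (\<integral>x. indicator \<Omega> x *\<^sub>R (u x * partial_deriv b \<phi> x) \<partial>lebesgue)"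
    proof (rule integral_cong_AE)
      show "AE x in lebesgue. v x * partial_deriv b \<phi> x = indicator \<Omega> x *\<^sub>R (u x * partial_deriv b \<phi> x)"
        using AEc(1) by eventually_elim (auto simp: indicator_def)
      have "(\<lambda>x. u x * partial_deriv b \<phi> x) \<in> borel_measurable (lebesgue_on \<Omega>)"
        using um by (intro borel_measurable_times) (auto intro!: measurable_restrict_space1 measurable_completion)
      thus "(\<lambda>x. indicator \<Omega> x *\<^sub>R (u x * partial_deriv b \<phi> x)) \<in> borel_measurable lebesgue"
        using \<Omega> by (subst (asm) borel_measurable_restrict_space_iff) auto
    qed (auto intro!: measurable_completion)
    also have "\<dots> = (\<integral>x. u x * partial_deriv b \<phi> x \<partial>lebesgue_on \<Omega>)"
      using \<Omega> by (subst integral_restrict_space) auto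
    also have "\<dots> = - (\<integral>x. (g x \<bullet> b) * \<phi> x \<partial>lebesgue_on \<Omega>)"
      using wg \<phi> b by (auto simp: has_weak_gradient_def)
    also have "(\<integral>x. (g x \<bullet> b) * \<phi> x \<partial>lebesgue_on \<Omega>) = (\<integral>x. indicator \<Omega> x *\<^sub>R ((g x \<bullet> b) * \<phi> x) \<partial>lebesgue)"
      using \<Omega> by (subst integral_restrict_space) auto
    also have "\<dots> = (\<integral>x. (h x \<bullet> b) * \<phi> x \<partial>lebesgue)"
    proof (rule integral_cong_AE)
      show "AE x in lebesgue. indicator \<Omega> x *\<^sub>R ((g x \<bullet> b) * \<phi> x) = (h x \<bullet> b) * \<phi> x"
        using AEc(2) by eventually_elim (auto simp: indicator_def)
      have "(\<lambda>x. (g x \<bullet> b) * \<phi> x) \<in> borel_measurable (lebesgue_on \<Omega>)"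
        by (intro borel_measurable_times) (auto intro!: measurable_restrict_space1 measurable_completion)
      thus "(\<lambda>x. indicator \<Omega> x *\<^sub>R ((g x \<bullet> b) * \<phi> x)) \<in> borel_measurable lebesgue"
        using \<Omega> by (subst (asm) borel_measurable_restrict_space_iff) auto
    qed (auto intro!: measurable_completion)
    also have "\<dots> = (\<integral>x. (h x \<bullet> b) * \<phi> x \<partial>lborel)" by (subst integral_completion) auto
    finally show "(\<integral>x. v x * partial_deriv b \<phi> x \<partial>lborel) = - (\<integral>x. (h x \<bullet> b) * \<phi> x \<partial>lborel)" .
  qed (use \<Omega> in auto)
  moreover have "AE x in lebesgue_on \<Omega>. u x = v x \<and> g x = h x"
    using vAE hAE by (intro AE_lborel_lebesgue_on[OF \<Omega>]) (auto elim!: eventually_elim2)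
  ultimately show ?thesis by blast
qed

lemma (in cone_cover) weak_gradient_energy_bound:
  fixes \<sigma> p :: real
  assumes p: "1 \<le> p" and \<sigma>: "0 < \<sigma>" "\<sigma> < 1"
  shows "\<exists>K\<ge>0. \<forall>u g. has_weak_gradient \<Omega> u g \<longrightarrow> pintegral (lebesgue_on \<Omega>) p u \<le> 1 \<longrightarrow>
    (\<integral>\<^sup>+x. ennreal (norm (g x) powr p) \<partial>lebesgue_on \<Omega>) \<le> 1 \<longrightarrow> energy (lebesgue_on \<Omega>) \<sigma> p u \<le> ennreal K"
proof -
  from gradient_energy_bound[OF p \<sigma>] obtain K where K: "0 \<le> K"
    "\<And>u g. borel_weak_gradient \<Omega> u g \<Longrightarrow>
    (\<integral>\<^sup>+x\<in>\<Omega>. ennreal (\<bar>u x\<bar> powr p) \<partial>lborel) \<le> 1 \<Longrightarrow> (\<integral>\<^sup>+x\<in>\<Omega>. ennreal (norm (g x) powr p) \<partial>lborel) \<le> 1 \<Longrightarrow>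
    (\<integral>\<^sup>+x\<in>\<Omega>. (\<integral>\<^sup>+y\<in>\<Omega>. diff_quot \<sigma> p u x y \<partial>lborel) \<partial>lborel) \<le> ennreal K" by blast
  have "energy (lebesgue_on \<Omega>) \<sigma> p u \<le> ennreal K" if wg: "has_weak_gradient \<Omega> u g"
    and J: "pintegral (lebesgue_on \<Omega>) p u \<le> 1" and G: "(\<integral>\<^sup>+x. ennreal (norm (g x) powr p) \<partial>lebesgue_on \<Omega>) \<le> 1" for u g
  proof -
    obtain v h where vh: "borel_weak_gradient \<Omega> v h" and ae: "AE x in lebesgue_on \<Omega>. u x = v x \<and> g x = h x"
      using borel_weak_gradient_exists[OF \<Omega>(1) wg] by blast
    note leb = nn_integral_lebesgue_on_lborel[OF \<Omega>(1), symmetric]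
    have "(\<integral>\<^sup>+x. ennreal (\<bar>v x\<bar> powr p) \<partial>lebesgue_on \<Omega>) = pintegral (lebesgue_on \<Omega>) p u"
      unfolding pintegral_def by (rule nn_integral_cong_AE) (use ae in \<open>eventually_elim, simp\<close>)
    moreover have "(\<integral>\<^sup>+x. ennreal (norm (h x) powr p) \<partial>lebesgue_on \<Omega>) = (\<integral>\<^sup>+x. ennreal (norm (g x) powr p) \<partial>lebesgue_on \<Omega>)"
      by (rule nn_integral_cong_AE) (use ae in \<open>eventually_elim, simp\<close>)
    ultimately have "(\<integral>\<^sup>+x. (\<integral>\<^sup>+y. diff_quot \<sigma> p v x y \<partial>lebesgue_on \<Omega>) \<partial>lebesgue_on \<Omega>) \<le> ennreal K"
      using K(2)[OF vh] J G unfolding leb by simp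
    moreover have "energy (lebesgue_on \<Omega>) \<sigma> p u = (\<integral>\<^sup>+x. (\<integral>\<^sup>+y. diff_quot \<sigma> p v x y \<partial>lebesgue_on \<Omega>) \<partial>lebesgue_on \<Omega>)"
      unfolding energy_def
    proof (rule nn_integral_cong_AE, use ae in eventually_elim)
      fix x assume x: "u x = v x \<and> g x = h x"
      show "(\<integral>\<^sup>+y. diff_quot \<sigma> p u x y \<partial>lebesgue_on \<Omega>) = (\<integral>\<^sup>+y. diff_quot \<sigma> p v x y \<partial>lebesgue_on \<Omega>)"
        by (rule nn_integral_cong_AE, use ae in eventually_elim) (simp add: diff_quot_def x)
    qed
    ultimately show ?thesis by simp
  qed
  thus ?thesis using K(1) by blast
qed

section \<open>Sobolev norms and compact embeddings\<close>

lemma ennpowr_ennreal: "0 \<le> a \<Longrightarrow> ennpowr (ennreal a) b = ennreal (a powr b)"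
  by (simp add: ennpowr_def)

lemma ennpowr_less_top_iff [simp]: "ennpowr x a < top \<longleftrightarrow> x < top"
  by (auto simp: ennpowr_def less_top)

lemma ennpowr_mono:
  assumes "0 \<le> a" "x \<le> y"
  shows "ennpowr x a \<le> ennpowr y a"
proof (cases "y = \<infinity>")
  case False
  hence "x \<noteq> \<infinity>" "y < \<infinity>" using assms(2) by (auto simp: less_top[symmetric] top_unique)
  thus ?thesis using assms unfolding ennpowr_def
    by (auto intro!: ennreal_leI powr_mono2 enn2real_mono)
qed (simp add: ennpowr_def)

lemma ennpowr_root: "0 < p \<Longrightarrow> ennpowr (ennpowr x (1 / p)) p = x"
  by (cases x) (auto simp: ennpowr_def powr_powr)

lemma ennpowr_mult_ennreal:
  assumes "0 < q"
  shows "ennpowr (ennreal (\<bar>a\<bar> powr q) * x) (1 / q) = ennreal \<bar>a\<bar> * ennpowr x (1 / q)"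
proof (cases "x = \<infinity>")
  case True
  thus ?thesis using assms by (cases "a = 0") (auto simp: ennpowr_def ennreal_mult_top)
next
  case False
  then obtain r where r: "x = ennreal r" "0 \<le> r" by (cases x) auto
  have "ennpowr (ennreal (\<bar>a\<bar> powr q) * x) (1 / q) = ennreal ((\<bar>a\<bar> powr q * r) powr (1 / q))"
    using r by (simp add: ennreal_mult[symmetric] ennpowr_ennreal)
  also have "(\<bar>a\<bar> powr q * r) powr (1 / q) = \<bar>a\<bar> * r powr (1 / q)"
    using r assms by (simp add: powr_mult powr_powr)
  finally show ?thesis using r by (simp add: ennreal_mult ennpowr_ennreal)
qed

lemma ennpowr_tendsto_0:
  assumes x: "x \<longlonglongrightarrow> (0::ennreal)" and a: "0 < a"
  shows "(\<lambda>k. ennpowr (x k) a) \<longlonglongrightarrow> 0"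
proof -
  have fin: "eventually (\<lambda>k. x k < 1) sequentially" using x by (rule order_tendstoD) simp
  have "(\<lambda>k. enn2real (x k)) \<longlonglongrightarrow> enn2real 0" using x by (intro tendsto_enn2real) auto
  hence "(\<lambda>k. enn2real (x k) powr a) \<longlonglongrightarrow> 0 powr a"
    using a by (intro tendsto_powr' tendsto_const) auto
  hence "(\<lambda>k. ennreal (enn2real (x k) powr a)) \<longlonglongrightarrow> ennreal 0" using a by (intro tendsto_ennrealI) simp
  moreover have "eventually (\<lambda>k. ennreal (enn2real (x k) powr a) = ennpowr (x k) a) sequentially"
    using fin by eventually_elim (auto simp: ennpowr_def)
  ultimately show ?thesis by (auto intro: Lim_transform_eventually)
qed

text \<open>Both Gamma arguments are positive: \<open>p * s > 0\<close> and p + N \<ge> 2 for the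
  numerator, s < 1 for the denominator.\<close>

lemma gagliardo_const_pos:
  assumes "0 < s" "s < 1" "1 \<le> p" "0 < N"
  shows "0 < gagliardo_const N s p"
proof -
  have "0 < p * s" using assms by simp
  moreover have "1 \<le> real N" using assms by simp
  ultimately have "0 < p * s + p + real N - 2" using assms(3) by linarith
  hence "0 < (p * s + p + real N - 2) / 2" by simp
  thus ?thesis using assms unfolding gagliardo_const_def by (auto intro!: divide_pos_pos mult_pos_pos Gamma_real_pos)
qed

lemma pintegral_cmult:
  assumes [measurable]: "u \<in> borel_measurable M"
  shows "pintegral M q (\<lambda>x. a * u x) = ennreal (\<bar>a\<bar> powr q) * pintegral M q u"
  unfolding pintegral_def by (subst nn_integral_cmult[symmetric]) (auto simp: abs_mult powr_mult ennreal_mult)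

lemma (in regular_measure) energy_cmult:
  assumes [measurable]: "u \<in> borel_measurable M"
  shows "energy M s q (\<lambda>x. a * u x) = ennreal (\<bar>a\<bar> powr q) * energy M s q u"
proof -
  have "diff_quot s q (\<lambda>x. a * u x) x y = ennreal (\<bar>a\<bar> powr q) * diff_quot s q u x y" for x y
    unfolding diff_quot_def
    by (simp add: right_diff_distrib[symmetric] abs_mult powr_mult ennreal_mult[symmetric])
  thus ?thesis unfolding energy_def by (simp add: nn_integral_cmult cong: nn_integral_cong)
qed

lemma has_weak_gradient_cmult:
  assumes wg: "has_weak_gradient \<Omega> u g"
  shows "has_weak_gradient \<Omega> (\<lambda>x. a * u x) (\<lambda>x. a *\<^sub>R g x)"
  unfolding has_weak_gradient_def
proof (intro conjI allI impI)
  have lu: "locally_integrable \<Omega> u" and lg: "locally_integrable \<Omega> g" using wg by (auto simp: has_weak_gradient_def)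
  show "locally_integrable \<Omega> (\<lambda>x. a * u x)"
    using lu by (auto simp: locally_integrable_def intro: set_integrable_mult_right)
  show "locally_integrable \<Omega> (\<lambda>x. a *\<^sub>R g x)"
    using lg by (auto simp: locally_integrable_def intro: set_integrable_scaleR_right)
  fix \<phi> b assume "test_function \<Omega> \<phi>" "b \<in> (Basis :: 'a set)"
  thus "(\<integral>x. a * u x * partial_deriv b \<phi> x \<partial>lebesgue_on \<Omega>) = - (\<integral>x. a *\<^sub>R g x \<bullet> b * \<phi> x \<partial>lebesgue_on \<Omega>)"
    using wg by (simp add: has_weak_gradient_def mult.assoc)
qed

text \<open>\<open>P\<close> plays the role of a ball of \<open>X\<close>. The scaling is applied to functions rather than to the norm of
  \<open>X\<close>, because the norm of order one contains an unspecified choice of the weak gradient.\<close>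

lemma compactly_embedded_criterion:
  fixes X Y :: "('a \<Rightarrow> real) set"
  assumes c: "0 < c" and K: "0 \<le> K"
    and fin: "\<And>u. u \<in> X \<Longrightarrow> nX u < \<infinity>"
    and ball: "\<And>u m. u \<in> X \<Longrightarrow> 0 < m \<Longrightarrow> nX u \<le> ennreal m \<Longrightarrow> P (\<lambda>x. inverse (c * m) * u x)"
    and PY: "\<And>u. P u \<Longrightarrow> u \<in> Y \<and> nY u \<le> ennreal K"
    and S: "\<And>u. P u \<Longrightarrow> u \<in> S" "\<And>u v. u \<in> S \<Longrightarrow> v \<in> S \<Longrightarrow> (\<lambda>x. u x - v x) \<in> S"
    and scaleY: "\<And>u a. u \<in> Y \<Longrightarrow> (\<lambda>x. a * u x) \<in> Y"
    and scale: "\<And>u a. u \<in> S \<Longrightarrow> nY (\<lambda>x. a * u x) = ennreal \<bar>a\<bar> * nY u"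
    and compact: "\<And>u. (\<And>n. P (u n)) \<Longrightarrow> \<exists>r v. strict_mono (r :: nat \<Rightarrow> nat) \<and> P v \<and> (\<lambda>k. nY (\<lambda>x. u (r k) x - v x)) \<longlonglongrightarrow> 0"
  shows "compactly_embedded X nX Y nY"
proof -
  have unscale: "(\<lambda>x. (c * m) * (inverse (c * m) * u x)) = u" if "0 < m" for m and u :: "'a \<Rightarrow> real"
    using that c by (auto simp: fun_eq_iff field_simps)
  have bound: "u \<in> Y \<and> nY u \<le> ennreal (c * K * m)" if u: "u \<in> X" "0 < m" "nX u \<le> ennreal m" for u m
  proof
    note P = ball[OF u]
    show "u \<in> Y" using scaleY[of "\<lambda>x. inverse (c * m) * u x" "c * m"] PY[OF P] unfolding unscale[OF u(2)] by blast
    have "nY u = ennreal \<bar>c * m\<bar> * nY (\<lambda>x. inverse (c * m) * u x)"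
      using scale[OF S(1)[OF P], of "c * m"] unfolding unscale[OF u(2)] .
    also have "\<dots> \<le> ennreal \<bar>c * m\<bar> * ennreal K" using PY[OF P] by (intro mult_left_mono) auto
    also have "\<dots> = ennreal (c * K * m)" using c K u by (simp add: ennreal_mult[symmetric] mult_ac)
    finally show "nY u \<le> ennreal (c * K * m)" .
  qed
  have norm_le: "nY u \<le> ennreal (c * K) * nX u" if u: "u \<in> X" for u
  proof -
    obtain a where a: "nX u = ennreal a" "0 \<le> a" using fin[OF u] by (cases "nX u") auto
    \<comment> \<open>\<open>ball\<close> asks for a positive radius although the norm
      \<open>a\<close> may be 0. The radius a + 1 only shows that \<open>nY u\<close> is finite; the
      radii a + d with small d then give the constant \<open>c * K\<close>.\<close>
    have "nY u \<le> ennreal (c * K * (a + 1))" using bound[OF u, of "a + 1"] a by (auto intro: ennreal_leI)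
    then obtain y where y: "nY u = ennreal y" "0 \<le> y" by (cases "nY u") (auto simp: top_unique)
    have "y \<le> c * K * a"
    proof (rule field_le_epsilon)
      fix e :: real assume e: "0 < e"
      define d where "d = e / (c * K + 1)"
      have cK: "0 \<le> c * K" using c K by simp
      have d: "0 < d" using e cK by (auto simp: d_def)
      have "nY u \<le> ennreal (c * K * (a + d))" using bound[OF u, of "a + d"] a d by (auto intro: ennreal_leI)
      hence "y \<le> c * K * (a + d)" using y a d cK by (simp add: ennreal_le_iff)
      also have "\<dots> = c * K * a + c * K * d" by (simp add: distrib_left)
      also have "c * K * d \<le> (c * K + 1) * d" using d by simp
      also have "(c * K + 1) * d = e" using cK by (simp add: d_def)
      finally show "y \<le> c * K * a + e" by simp
    qed
    thus ?thesis unfolding a y using a c K by (simp add: ennreal_mult[symmetric] ennreal_leI)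
  qed
  have seq: "\<exists>v\<in>Y. \<exists>r. strict_mono (r :: nat \<Rightarrow> nat) \<and> (\<lambda>k. nY (\<lambda>x. u (r k) x - v x)) \<longlonglongrightarrow> 0"
    if u: "\<And>n. u n \<in> X \<and> nX (u n) \<le> ennreal M" for u :: "nat \<Rightarrow> 'a \<Rightarrow> real" and M
  proof -
    define m where "m = max M 1"
    have m: "0 < m" by (simp add: m_def)
    have P: "P (\<lambda>x. inverse (c * m) * u n x)" for n
    proof (rule ball[OF _ m])
      show "nX (u n) \<le> ennreal m" using u[of n] by (auto simp: m_def intro: order_trans ennreal_leI)
    qed (use u in auto)
    obtain r v where r: "strict_mono r" and v: "P v"
      and lim: "(\<lambda>k. nY (\<lambda>x. inverse (c * m) * u (r k) x - v x)) \<longlonglongrightarrow> 0"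
      using compact[of "\<lambda>n x. inverse (c * m) * u n x", OF P] by blast
    have eq: "nY (\<lambda>x. u (r k) x - c * m * v x) = ennreal \<bar>c * m\<bar> * nY (\<lambda>x. inverse (c * m) * u (r k) x - v x)" for k
    proof -
      have "(\<lambda>x. u (r k) x - c * m * v x) = (\<lambda>x. c * m * (inverse (c * m) * u (r k) x - v x))"
        using c m by (auto simp: fun_eq_iff field_simps)
      thus ?thesis using scale[OF S(2)[OF S(1)[OF P] S(1)[OF v]], of "c * m"] by simp
    qed
    have "(\<lambda>k. ennreal \<bar>c * m\<bar> * nY (\<lambda>x. inverse (c * m) * u (r k) x - v x)) \<longlonglongrightarrow> ennreal \<bar>c * m\<bar> * 0"
      by (intro ennreal_tendsto_cmult lim) auto
    hence "(\<lambda>k. nY (\<lambda>x. u (r k) x - c * m * v x)) \<longlonglongrightarrow> 0" unfolding eq by simp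
    moreover have "(\<lambda>x. c * m * v x) \<in> Y" using PY[OF v] by (intro scaleY) blast
    ultimately show ?thesis using r by (intro bexI[of _ "\<lambda>x. c * m * v x"] exI[of _ r] conjI)
  qed
  have "X \<subseteq> Y"
  proof
    fix u assume u: "u \<in> X"
    obtain a where a: "nX u = ennreal a" "0 \<le> a" using fin[OF u] by (cases "nX u") auto
    show "u \<in> Y" using bound[OF u, of "a + 1"] a by (auto intro: ennreal_leI)
  qed
  thus ?thesis unfolding compactly_embedded_def using norm_le seq by blast
qed

context cone_cover
begin

abbreviation M where "M \<equiv> lebesgue_on \<Omega>"

lemma Lp_norm_eq: "Lp_norm p \<Omega> u = ennpowr (pintegral M p u) (1 / p)" for u :: "'a \<Rightarrow> real"
  by (simp add: Lp_norm_def pintegral_def)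

lemma gagliardo_seminorm_eq:
  assumes u: "u \<in> borel_measurable M"
  shows "gagliardo_seminorm s p \<Omega> u = ennpowr (ennreal (gagliardo_const DIM('a) s p) * energy M s p u) (1 / p)"
proof -
  obtain c C R where "regular_measure M c C R" using regular_measure_lebesgue_on by blast
  then interpret regular_measure M c C R .
  show ?thesis unfolding gagliardo_seminorm_def energy_eq_pair_integral[OF u] diff_quot_def by (simp add: split_beta')
qed

lemma sobolev_fractional:
  assumes s: "0 < s" "s < 1" and p: "1 \<le> p" and u: "u \<in> borel_measurable M"
  shows "sobolev_norm s p \<Omega> u = ennpowr (ennreal (gagliardo_const DIM('a) s p) * energy M s p u + pintegral M p u) (1 / p)"
    and "u \<in> sobolev_space s p \<Omega> \<longleftrightarrow> energy M s p u < \<infinity> \<and> pintegral M p u < \<infinity>"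
proof -
  have k: "0 < gagliardo_const DIM('a) s p" using s p by (intro gagliardo_const_pos) auto
  show "sobolev_norm s p \<Omega> u = ennpowr (ennreal (gagliardo_const DIM('a) s p) * energy M s p u + pintegral M p u) (1 / p)"
    using s p by (simp add: sobolev_norm_def sobolev_seminorm_def gagliardo_seminorm_eq[OF u] Lp_norm_eq ennpowr_root)
  show "u \<in> sobolev_space s p \<Omega> \<longleftrightarrow> energy M s p u < \<infinity> \<and> pintegral M p u < \<infinity>"
    using s p u k by (auto simp: sobolev_space_def Lp_space_def sobolev_seminorm_def gagliardo_seminorm_eq[OF u] Lp_norm_eq
       ennreal_mult_less_top)
qed

lemma sobolev_zero:
  assumes u: "u \<in> borel_measurable M"
  shows "sobolev_norm 0 p \<Omega> u = ennpowr (pintegral M p u) (1 / p)"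
    and "u \<in> sobolev_space 0 p \<Omega> \<longleftrightarrow> pintegral M p u < \<infinity>"
  using u by (auto simp: sobolev_norm_def Lp_norm_eq sobolev_space_def Lp_space_def sobolev_seminorm_def)

lemma sobolev_space_measurable: "u \<in> sobolev_space s p \<Omega> \<Longrightarrow> u \<in> borel_measurable M"
  by (simp add: sobolev_space_def Lp_space_def)

end

lemma scaled_powr_le_1:
  assumes m: "0 < m" and c: "0 < c" and x: "x \<le> ennreal (A * m powr p)" and A: "0 \<le> A" "A \<le> c powr p"
  shows "ennreal (\<bar>inverse (c * m)\<bar> powr p) * x \<le> 1"
proof -
  have "\<bar>inverse (c * m)\<bar> powr p = inverse (c powr p * m powr p)"
    using m c by (simp add: powr_mult inverse_powr[symmetric] powr_minus[symmetric] abs_mult)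
  hence "ennreal (\<bar>inverse (c * m)\<bar> powr p) * x \<le> ennreal (inverse (c powr p * m powr p)) * ennreal (A * m powr p)"
    using x by (auto intro!: mult_left_mono)
  also have "\<dots> = ennreal (A / c powr p)" using m c A by (simp add: ennreal_mult[symmetric] field_simps)
  also have "\<dots> \<le> ennreal 1" using A c by (intro ennreal_leI) simp
  finally show ?thesis by simp
qed

section \<open>Source norms reduced to unit balls of fractional energy\<close>

context cone_cover
begin

text \<open>The interface between source and target: a source norm enters only through the fact that
  its rescaled balls land in this set. For order one, \<open>s\<close> is an auxiliary order below
  one.\<close>

definition unit_energy_ball :: "real \<Rightarrow> real \<Rightarrow> ('a \<Rightarrow> real) set" where
  "unit_energy_ball s p = {u \<in> borel_measurable M. pintegral M p u \<le> 1 \<and> energy M s p u \<le> 1}"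

text \<open>Each summand of the p-th power of the norm is at most m^p. The value c^p = 1 + 1 / k
  dominates 1 for the L^p part and 1 / k, the inverse Gagliardo constant, for the energy.\<close>

lemma fractional_ball:
  assumes s: "0 < s" "s < 1" and p: "1 \<le> p"
  shows "\<exists>c>0. \<forall>u m. u \<in> sobolev_space s p \<Omega> \<longrightarrow> 0 < m \<longrightarrow> sobolev_norm s p \<Omega> u \<le> ennreal m \<longrightarrow>
    (\<lambda>x. inverse (c * m) * u x) \<in> unit_energy_ball s p"
proof -
  define k where "k = gagliardo_const DIM('a) s p"
  have k: "0 < k" using s p unfolding k_def by (intro gagliardo_const_pos) auto
  define c where "c = (1 + 1 / k) powr (1 / p)"
  have "0 < 1 + 1 / k" using k by (intro add_pos_pos) auto
  hence cp: "c powr p = 1 + 1 / k" "0 < c" using p by (auto simp: c_def powr_powr)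
  have "(\<lambda>x. inverse (c * m) * u x) \<in> unit_energy_ball s p"
    if us: "u \<in> sobolev_space s p \<Omega>" and m: "0 < m" and le: "sobolev_norm s p \<Omega> u \<le> ennreal m" for u m
  proof -
    obtain c0 C R where "regular_measure M c0 C R" using regular_measure_lebesgue_on by blast
    then interpret regular_measure M c0 C R .
    have u[measurable]: "u \<in> borel_measurable M" using us by (rule sobolev_space_measurable)
    have "ennreal k * energy M s p u + pintegral M p u = ennpowr (sobolev_norm s p \<Omega> u) p"
      using p by (simp add: sobolev_fractional(1)[OF s p u] k_def ennpowr_root)
    also have "\<dots> \<le> ennpowr (ennreal m) p" using p by (intro ennpowr_mono le) auto
    also have "\<dots> = ennreal (m powr p)" using m by (simp add: ennpowr_ennreal)
    finally have sum: "ennreal k * energy M s p u + pintegral M p u \<le> ennreal (m powr p)" .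
    have J: "pintegral M p u \<le> ennreal (1 * m powr p)" using order_trans[OF _ sum] by simp
    have "ennreal (1 / k) * (ennreal k * energy M s p u) \<le> ennreal (1 / k) * ennreal (m powr p)"
      using order_trans[OF _ sum] by (intro mult_left_mono) auto
    hence E: "energy M s p u \<le> ennreal (1 / k * m powr p)"
      using k by (simp add: mult.assoc[symmetric] ennreal_mult[symmetric])
    show ?thesis unfolding unit_energy_ball_def
      using scaled_powr_le_1[OF m cp(2) J] scaled_powr_le_1[OF m cp(2) E] k cp(1)
      by (simp add: pintegral_cmult energy_cmult)
  qed
  thus ?thesis using cp(2) by blast
qed

text \<open>Two normalisations: division by m brings function and gradient into the unit ball, where
  the energy is at most \<open>K\<close>; division by c with c^p = 1 + K brings the energy below
  one.\<close>

lemma gradient_ball: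
  assumes s: "0 < s" "s < 1" and p: "1 \<le> p"
  shows "\<exists>c>0. \<forall>u m. u \<in> sobolev_space 1 p \<Omega> \<longrightarrow> 0 < m \<longrightarrow> sobolev_norm 1 p \<Omega> u \<le> ennreal m \<longrightarrow>
    (\<lambda>x. inverse (c * m) * u x) \<in> unit_energy_ball s p"
proof -
  from weak_gradient_energy_bound[OF p s] obtain K where K: "0 \<le> K"
    "\<And>u g. has_weak_gradient \<Omega> u g \<Longrightarrow> pintegral M p u \<le> 1 \<Longrightarrow>
    (\<integral>\<^sup>+x. ennreal (norm (g x) powr p) \<partial>M) \<le> 1 \<Longrightarrow> energy M s p u \<le> ennreal K" by blast
  define c where "c = (1 + K) powr (1 / p)"
  have cp: "c powr p = 1 + K" "0 < c" using K p by (auto simp: c_def powr_powr)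
  have "(\<lambda>x. inverse (c * m) * u x) \<in> unit_energy_ball s p"
    if us: "u \<in> sobolev_space 1 p \<Omega>" and m: "0 < m" and le: "sobolev_norm 1 p \<Omega> u \<le> ennreal m" for u m
  proof -
    obtain c0 C R where "regular_measure M c0 C R" using regular_measure_lebesgue_on by blast
    then interpret regular_measure M c0 C R .
    have u[measurable]: "u \<in> borel_measurable M" using us by (rule sobolev_space_measurable)
    have ex: "\<exists>g. has_weak_gradient \<Omega> u g"
      using us by (auto simp: sobolev_space_def sobolev_seminorm_def split: if_splits)
    define g where "g = weak_gradient \<Omega> u"
    \<comment> \<open>The gradient has to be the one selected by \<open>weak_gradient\<close>, since
      it is the one whose norm occurs in \<open>sobolev_norm\<close>.\<close>
    have g: "has_weak_gradient \<Omega> u g" unfolding g_def weak_gradient_def using ex by (rule someI_ex)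
    have gm[measurable]: "g \<in> borel_measurable M"
      using g \<Omega>(1) by (intro locally_integrable_measurable) (auto simp: has_weak_gradient_def)
    let ?G = "\<integral>\<^sup>+x. ennreal (norm (g x) powr p) \<partial>M"
    have "?G + pintegral M p u = ennpowr (sobolev_norm 1 p \<Omega> u) p"
      using p ex by (simp add: sobolev_norm_def sobolev_seminorm_def g_def[symmetric] Lp_norm_def pintegral_def ennpowr_root)
    also have "\<dots> \<le> ennpowr (ennreal m) p" using p by (intro ennpowr_mono le) auto
    also have "\<dots> = ennreal (m powr p)" using m by (simp add: ennpowr_ennreal)
    finally have sum: "?G + pintegral M p u \<le> ennreal (m powr p)" .
    have J: "pintegral M p u \<le> ennreal (1 * m powr p)" and G: "?G \<le> ennreal (1 * m powr p)"
      using order_trans[OF _ sum] by simp_all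
    have J1: "pintegral M p (\<lambda>x. inverse m * u x) \<le> 1"
      using scaled_powr_le_1[OF m zero_less_one J] by (simp add: pintegral_cmult)
    have "(\<integral>\<^sup>+x. ennreal (norm (inverse m *\<^sub>R g x) powr p) \<partial>M) = ennreal (\<bar>inverse m\<bar> powr p) * ?G"
      by (subst nn_integral_cmult[symmetric]) (auto simp: powr_mult ennreal_mult)
    hence G1: "(\<integral>\<^sup>+x. ennreal (norm (inverse m *\<^sub>R g x) powr p) \<partial>M) \<le> 1"
      using scaled_powr_le_1[OF m zero_less_one G] by simp
    have E1: "energy M s p (\<lambda>x. inverse m * u x) \<le> ennreal (K * 1 powr p)"
      using K(2)[OF has_weak_gradient_cmult[OF g] J1 G1] by simp
    have eq: "(\<lambda>x. inverse (c * m) * u x) = (\<lambda>x. inverse (c * 1) * (inverse m * u x))"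
      by (auto simp: fun_eq_iff)
    have "pintegral M p (\<lambda>x. inverse (c * m) * u x) \<le> 1"
      using scaled_powr_le_1[OF m cp(2) J] K cp(1) by (simp add: pintegral_cmult)
    moreover have "energy M s p (\<lambda>x. inverse (c * m) * u x) \<le> 1"
      unfolding eq using scaled_powr_le_1[OF zero_less_one cp(2) E1] K(1) cp(1) by (subst energy_cmult) auto
    ultimately show ?thesis unfolding unit_energy_ball_def by simp
  qed
  thus ?thesis using cp(2) by blast
qed

lemma compactly_embedded_if_unit_energy_ball:
  fixes p q s s' :: real and nZ :: "('a \<Rightarrow> real) \<Rightarrow> ennreal"
  assumes p: "1 \<le> p" "1 \<le> q" and s: "s * p < DIM('a)" "0 \<le> s'" "s' < s" "s < 1"
    and sub: "real DIM('a) / p - s < real DIM('a) / q - s'"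
    and fin: "\<And>u. u \<in> Z \<Longrightarrow> nZ u < \<infinity>"
    and ball: "\<exists>c>0. \<forall>u m. u \<in> Z \<longrightarrow> 0 < m \<longrightarrow> nZ u \<le> ennreal m \<longrightarrow> (\<lambda>x. inverse (c * m) * u x) \<in> unit_energy_ball s p"
  shows "compactly_embedded Z nZ (sobolev_space s' q \<Omega>) (sobolev_norm s' q \<Omega>)"
proof -
  obtain c0 C R where "regular_measure M c0 C R" using regular_measure_lebesgue_on by blast
  then interpret regular_measure M c0 C R .
  from ball obtain c where c: "0 < c"
    "\<And>u m. u \<in> Z \<Longrightarrow> 0 < m \<Longrightarrow> nZ u \<le> ennreal m \<Longrightarrow> (\<lambda>x. inverse (c * m) * u x) \<in> unit_energy_ball s p" by blast
  define b where "b = min (s / 2) ((real DIM('a) / q - s' - (real DIM('a) / p - s)) / 2)"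
  have b: "b \<le> s / 2" "b \<le> (real DIM('a) / q - s' - (real DIM('a) / p - s)) / 2" "0 < b"
    unfolding b_def by (rule min.cobounded1, rule min.cobounded2) (use s sub in simp)
  \<comment> \<open>\<open>energy_embedding\<close> requires a positive target order. For order 0 it
    is applied with the small order \<open>b\<close>, which costs at most half of the slack, and
    only its bound on \<open>pintegral\<close> enters.\<close>
  define s1 where "s1 = (if s' = 0 then b else s')"
  have s1: "0 < s1" "s1 < s" "real DIM('a) / p - s < real DIM('a) / q - s1" "s' \<noteq> 0 \<Longrightarrow> s1 = s'"
    using b s sub by (auto simp: s1_def)
  from energy_embedding[OF p s(1) s1(1-3)] obtain K where K: "0 \<le> K"
    "\<And>u. u \<in> borel_measurable M \<Longrightarrow> pintegral M p u \<le> 1 \<Longrightarrow> energy M s p u \<le> 1 \<Longrightarrow> energy M s1 q u \<le> ennreal K"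
    "\<And>u. u \<in> borel_measurable M \<Longrightarrow> pintegral M p u \<le> 1 \<Longrightarrow> energy M s p u \<le> 1 \<Longrightarrow> pintegral M q u \<le> ennreal K" by blast
  \<comment> \<open>With coefficient 0 the norm of order 0 obeys the same formula, even if the
    energy is infinite, so both cases share one proof.\<close>
  define k where "k = (if s' = 0 then 0 else gagliardo_const DIM('a) s' q)"
  have k: "0 \<le> k" using s p less_imp_le[OF gagliardo_const_pos[of s' q "DIM('a)"]] by (auto simp: k_def)
  have norm_eq: "sobolev_norm s' q \<Omega> u = ennpowr (ennreal k * energy M s' q u + pintegral M q u) (1 / q)"
    if "u \<in> borel_measurable M" for u
    using sobolev_fractional(1)[OF _ _ p(2) that, of s'] sobolev_zero(1)[OF that, of q] s by (cases "s' = 0") (auto simp: k_def)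
  have space_iff: "u \<in> sobolev_space s' q \<Omega> \<longleftrightarrow> (s' \<noteq> 0 \<longrightarrow> energy M s' q u < \<infinity>) \<and> pintegral M q u < \<infinity>"
    if "u \<in> borel_measurable M" for u
    using sobolev_fractional(2)[OF _ _ p(2) that, of s'] sobolev_zero(2)[OF that, of q] s by (cases "s' = 0") auto
  show ?thesis
  proof (rule compactly_embedded_criterion[where P = "\<lambda>u. u \<in> unit_energy_ball s p" and S = "borel_measurable M"
        and c = c and K = "((k + 1) * K) powr (1 / q)"])
    fix u assume "u \<in> unit_energy_ball s p"
    hence u: "u \<in> borel_measurable M" "pintegral M p u \<le> 1" "energy M s p u \<le> 1" by (auto simp: unit_energy_ball_def)
    have E: "ennreal k * energy M s' q u \<le> ennreal (k * K)"
    proof (cases "s' = 0")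
      case False
      thus ?thesis using K(2)[OF u] K(1) k s1(4) by (simp add: ennreal_mult mult_left_mono)
    qed (simp add: k_def)
    have "ennreal k * energy M s' q u + pintegral M q u \<le> ennreal (k * K) + ennreal K"
      by (intro add_mono E K(3) u)
    also have "\<dots> = ennreal ((k + 1) * K)" using k K(1) by (simp add: ennreal_plus[symmetric] algebra_simps del: ennreal_plus)
    finally have "sobolev_norm s' q \<Omega> u \<le> ennpowr (ennreal ((k + 1) * K)) (1 / q)"
      unfolding norm_eq[OF u(1)] using p by (intro ennpowr_mono) auto
    also have "\<dots> = ennreal (((k + 1) * K) powr (1 / q))" using k K(1) by (intro ennpowr_ennreal) auto
    finally have "sobolev_norm s' q \<Omega> u \<le> ennreal (((k + 1) * K) powr (1 / q))" .
    moreover have "u \<in> sobolev_space s' q \<Omega>"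
      using K(2,3)[OF u] s1(4) unfolding space_iff[OF u(1)] by (auto simp: less_top[symmetric] top_unique)
    ultimately show "u \<in> sobolev_space s' q \<Omega> \<and> sobolev_norm s' q \<Omega> u \<le> ennreal (((k + 1) * K) powr (1 / q))" by simp
  next
    fix u :: "'a \<Rightarrow> real" and a :: real assume uY: "u \<in> sobolev_space s' q \<Omega>"
    hence u[measurable]: "u \<in> borel_measurable M" by (rule sobolev_space_measurable)
    have "(\<lambda>x. a * u x) \<in> borel_measurable M" by measurable
    thus "(\<lambda>x. a * u x) \<in> sobolev_space s' q \<Omega>"
      using uY by (simp add: space_iff u pintegral_cmult energy_cmult ennreal_mult_less_top)
  next
    fix u :: "'a \<Rightarrow> real" and a :: real assume u[measurable]: "u \<in> borel_measurable M"
    have "(\<lambda>x. a * u x) \<in> borel_measurable M" by measurable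
    hence "sobolev_norm s' q \<Omega> (\<lambda>x. a * u x) = ennpowr (ennreal (\<bar>a\<bar> powr q) * (ennreal k * energy M s' q u + pintegral M q u)) (1 / q)"
      by (simp add: norm_eq pintegral_cmult energy_cmult distrib_left mult.left_commute)
    also have "\<dots> = ennreal \<bar>a\<bar> * sobolev_norm s' q \<Omega> u"
      using p by (simp add: ennpowr_mult_ennreal norm_eq u)
    finally show "sobolev_norm s' q \<Omega> (\<lambda>x. a * u x) = ennreal \<bar>a\<bar> * sobolev_norm s' q \<Omega> u" .
  next
    fix u :: "nat \<Rightarrow> 'a \<Rightarrow> real" assume "\<And>n. u n \<in> unit_energy_ball s p"
    hence u[measurable]: "\<And>n. u n \<in> borel_measurable M" and J: "\<And>n. pintegral M p (u n) \<le> 1" and I: "\<And>n. energy M s p (u n) \<le> 1"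
      by (auto simp: unit_energy_ball_def)
    obtain r v where r: "strict_mono r" and v[measurable]: "v \<in> borel_measurable M"
      and Jv: "pintegral M p v \<le> 1" and Iv: "energy M s p v \<le> 1"
      and lim: "(\<lambda>k. pintegral M q (\<lambda>x. u (r k) x - v x)) \<longlonglongrightarrow> 0"
        "(\<lambda>k. energy M s' q (\<lambda>x. u (r k) x - v x)) \<longlonglongrightarrow> 0"
      by (rule energy_compactness[OF p s(1-3) sub u J I]) (erule (5) that)
    have "(\<lambda>i. ennreal k * energy M s' q (\<lambda>x. u (r i) x - v x) + pintegral M q (\<lambda>x. u (r i) x - v x)) \<longlonglongrightarrow> ennreal k * 0 + 0"
      by (intro tendsto_add ennreal_tendsto_cmult lim) auto
    hence "(\<lambda>i. ennpowr (ennreal k * energy M s' q (\<lambda>x. u (r i) x - v x) + pintegral M q (\<lambda>x. u (r i) x - v x)) (1 / q)) \<longlonglongrightarrow> 0"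
      using p by (intro ennpowr_tendsto_0) auto
    moreover have "(\<lambda>x. u (r i) x - v x) \<in> borel_measurable M" for i by measurable
    ultimately have "(\<lambda>i. sobolev_norm s' q \<Omega> (\<lambda>x. u (r i) x - v x)) \<longlonglongrightarrow> 0" by (simp add: norm_eq)
    thus "\<exists>r v. strict_mono (r :: nat \<Rightarrow> nat) \<and> v \<in> unit_energy_ball s p \<and> (\<lambda>k. sobolev_norm s' q \<Omega> (\<lambda>x. u (r k) x - v x)) \<longlonglongrightarrow> 0"
      using r v Jv Iv by (intro exI[of _ r] exI[of _ v]) (simp add: unit_energy_ball_def)
  qed (use c fin K k in \<open>auto simp: unit_energy_ball_def\<close>)
qed

end

lemma sobolev_norm_finite:
  assumes "0 < p" "u \<in> sobolev_space s p \<Omega>"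
  shows "sobolev_norm s p \<Omega> u < \<infinity>"
proof -
  have "sobolev_seminorm s p \<Omega> u < top" "Lp_norm p \<Omega> u < top" using assms by (auto simp: sobolev_space_def Lp_space_def)
  thus ?thesis by (simp add: sobolev_norm_def)
qed

lemma sobolev_compact_embedding:
  fixes s p s' q :: real and \<Omega> :: "'a::euclidean_space set"
  assumes s: "0 < s" "s \<le> 1" and p: "1 \<le> p" and sp: "s * p < real DIM('a)"
    and \<Omega>: "open \<Omega>" "bounded \<Omega>" "lipschitz_boundary \<Omega>"
    and s': "0 \<le> s'" "s' < s" and q: "1 \<le> q" and sub: "real DIM('a) / p - s < real DIM('a) / q - s'"
  shows "sobolev_compactly_embedded \<Omega> (s, p) (s', q)"
proof -
  from cone_cover_exists[OF \<Omega>] obtain X r e \<rho> \<delta> t0 where "cone_cover \<Omega> X r e \<rho> \<delta> t0" by blast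
  then interpret cone_cover \<Omega> X r e \<rho> \<delta> t0 .
  have fin: "sobolev_norm s p \<Omega> u < \<infinity>" if "u \<in> sobolev_space s p \<Omega>" for u
    using that p by (intro sobolev_norm_finite) auto
  show ?thesis
  proof (cases "s = 1")
    case False
    hence s1: "s < 1" using s by simp
    show ?thesis unfolding sobolev_compactly_embedded_def
      using compactly_embedded_if_unit_energy_ball[OF p q sp s' s1 sub fin fractional_ball[OF s(1) s1 p]] by simp
  next
    case True
    \<comment> \<open>Half of each available slack: \<open>\<sigma>\<close> stays above
      \<open>s'\<close>, and the strict inequality survives lowering the order from 1 to
      \<open>\<sigma>\<close>.\<close>
    define d where "d = min ((1 - s') / 2) ((real DIM('a) / q - s' - (real DIM('a) / p - s)) / 2)"
    have d: "d \<le> (1 - s') / 2" "d \<le> (real DIM('a) / q - s' - (real DIM('a) / p - s)) / 2" "0 < d"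
      unfolding d_def by (rule min.cobounded1, rule min.cobounded2) (use s' sub True in simp)
    define \<sigma> where "\<sigma> = 1 - d"
    have \<sigma>: "0 < \<sigma>" "\<sigma> < 1" "s' < \<sigma>" "real DIM('a) / p - \<sigma> < real DIM('a) / q - s'"
      using d s' sub True by (auto simp: \<sigma>_def)
    have "\<sigma> * p \<le> s * p" using \<sigma> True p by (intro mult_right_mono) auto
    hence sp': "\<sigma> * p < DIM('a)" using sp by linarith
    show ?thesis unfolding sobolev_compactly_embedded_def True
      using compactly_embedded_if_unit_energy_ball[OF p q sp' s'(1) \<sigma>(3,2,4) fin[unfolded True] gradient_ball[OF \<sigma>(1,2) p]] by simp
  qed
qed

theorem corollary1p4:
  fixes s p s' p' :: real and \<Omega> :: "'a::euclidean_space set" and \<gamma> :: "real \<Rightarrow> real \<times> real"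
  assumes "0 < s" "s \<le> 1" and "1 \<le> p"
    and "s * p < real DIM('a)" and "s \<noteq> p"
    and "open \<Omega>" "connected \<Omega>" "bounded \<Omega>" "lipschitz_boundary \<Omega>"
    and "0 \<le> s'" "s' < s"
    and "1 \<le> p'" "p' < real DIM('a) * p / (real DIM('a) - (s - s') * p)"
    and "\<And>\<theta>. \<theta> \<in> {0..1} \<Longrightarrow>
           \<gamma> \<theta> = (\<theta> * s' + (1 - \<theta>) * s, p * p' / (p' + \<theta> * (p - p')))"
  shows "sobolev_compactly_embedded \<Omega> (s, p) (s', p') \<and>
    (\<forall>\<theta>1 \<theta>2. 0 < \<theta>1 \<and> \<theta>1 < \<theta>2 \<and> \<theta>2 \<le> 1 \<longrightarrow>
       sobolev_compactly_embedded \<Omega> (\<gamma> \<theta>1) (\<gamma> \<theta>2))"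
proof -
  define n where "n = real DIM('a)"
  have n: "0 < n" by (simp add: n_def)
  have "(s - s') * p \<le> s * p" using assms by (intro mult_right_mono) auto
  hence den: "0 < n - (s - s') * p" using assms(4) by (simp add: n_def)
  \<comment> \<open>Dividing this by p p' compares the differential dimensions of the two
    spaces.\<close>
  have "p' * (n - (s - s') * p) < n * p"
    using assms(13) den by (simp add: n_def less_divide_eq)
  hence sub0: "n / p - s < n / p' - s'"
    using assms(3,12) by (simp add: field_simps)
  define A where "A = n / p"
  define B where "B = n / p'"
  have sub: "A - s < B - s'" using sub0 by (simp add: A_def B_def)
  define S where "S \<theta> = \<theta> * s' + (1 - \<theta>) * s" for \<theta>
  define Q where "Q \<theta> = p * p' / (p' + \<theta> * (p - p'))" for \<theta>
  have Q: "1 \<le> Q \<theta>" "n / Q \<theta> = (1 - \<theta>) * A + \<theta> * B" if \<theta>: "0 \<le> \<theta>" "\<theta> \<le> 1" for \<theta>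
  proof -
    have D: "p' + \<theta> * (p - p') = (1 - \<theta>) * p' + \<theta> * p" by (simp add: algebra_simps)
    have "min p p' = (1 - \<theta>) * min p p' + \<theta> * min p p'" by (simp add: algebra_simps)
    also have "\<dots> \<le> (1 - \<theta>) * p' + \<theta> * p" using \<theta> by (intro add_mono mult_left_mono) auto
    finally have pos: "0 < (1 - \<theta>) * p' + \<theta> * p" using assms(3,12) by linarith
    \<comment> \<open>The denominator is a convex combination of p' and p, each at most p p' because
      both are at least 1.\<close>
    have "(1 - \<theta>) * p' \<le> (1 - \<theta>) * (p * p')" "\<theta> * p \<le> \<theta> * (p * p')"
      using \<theta> assms(3,12) by (auto intro!: mult_left_mono)
    hence "(1 - \<theta>) * p' + \<theta> * p \<le> p * p'" by (simp add: algebra_simps)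
    thus "1 \<le> Q \<theta>" unfolding Q_def D using pos by (simp add: le_divide_eq)
    show "n / Q \<theta> = (1 - \<theta>) * A + \<theta> * B"
      unfolding Q_def D A_def B_def using pos assms(3,12) by (simp add: field_simps)
  qed
  have "sobolev_compactly_embedded \<Omega> (\<gamma> \<theta>1) (\<gamma> \<theta>2)" if \<theta>: "0 < \<theta>1" "\<theta>1 < \<theta>2" "\<theta>2 \<le> 1" for \<theta>1 \<theta>2
  proof -
    have \<gamma>: "\<gamma> \<theta>1 = (S \<theta>1, Q \<theta>1)" "\<gamma> \<theta>2 = (S \<theta>2, Q \<theta>2)"
      using assms(14)[of \<theta>1] assms(14)[of \<theta>2] \<theta> by (auto simp: S_def Q_def)
    have mono: "S \<theta>2 < S \<theta>1"
    proof -
      have "S \<theta>1 - S \<theta>2 = (\<theta>2 - \<theta>1) * (s - s')" by (simp add: S_def algebra_simps)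
      also have "\<dots> > 0" using \<theta> assms by (intro mult_pos_pos) auto
      finally show ?thesis by simp
    qed
    have S2: "0 \<le> S \<theta>2" using \<theta> assms by (simp add: S_def)
    have S1: "S \<theta>1 \<le> 1"
    proof -
      have "S \<theta>1 \<le> \<theta>1 * 1 + (1 - \<theta>1) * 1" unfolding S_def using \<theta> assms by (intro add_mono mult_left_mono) auto
      thus ?thesis by simp
    qed
    have sub': "n / Q \<theta>1 - S \<theta>1 < n / Q \<theta>2 - S \<theta>2"
    proof -
      have "(n / Q \<theta>2 - S \<theta>2) - (n / Q \<theta>1 - S \<theta>1) = (\<theta>2 - \<theta>1) * ((B - s') - (A - s))"
        using \<theta> by (simp add: Q(2) S_def algebra_simps)
      also have "\<dots> > 0" using \<theta> sub by (intro mult_pos_pos) auto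
      finally show ?thesis by simp
    qed
    have "S \<theta>1 * Q \<theta>1 < n"
    proof -
      \<comment> \<open>The differential dimension is positive at \<theta> = 0 and increases along
        the curve, so every intermediate space satisfies the hypothesis on a source.\<close>
      have "0 < A - s" using assms(3,4) by (simp add: A_def n_def field_simps)
      also have "\<dots> \<le> (A - s) + \<theta>1 * ((B - s') - (A - s))" using \<theta> sub by auto
      also have "\<dots> = n / Q \<theta>1 - S \<theta>1" using \<theta> by (simp add: Q(2) S_def algebra_simps)
      finally have "S \<theta>1 < n / Q \<theta>1" by simp
      thus ?thesis using Q(1)[of \<theta>1] \<theta> by (simp add: less_divide_eq)
    qed
    thus ?thesis unfolding \<gamma> using mono S1 S2 sub' \<theta> assms(6,8,9)
      by (intro sobolev_compact_embedding Q(1)) (auto simp: n_def)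
  qed
  moreover have "sobolev_compactly_embedded \<Omega> (s, p) (s', p')"
    using assms sub0 by (intro sobolev_compact_embedding) (auto simp: n_def)
  ultimately show ?thesis by blast
qed

end
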